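(* Let $X$ be a complex Banach space with the approximation property. Let $A,B\in\mathcal{N}(X)$ be negative operators on $X$ such that $D(A)\subseteq D(B)$ and $A-B$ is nuclear. Then there exist a domain $\Omega_{A,B}$ of the form $S_\theta\cup B_\delta(0)$ with $\theta\in(0,\pi/2)$, $\delta>0$, and an analytic continuation (again denoted $\xi_{A,B}$) of the spectral shift function $\xi_{A,B}:(0,\infty)\to\mathbb{C}$ into the closure of $\Omega_{A,B}$, such that for every $\varphi\in\mathcal{OM}_-$ with $\varphi'(-0)\neq\infty$ and $$\int_0^\infty\frac{|\varphi(-x)|}{1+x^2}\,dx<\infty\qquad(\ast)$$ the following trace formula holds: $$\mathrm{tr}(\varphi(A)-\varphi(B))=\frac{1}{2\pi i}\int_{\Gamma_{A,B}}\xi_{A,B}(z)\varphi'(z)\,dz,\qquad(LK)$$ where $\Gamma_{A,B}$ denotes the positively oriented boundary of $\Omega_{A,B}$. Conversely, if $\varphi\in\mathcal{OM}_-$ with $\varphi'(-0)\ne\infty$ is such that formula $(LK)$ holds for every pair $(A,B)$ of negative operators on the one-dimensional complex space $\mathbb{C}$, then $\varphi$ satisfies condition $(\ast)$.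
   Context: $R(t,A)=(tI-A)^{-1}$ is the resolvent and $\rho(A)$ the resolvent set. A closed densely defined operator $A$ on $X$ is nonpositive, $A\in\mathcal{NP}(X)$, if $(0,\infty)\subset\rho(A)$ and $\sup_{t>0}\|tR(t,A)\|<\infty$; it is negative, $A\in\mathcal{N}(X)$, if $[0,\infty)\subset\rho(A)$ and $\sup_{t>0}\|(1+t)R(t,A)\|<\infty$. Clearly $\mathcal{N}(X)\subset\mathcal{NP}(X)$. $\mathcal{OM}_-$ denotes the class of negative complete Bernstein (equivalently, negative operator monotone) functions, normalized to have no affine part, i.e. the functions $\varphi(z)=\int_{(0,\infty)}\frac{z}{t-z}\,d\mu(t)$, $z\in\mathbb{C}\setminus(0,\infty)$, where $\mu$ is a (unique) positive measure on $(0,\infty)$ with $\int_{(0,\infty)}\frac{d\mu(t)}{1+t}<\infty$. Put $\varphi'(-0)=\lim_{s\to0,\,s<0}\varphi'(s)\in[0,\infty]$. For $A\in\mathcal{NP}(X)$ and $\varphi\in\mathcal{OM}_-$, $\varphi(A)$ is the closure of the operator $x\mapsto\int_{(0,\infty)}AR(t,A)x\,d\mu(t)$, $x\in D(A)$. If $D(A)\subseteq D(B)$, the differences $A-B$ and $\varphi(A)-\varphi(B)$ are considered on the dense subspace $D(A)$; when bounded there they are identified with their bounded extensions to $X$, and "$A-B$ is nuclear" refers to this extension. An operator on $X$ is nuclear if it is the sum of a series of rank one operators absolutely convergent in operator norm; since $X$ has the approximation property, nuclear operators have a well-defined trace $\mathrm{tr}$. For $\lambda>0$ the function $\psi_\lambda(s)=\log\lambda-\log(\lambda-s)$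 belongs to $\mathcal{OM}_-$ (with measure $t^{-1}dt$ on $(\lambda,\infty)$), and $\log(\lambda I-A):=(\log\lambda)I-\psi_\lambda(A)$. For $A,B\in\mathcal{NP}(X)$ with $D(A)\subseteq D(B)$ and $A-B$ nuclear, the operator $\log(\lambda I-A)-\log(\lambda I-B)=\psi_\lambda(B)-\psi_\lambda(A)$ is nuclear, and the spectral shift function is $\xi_{A,B}(\lambda)=\mathrm{tr}(\log(\lambda I-A)-\log(\lambda I-B))$, $\lambda>0$. $S_\theta=\{z\neq0:|\arg z|<\theta\}$ and $B_\delta(0)$ is the open disc of radius $\delta$ centered at $0$. Analytic continuation into the closure of a domain means a holomorphic extension to a neighborhood of that closure. *)

theory Defs
  imports "HOL-Complex_Analysis.Complex_Analysis"
begin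

section \<open>Complex Banach spaces\<close>

(* The distribution only has real Banach spaces as a type class. *)
class complex_banach = banach +
  fixes scaleC :: "complex \<Rightarrow> 'a \<Rightarrow> 'a"  (infixr "*\<^sub>C" 75)
  assumes scaleC_add_right: "c *\<^sub>C (x + y) = c *\<^sub>C x + c *\<^sub>C y"
    and scaleC_add_left: "(c + d) *\<^sub>C x = c *\<^sub>C x + d *\<^sub>C x"
    and scaleC_scaleC: "c *\<^sub>C d *\<^sub>C x = (c * d) *\<^sub>C x"
    and scaleR_scaleC: "r *\<^sub>R x = complex_of_real r *\<^sub>C x"
    and norm_scaleC: "norm (c *\<^sub>C x) = cmod c * norm x"

instantiation complex :: complex_banach
begin

definition scaleC_complex_def: "c *\<^sub>C (x :: complex) = c * x"

instance
  by standard (auto simp: scaleC_complex_def algebra_simps norm_mult scaleR_conv_of_real)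

end

definition bounded_clinear :: "('a::complex_banach \<Rightarrow> 'b::complex_banach) \<Rightarrow> bool" where
  "bounded_clinear T \<longleftrightarrow> bounded_linear T \<and> (\<forall>c x. T (c *\<^sub>C x) = c *\<^sub>C T x)"

definition finite_rank :: "('a::complex_banach \<Rightarrow> 'b::complex_banach) \<Rightarrow> bool" where
  "finite_rank T \<longleftrightarrow> bounded_clinear T \<and>
     (\<exists>S. finite S \<and> range T \<subseteq> module.span ((*\<^sub>C) :: complex \<Rightarrow> 'b \<Rightarrow> 'b) S)"

definition approximation_property :: "'a::complex_banach itself \<Rightarrow> bool" where
  "approximation_property _ \<longleftrightarrow>
     (\<forall>K :: 'a set. compact K \<longrightarrow> (\<forall>\<epsilon>>0. \<exists>F :: 'a \<Rightarrow> 'a. finite_rank F \<and>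
        (\<forall>x\<in>K. norm (F x - x) < \<epsilon>)))"


section \<open>Nuclear operators and their trace\<close>

(* T is the sum of the operators x |-> f n x *C y n, which are of rank at most one (zero terms
   are allowed, so that finite sums are covered). As the series converges absolutely in operator
   norm, its pointwise sum is its sum in operator norm. *)
definition nuclear_series ::
  "(nat \<Rightarrow> 'a::complex_banach \<Rightarrow> complex) \<Rightarrow> (nat \<Rightarrow> 'a) \<Rightarrow> ('a \<Rightarrow> 'a) \<Rightarrow> bool" where
  "nuclear_series f y T \<longleftrightarrow>
     (\<forall>n. bounded_clinear (f n)) \<and>
     summable (\<lambda>n. onorm (\<lambda>x. f n x *\<^sub>C y n)) \<and>
     (\<forall>x. (\<lambda>n. f n x *\<^sub>C y n) sums T x)"

definition nuclear :: "('a::complex_banach \<Rightarrow> 'a) \<Rightarrow> bool" where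
  "nuclear T \<longleftrightarrow> (\<exists>f y. nuclear_series f y T)"

(* Independent of the representation if the space has the approximation property. *)
definition nuclear_trace :: "('a::complex_banach \<Rightarrow> 'a) \<Rightarrow> complex" where
  "nuclear_trace T = (THE c. \<exists>f y. nuclear_series f y T \<and> c = (\<Sum>n. f n (y n)))"


section \<open>Unbounded operators\<close>

(* An operator is given by its graph; its domain is Domain A, and its closure is the topological
   closure of the graph in the product space. *)
type_synonym 'a oper = "('a \<times> 'a) set"

definition linear_oper :: "'a::complex_banach oper \<Rightarrow> bool" where
  "linear_oper A \<longleftrightarrow> single_valued A \<and> (0, 0) \<in> A \<and>
     (\<forall>x y x' y'. (x, y) \<in> A \<longrightarrow> (x', y') \<in> A \<longrightarrow> (x + x', y + y') \<in> A) \<and>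
     (\<forall>c x y. (x, y) \<in> A \<longrightarrow> (c *\<^sub>C x, c *\<^sub>C y) \<in> A)"

definition app :: "'a oper \<Rightarrow> 'a \<Rightarrow> 'a" where
  "app A x = (THE y. (x, y) \<in> A)"

definition scalar_minus :: "complex \<Rightarrow> 'a::complex_banach oper \<Rightarrow> 'a oper" where
  "scalar_minus z A = {(x, z *\<^sub>C x - y) | x y. (x, y) \<in> A}"

definition resolvent :: "complex \<Rightarrow> 'a::complex_banach oper \<Rightarrow> 'a \<Rightarrow> 'a" where
  "resolvent z A = app ((scalar_minus z A)\<inverse>)"

definition resolvent_set :: "'a::complex_banach oper \<Rightarrow> complex set" where
  "resolvent_set A =
     {z. bij_betw (app (scalar_minus z A)) (Domain A) UNIV \<and> bounded_clinear (resolvent z A)}"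

definition negative_oper :: "'a::complex_banach oper \<Rightarrow> bool" where
  "negative_oper A \<longleftrightarrow>
     linear_oper A \<and> closed A \<and> closure (Domain A) = UNIV \<and>
     complex_of_real ` {0..} \<subseteq> resolvent_set A \<and>
     bdd_above ((\<lambda>t. onorm (\<lambda>x. (1 + t) *\<^sub>R resolvent (of_real t) A x)) ` {0<..})"

definition difference_on ::
  "'a::complex_banach set \<Rightarrow> 'a oper \<Rightarrow> 'a oper \<Rightarrow> ('a \<Rightarrow> 'a) \<Rightarrow> bool" where
  "difference_on D A B T \<longleftrightarrow>
     bounded_clinear T \<and> D \<subseteq> Domain A \<and> D \<subseteq> Domain B \<and> (\<forall>x\<in>D. T x = app A x - app B x)"

(* In the following two definitions D is a dense subspace, so that the bounded extension T of the
   difference on D is unique. *)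
definition nuclear_difference :: "'a::complex_banach set \<Rightarrow> 'a oper \<Rightarrow> 'a oper \<Rightarrow> bool" where
  "nuclear_difference D A B \<longleftrightarrow> (\<exists>T. difference_on D A B T \<and> nuclear T)"

definition trace_difference :: "'a::complex_banach set \<Rightarrow> 'a oper \<Rightarrow> 'a oper \<Rightarrow> complex" where
  "trace_difference D A B = nuclear_trace (THE T. difference_on D A B T)"


section \<open>The class of functions and the functional calculus\<close>

definition OM_measure :: "real measure \<Rightarrow> bool" where
  "OM_measure \<mu> \<longleftrightarrow> sets \<mu> = sets (restrict_space borel {0<..}) \<and>
     (\<integral>\<^sup>+ t. ennreal (1 / (1 + t)) \<partial>\<mu>) < \<infinity>"

definition represents :: "real measure \<Rightarrow> (complex \<Rightarrow> complex) \<Rightarrow> bool" where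
  "represents \<mu> \<phi> \<longleftrightarrow> OM_measure \<mu> \<and>
     (\<forall>z \<in> - (complex_of_real ` {0<..}). \<phi> z = (\<integral>t. z / (of_real t - z) \<partial>\<mu>))"

(* The functions are defined off the positive half-line; the values there are irrelevant. *)
definition OM_minus :: "(complex \<Rightarrow> complex) set" where
  "OM_minus = {\<phi>. \<exists>\<mu>. represents \<mu> \<phi>}"

(* The representing measure is unique. *)
definition repr_measure :: "(complex \<Rightarrow> complex) \<Rightarrow> real measure" where
  "repr_measure \<phi> = (SOME \<mu>. represents \<mu> \<phi>)"

definition deriv_at_minus_zero :: "(complex \<Rightarrow> complex) \<Rightarrow> ereal" where
  "deriv_at_minus_zero \<phi> = Lim (at_left (0::real)) (\<lambda>s. ereal (Re (deriv \<phi> (of_real s))))"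

(* The Bochner integral of functions with values in an arbitrary Banach space: has_bochner_integral
   of HOL-Analysis, word for word, but without its restriction to second countable (separable)
   spaces. *)
definition has_vector_integral ::
  "'m measure \<Rightarrow> ('m \<Rightarrow> 'a::banach) \<Rightarrow> 'a \<Rightarrow> bool" where
  "has_vector_integral M f I \<longleftrightarrow> f \<in> borel_measurable M \<and>
     (\<exists>s. (\<forall>i. Bochner_Integration.simple_bochner_integrable M (s i)) \<and>
          (\<lambda>i. \<integral>\<^sup>+ t. ennreal (norm (f t - s i t)) \<partial>M) \<longlonglongrightarrow> 0 \<and>
          (\<lambda>i. Bochner_Integration.simple_bochner_integral M (s i)) \<longlonglongrightarrow> I)"

definition oper_fun :: "(complex \<Rightarrow> complex) \<Rightarrow> 'a::complex_banach oper \<Rightarrow> 'a oper" where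
  "oper_fun \<phi> A = closure {(x, y). x \<in> Domain A \<and>
     has_vector_integral (repr_measure \<phi>) (\<lambda>t. app A (resolvent (of_real t) A x)) y}"


section \<open>The spectral shift function\<close>

definition psi :: "real \<Rightarrow> complex \<Rightarrow> complex" where
  "psi l s = of_real (ln l) - Ln (of_real l - s)"

definition log_oper :: "real \<Rightarrow> 'a::complex_banach oper \<Rightarrow> 'a oper" where
  "log_oper l A = scalar_minus (of_real (ln l)) (oper_fun (psi l) A)"

definition spectral_shift :: "'a::complex_banach oper \<Rightarrow> 'a oper \<Rightarrow> real \<Rightarrow> complex" where
  "spectral_shift A B l = trace_difference (Domain A) (log_oper l A) (log_oper l B)"


section \<open>The domain, its boundary, and the trace formula\<close>

definition Omega :: "real \<Rightarrow> real \<Rightarrow> complex set" where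
  "Omega \<theta> \<delta> = {z. z \<noteq> 0 \<and> \<bar>Arg z\<bar> < \<theta>} \<union> ball 0 \<delta>"

(* The positively oriented boundary of Omega runs inwards along the ray of argument \<theta>, along the
   circle of radius \<delta> from argument \<theta> to 2 * pi - \<theta>, and outwards along the ray of argument -\<theta>.
   The integral along the two rays is absolutely convergent (Lebesgue). *)
definition Gamma_integrable :: "real \<Rightarrow> real \<Rightarrow> (complex \<Rightarrow> complex) \<Rightarrow> bool" where
  "Gamma_integrable \<theta> \<delta> g \<longleftrightarrow>
     set_integrable lborel {\<delta>..} (\<lambda>r. g (of_real r * cis \<theta>) * cis \<theta>) \<and>
     g contour_integrable_on part_circlepath 0 \<delta> \<theta> (2 * pi - \<theta>) \<and>
     set_integrable lborel {\<delta>..} (\<lambda>r. g (of_real r * cis (- \<theta>)) * cis (- \<theta>))"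

definition Gamma_integral :: "real \<Rightarrow> real \<Rightarrow> (complex \<Rightarrow> complex) \<Rightarrow> complex" where
  "Gamma_integral \<theta> \<delta> g =
     - (LINT r:{\<delta>..}|lborel. g (of_real r * cis \<theta>) * cis \<theta>)
     + contour_integral (part_circlepath 0 \<delta> \<theta> (2 * pi - \<theta>)) g
     + (LINT r:{\<delta>..}|lborel. g (of_real r * cis (- \<theta>)) * cis (- \<theta>))"

(* analytic_on a set means holomorphic on some open neighbourhood of it. *)
definition shift_continuation ::
  "'a::complex_banach oper \<Rightarrow> 'a oper \<Rightarrow> real \<Rightarrow> real \<Rightarrow> (complex \<Rightarrow> complex) \<Rightarrow> bool" where
  "shift_continuation A B \<theta> \<delta> \<xi> \<longleftrightarrow>
     \<xi> analytic_on closure (Omega \<theta> \<delta>) \<and> (\<forall>l>0. \<xi> (of_real l) = spectral_shift A B l)"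

definition LK_formula ::
  "'a::complex_banach oper \<Rightarrow> 'a oper \<Rightarrow> real \<Rightarrow> real \<Rightarrow> (complex \<Rightarrow> complex)
     \<Rightarrow> (complex \<Rightarrow> complex) \<Rightarrow> bool" where
  "LK_formula A B \<theta> \<delta> \<xi> \<phi> \<longleftrightarrow>
     nuclear_difference (Domain A) (oper_fun \<phi> A) (oper_fun \<phi> B) \<and>
     Gamma_integrable \<theta> \<delta> (\<lambda>z. \<xi> z * deriv \<phi> z) \<and>
     trace_difference (Domain A) (oper_fun \<phi> A) (oper_fun \<phi> B) =
       1 / (2 * of_real pi * \<i>) * Gamma_integral \<theta> \<delta> (\<lambda>z. \<xi> z * deriv \<phi> z)"

definition growth_condition :: "(complex \<Rightarrow> complex) \<Rightarrow> bool" where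
  "growth_condition \<phi> \<longleftrightarrow>
     (\<integral>\<^sup>+ x\<in>{0..}. ennreal (cmod (\<phi> (of_real (- x))) / (1 + x\<^sup>2)) \<partial>lborel) < \<infinity>"

end

theory Submission
  imports Defs "HOL-Real_Asymp.Real_Asymp"
begin

text \<open>Let \<open>h z\<close> be the trace of \<open>R(z,A) - R(z,B) = R(z,B) (A - B) R(z,A)\<close>. Since
  \<open>A R(t,A) - B R(t,B) = t (R(t,A) - R(t,B))\<close>, the trace of \<open>\<phi>(A) - \<phi>(B)\<close> is \<open>\<integral> t h(t) d\<mu>(t)\<close>; the case of
  \<open>\<psi>\<^sub>\<lambda>\<close> gives \<open>\<xi>(\<lambda>) = - \<integral> h(t) dt\<close> over \<open>(\<lambda>, \<infinity>)\<close>, so that \<open>\<xi>\<close> extends to the primitive of \<open>h\<close> vanishing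
  at infinity. Integrating Cauchy's formula for \<open>h(t) = \<xi>'(t)\<close> on \<open>\<Gamma>\<close> against \<open>t d\<mu>(t)\<close> and using
  \<open>\<phi>'(z) = \<integral> t / (t - z)\<^sup>2 d\<mu>(t)\<close> yields the trace formula; as \<open>\<xi>(z) = O(1 / \<bar>z\<bar>)\<close>, the growth condition is
  what Fubini's theorem needs.

  Conversely, for the scalars \<open>-1\<close> and \<open>-2\<close> the function \<open>\<xi>(z)\<close> decays exactly like \<open>1 / \<bar>z\<bar>\<close>, so the integral of
  \<open>\<bar>\<phi>'(z)\<bar> / \<bar>z\<bar>\<close> over a ray of \<open>\<Gamma>\<close> is finite. Hardy's inequality turns this into the integral of
  \<open>\<bar>\<phi>(z)\<bar> / \<bar>z\<bar>\<^sup>2\<close>, and \<open>\<bar>\<phi>(z)\<bar>\<close> is comparable to \<open>\<bar>\<phi>(- \<bar>z\<bar>)\<bar>\<close> on the ray because \<open>z / (t - z)\<close> stays in a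
  fixed half-plane for all \<open>t > 0\<close>.\<close>

section \<open>Bochner integrals in non-separable spaces\<close>

text \<open>Nuclear operators are not treated as a normed space, so the trace cannot be pulled
  through an operator-valued integral by continuity. Instead the half-line is cut into short
  intervals on which both resolvents are Neumann series about a real point: the integral of
  \<open>t *\<^sub>R D (of_real t) x\<close> becomes a double series of nuclear operators with
  scalar coefficients, and the trace of such a series is the series of the traces. The radius of
  convergence \<open>(1 + t) / (2 * K)\<close> also dictates the geometry: the discs of these radii
  around the points \<open>t\<close> form a convex open set that contains a sector and a disc about
  0. There \<open>\<xi>\<close> is defined, and there Cauchy's theorem for convex sets applies.
  Cauchy's formula is integrated by parts, so that \<open>h\<close> is traded for its decaying
  primitive and the kernel is squared. The representing measure is an arbitrary choice; since the
  contour integral involves the function alone, the logarithm may be evaluated with an explicit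
  measure.\<close>

text \<open>In a non-separable space sums of Borel functions need not be Borel. Hence the norm of \<open>f - s\<close> is replaced
  by a measurable majorant.\<close>

definition vint :: "'m measure \<Rightarrow> ('m \<Rightarrow> 'a::real_normed_vector) \<Rightarrow> 'a \<Rightarrow> bool" where
  "vint M f I \<longleftrightarrow> (\<forall>\<epsilon>>0. \<exists>s b. Bochner_Integration.simple_bochner_integrable M s \<and> b \<in> borel_measurable M \<and>
     (\<forall>x\<in>space M. ennreal (norm (f x - s x)) \<le> b x) \<and> (\<integral>\<^sup>+x. b x \<partial>M) < ennreal \<epsilon> \<and>
     norm (Bochner_Integration.simple_bochner_integral M s - I) < \<epsilon>)"

lemma vintE:
  assumes "vint M f I" "\<epsilon> > 0"
  obtains s b where "Bochner_Integration.simple_bochner_integrable M s" "b \<in> borel_measurable M"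
     "\<And>x. x \<in> space M \<Longrightarrow> ennreal (norm (f x - s x)) \<le> b x" "(\<integral>\<^sup>+x. b x \<partial>M) < ennreal \<epsilon>"
     "norm (Bochner_Integration.simple_bochner_integral M s - I) < \<epsilon>"
  using assms unfolding vint_def by blast

text \<open>A simple \<open>s\<close> takes finitely many values, and where it equals
  \<open>c\<close> the norm is a continuous function of \<open>f\<close> alone. So no sum of two
  Borel functions has to be measurable.\<close>

lemma borel_measurable_norm_diff_simple:
  fixes f :: "'m \<Rightarrow> 'a::real_normed_vector"
  assumes "f \<in> borel_measurable M" "simple_function M s"
  shows "(\<lambda>x. ennreal (norm (f x - s x))) \<in> borel_measurable M"
proof -
  have "(\<lambda>x. ennreal (norm (f x - s x))) \<in> borel_measurable M"
  proof (rule measurable_compose_countable'[where I = "s ` space M" and g = s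
        and f = "\<lambda>c x. ennreal (norm (f x - c))"])
    fix c assume "c \<in> s ` space M"
    have "continuous_on UNIV (\<lambda>y::'a. norm (y - c))"
      by (intro continuous_intros)
    from borel_measurable_continuous_onI[OF this]
    have "(\<lambda>y::'a. ennreal (norm (y - c))) \<in> borel_measurable borel"
      by measurable
    from measurable_compose[OF assms(1) this]
    show "(\<lambda>x. ennreal (norm (f x - c))) \<in> borel_measurable M" by simp
  next
    show "s \<in> measurable M (count_space (s ` space M))"
      using assms(2) by (auto simp: simple_function_def measurable_count_space_eq2)
    show "countable (s ` space M)"
      using assms(2) by (simp add: simple_function_def countable_finite)
  qed
  then show ?thesis by simp
qed

lemma simple_bochner_simple: "Bochner_Integration.simple_bochner_integrable M s \<Longrightarrow> simple_function M s"
  by (erule simple_bochner_integrable.cases)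

lemma vint_approximation:
  fixes f :: "'m \<Rightarrow> 'a::real_normed_vector"
  assumes f: "f \<in> borel_measurable M" and s: "\<And>i. Bochner_Integration.simple_bochner_integrable M (s i)"
    and lim: "(\<lambda>i. \<integral>\<^sup>+ t. ennreal (norm (f t - s i t)) \<partial>M) \<longlonglongrightarrow> 0"
      "(\<lambda>i. Bochner_Integration.simple_bochner_integral M (s i)) \<longlonglongrightarrow> I"
  shows "vint M f I"
  unfolding vint_def
proof (intro allI impI)
  fix \<epsilon> :: real assume e: "\<epsilon> > 0"
  have "\<forall>\<^sub>F i in sequentially. (\<integral>\<^sup>+ t. ennreal (norm (f t - s i t)) \<partial>M) < ennreal \<epsilon>"
    using lim(1) e by (intro order_tendstoD) auto
  moreover have "\<forall>\<^sub>F i in sequentially. norm (Bochner_Integration.simple_bochner_integral M (s i) - I) < \<epsilon>"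
    using lim(2) e by (auto simp: tendsto_iff dist_norm)
  ultimately obtain i where "(\<integral>\<^sup>+ t. ennreal (norm (f t - s i t)) \<partial>M) < ennreal \<epsilon>"
    "norm (Bochner_Integration.simple_bochner_integral M (s i) - I) < \<epsilon>"
    using eventually_happens[OF eventually_conj] by force
  then show "\<exists>s b. Bochner_Integration.simple_bochner_integrable M s \<and> b \<in> borel_measurable M \<and>
     (\<forall>x\<in>space M. ennreal (norm (f x - s x)) \<le> b x) \<and> (\<integral>\<^sup>+x. b x \<partial>M) < ennreal \<epsilon> \<and>
     norm (Bochner_Integration.simple_bochner_integral M s - I) < \<epsilon>"
    using s[of i] borel_measurable_norm_diff_simple[OF f simple_bochner_simple[OF s[of i]]]
    by (intro exI[of _ "s i"] exI[of _ "\<lambda>t. ennreal (norm (f t - s i t))"]) auto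
qed

text \<open>From right to left, the accuracies \<open>1 / Suc i\<close> produce the approximating
  sequence. Measurability is thereby split off and has to be checked only for the final integrand,
  while \<open>vint\<close> alone is stable under sums, bounded linear maps and limits.\<close>

lemma has_vector_integral_iff_vint:
  "has_vector_integral M f I \<longleftrightarrow> f \<in> borel_measurable M \<and> vint M f I"
proof safe
  assume "has_vector_integral M f I"
  then show "f \<in> borel_measurable M" "vint M f I"
    unfolding has_vector_integral_def by (auto intro: vint_approximation)
next
  assume f: "f \<in> borel_measurable M" and v: "vint M f I"
  have "\<forall>i. \<exists>s b. Bochner_Integration.simple_bochner_integrable M s \<and> b \<in> borel_measurable M \<and>
     (\<forall>x\<in>space M. ennreal (norm (f x - s x)) \<le> b x) \<and> (\<integral>\<^sup>+x. b x \<partial>M) < ennreal (1 / Suc i) \<and>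
     norm (Bochner_Integration.simple_bochner_integral M s - I) < 1 / Suc i"
    using v unfolding vint_def by auto
  then obtain s b where sb: "\<And>i. Bochner_Integration.simple_bochner_integrable M (s i)"
     "\<And>i x. x\<in>space M \<Longrightarrow> ennreal (norm (f x - s i x)) \<le> b i x"
     "\<And>i. (\<integral>\<^sup>+x. b i x \<partial>M) < ennreal (1 / Suc i)"
     "\<And>i. norm (Bochner_Integration.simple_bochner_integral M (s i) - I) < 1 / Suc i"
    by metis
  have z: "(\<lambda>i. 1 / real (Suc i)) \<longlonglongrightarrow> 0"
    by (rule LIMSEQ_Suc[OF lim_1_over_n])
  have "(\<lambda>i. \<integral>\<^sup>+ t. ennreal (norm (f t - s i t)) \<partial>M) \<longlonglongrightarrow> 0"
  proof (rule tendsto_sandwich[OF _ _ tendsto_const])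
    show "\<forall>\<^sub>F i in sequentially. (\<integral>\<^sup>+ t. ennreal (norm (f t - s i t)) \<partial>M) \<le> ennreal (1 / Suc i)"
      using sb(2,3) by (intro always_eventually allI) (meson le_less_trans less_imp_le nn_integral_mono)
    show "(\<lambda>i. ennreal (1 / real (Suc i))) \<longlonglongrightarrow> 0"
      using tendsto_ennrealI[OF z] by simp
  qed auto
  moreover have "(\<lambda>i. Bochner_Integration.simple_bochner_integral M (s i)) \<longlonglongrightarrow> I"
    by (rule LIM_zero_cancel, rule tendsto_norm_zero_cancel,
        rule tendsto_sandwich[OF _ _ tendsto_const z])
       (use sb(4) in \<open>auto intro!: always_eventually less_imp_le\<close>)
  ultimately show "has_vector_integral M f I"
    unfolding has_vector_integral_def using f sb(1) by blast
qed

lemma vint_cong: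
  assumes "\<And>x. x \<in> space M \<Longrightarrow> f x = g x"
  shows "vint M f I \<longleftrightarrow> vint M g I"
  unfolding vint_def using assms by (simp cong: ball_cong)

lemma vint_integrable:
  fixes f :: "'m \<Rightarrow> 'a::{banach, second_countable_topology}"
  assumes "integrable M f"
  shows "vint M f (integral\<^sup>L M f)"
  using has_bochner_integral_integrable[OF assms]
  by (elim has_bochner_integral.cases) (auto intro: vint_approximation)

lemma vint_linear:
  assumes "bounded_linear T" "vint M f I"
  shows "vint M (\<lambda>x. T (f x)) (T I)"
  unfolding vint_def
proof (intro allI impI)
  interpret T: bounded_linear T by fact
  obtain K where K: "K > 0" "\<And>x. norm (T x) \<le> norm x * K"
    using T.pos_bounded by blast
  fix \<epsilon> :: real assume e: "\<epsilon> > 0"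
  obtain s b where s: "Bochner_Integration.simple_bochner_integrable M s" "b \<in> borel_measurable M"
     "\<And>x. x \<in> space M \<Longrightarrow> ennreal (norm (f x - s x)) \<le> b x" "(\<integral>\<^sup>+x. b x \<partial>M) < ennreal (\<epsilon> / K)"
     "norm (Bochner_Integration.simple_bochner_integral M s - I) < \<epsilon> / K"
    using vintE[OF assms(2), of "\<epsilon> / K"] e K(1) by auto
  have "Bochner_Integration.simple_bochner_integrable M (\<lambda>x. T (s x))"
    by (rule simple_bochner_integrable_compose2[where p = "\<lambda>x y. T x", OF T.zero s(1) s(1)])
  moreover have "ennreal (norm (T (f x) - T (s x))) \<le> ennreal K * b x" if "x \<in> space M" for x
  proof -
    have "ennreal (norm (T (f x) - T (s x))) \<le> ennreal (K * norm (f x - s x))"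
      using K(2)[of "f x - s x"] by (intro ennreal_leI) (simp add: T.diff mult.commute)
    also have "\<dots> = ennreal K * ennreal (norm (f x - s x))"
      using K(1) by (simp add: ennreal_mult)
    also have "\<dots> \<le> ennreal K * b x"
      using s(3)[OF that] by (rule mult_left_mono) simp
    finally show ?thesis .
  qed
  moreover have "(\<integral>\<^sup>+x. ennreal K * b x \<partial>M) < ennreal \<epsilon>"
  proof -
    have "(\<integral>\<^sup>+x. ennreal K * b x \<partial>M) = ennreal K * (\<integral>\<^sup>+x. b x \<partial>M)"
      by (rule nn_integral_cmult[OF s(2)])
    also have "\<dots> < ennreal K * ennreal (\<epsilon> / K)"
      using s(4) K(1) by (intro ennreal_mult_strict_left_mono) auto
    also have "\<dots> = ennreal \<epsilon>"
      using K(1) e by (subst ennreal_mult[symmetric]) auto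
    finally show ?thesis .
  qed
  moreover have "norm (Bochner_Integration.simple_bochner_integral M (\<lambda>x. T (s x)) - T I) < \<epsilon>"
  proof -
    have "Bochner_Integration.simple_bochner_integral M (\<lambda>x. T (s x)) - T I = T (Bochner_Integration.simple_bochner_integral M s - I)"
      using simple_bochner_integral_linear[OF T.linear_axioms s(1)] by (simp add: T.diff)
    also have "norm \<dots> \<le> norm (Bochner_Integration.simple_bochner_integral M s - I) * K"
      by (rule K)
    also have "\<dots> < \<epsilon>"
      using s(5) K(1) by (simp add: field_simps)
    finally show ?thesis .
  qed
  ultimately show "\<exists>s b. Bochner_Integration.simple_bochner_integrable M s \<and> b \<in> borel_measurable M \<and>
     (\<forall>x\<in>space M. ennreal (norm (T (f x) - s x)) \<le> b x) \<and> (\<integral>\<^sup>+x. b x \<partial>M) < ennreal \<epsilon> \<and>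
     norm (Bochner_Integration.simple_bochner_integral M s - T I) < \<epsilon>"
    using s(2) by (intro exI[of _ "\<lambda>x. T (s x)"] exI[of _ "\<lambda>x. ennreal K * b x"]) auto
qed

lemma vint_scaleR:
  assumes "integrable M g"
  shows "vint M (\<lambda>x. g x *\<^sub>R v) ((\<integral>x. g x \<partial>M) *\<^sub>R v)"
  using vint_linear[OF bounded_linear_scaleR_left vint_integrable[OF assms]] .

text \<open>Approximation in mean by integrable functions is followed by approximation of those by
  simple functions, with half of \<open>\<epsilon>\<close> spent on each; the measurable majorants
  add up.\<close>

lemma vint_limit:
  assumes "\<And>\<epsilon>. \<epsilon> > 0 \<Longrightarrow> \<exists>g J b. vint M g J \<and> b \<in> borel_measurable M \<and>
     (\<forall>x\<in>space M. ennreal (norm (f x - g x)) \<le> b x) \<and> (\<integral>\<^sup>+x. b x \<partial>M) < ennreal \<epsilon> \<and> norm (J - I) < \<epsilon>"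
  shows "vint M f I"
  unfolding vint_def
proof (intro allI impI)
  fix \<epsilon> :: real assume e: "\<epsilon> > 0"
  obtain g J b where g: "vint M g J" "b \<in> borel_measurable M"
     "\<And>x. x\<in>space M \<Longrightarrow> ennreal (norm (f x - g x)) \<le> b x" "(\<integral>\<^sup>+x. b x \<partial>M) < ennreal (\<epsilon> / 2)" "norm (J - I) < \<epsilon> / 2"
    using assms[of "\<epsilon> / 2"] e by auto
  obtain s c where s: "Bochner_Integration.simple_bochner_integrable M s" "c \<in> borel_measurable M"
     "\<And>x. x \<in> space M \<Longrightarrow> ennreal (norm (g x - s x)) \<le> c x" "(\<integral>\<^sup>+x. c x \<partial>M) < ennreal (\<epsilon> / 2)"
     "norm (Bochner_Integration.simple_bochner_integral M s - J) < \<epsilon> / 2"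
    using vintE[OF g(1), of "\<epsilon> / 2"] e by auto
  have "ennreal (norm (f x - s x)) \<le> b x + c x" if "x \<in> space M" for x
  proof -
    have "norm (f x - s x) \<le> norm (f x - g x) + norm (g x - s x)"
      using norm_triangle_ineq[of "f x - g x" "g x - s x"] by simp
    then have "ennreal (norm (f x - s x)) \<le> ennreal (norm (f x - g x)) + ennreal (norm (g x - s x))"
      by (simp flip: ennreal_plus add: ennreal_leI)
    also have "\<dots> \<le> b x + c x"
      using g(3) s(3) that by (intro add_mono)
    finally show ?thesis .
  qed
  moreover have "(\<integral>\<^sup>+x. b x + c x \<partial>M) < ennreal \<epsilon>"
  proof -
    have "(\<integral>\<^sup>+x. b x + c x \<partial>M) = (\<integral>\<^sup>+x. b x \<partial>M) + (\<integral>\<^sup>+x. c x \<partial>M)"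
      using g(2) s(2) by (rule nn_integral_add)
    also have "\<dots> < ennreal (\<epsilon> / 2) + ennreal (\<epsilon> / 2)"
      using g(4) s(4) by (rule add_strict_mono)
    also have "\<dots> = ennreal \<epsilon>" using e by (simp flip: ennreal_plus)
    finally show ?thesis .
  qed
  moreover have "norm (Bochner_Integration.simple_bochner_integral M s - I) < \<epsilon>"
    using norm_triangle_ineq[of "Bochner_Integration.simple_bochner_integral M s - J" "J - I"] s(5) g(5) by simp
  ultimately show "\<exists>s b. Bochner_Integration.simple_bochner_integrable M s \<and> b \<in> borel_measurable M \<and>
     (\<forall>x\<in>space M. ennreal (norm (f x - s x)) \<le> b x) \<and> (\<integral>\<^sup>+x. b x \<partial>M) < ennreal \<epsilon> \<and>
     norm (Bochner_Integration.simple_bochner_integral M s - I) < \<epsilon>"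
    using s(1,2) g(2) by (intro exI[of _ s] exI[of _ "\<lambda>x. b x + c x"]) auto
qed

text \<open>The approximating simple function is dominated by \<open>b + c\<close>, where
  \<open>c\<close> has small integral, so its integral and hence \<open>I\<close> are controlled up
  to \<open>\<epsilon>\<close>. Applied to a difference with \<open>b = 0\<close>, this yields
  uniqueness of the integral.\<close>

lemma vint_norm_bound:
  assumes "vint M f I" "b \<in> borel_measurable M" "\<And>x. x \<in> space M \<Longrightarrow> ennreal (norm (f x)) \<le> b x"
  shows "ennreal (norm I) \<le> (\<integral>\<^sup>+x. b x \<partial>M)"
proof (rule ennreal_le_epsilon)
  fix \<epsilon> :: real assume e: "\<epsilon> > 0"
  obtain s c where s: "Bochner_Integration.simple_bochner_integrable M s" "c \<in> borel_measurable M"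
     "\<And>x. x \<in> space M \<Longrightarrow> ennreal (norm (f x - s x)) \<le> c x" "(\<integral>\<^sup>+x. c x \<partial>M) < ennreal (\<epsilon> / 2)"
     "norm (Bochner_Integration.simple_bochner_integral M s - I) < \<epsilon> / 2"
    using vintE[OF assms(1), of "\<epsilon> / 2"] e by auto
  have n: "Bochner_Integration.simple_bochner_integrable M (\<lambda>x. norm (s x))"
    by (rule simple_bochner_integrable_compose2[where p = "\<lambda>x y. norm x", OF norm_zero s(1) s(1)])
  have "norm I \<le> \<epsilon> / 2 + norm (Bochner_Integration.simple_bochner_integral M s)"
    using s(5) norm_triangle_ineq3[of I "Bochner_Integration.simple_bochner_integral M s"] by (simp add: norm_minus_commute)
  also have "\<dots> \<le> \<epsilon> / 2 + Bochner_Integration.simple_bochner_integral M (\<lambda>x. norm (s x))"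
    using simple_bochner_integral_norm_bound[OF s(1)] by simp
  finally have "ennreal (norm I) \<le> ennreal (\<epsilon> / 2) + ennreal (Bochner_Integration.simple_bochner_integral M (\<lambda>x. norm (s x)))"
    using e by (simp flip: ennreal_plus add: ennreal_leI)
  also have "ennreal (Bochner_Integration.simple_bochner_integral M (\<lambda>x. norm (s x))) = (\<integral>\<^sup>+x. norm (s x) \<partial>M)"
    by (rule simple_bochner_integral_eq_nn_integral[OF n]) simp
  also have "\<dots> \<le> (\<integral>\<^sup>+x. b x + c x \<partial>M)"
  proof (rule nn_integral_mono)
    fix x assume x: "x \<in> space M"
    have "norm (s x) \<le> norm (f x) + norm (f x - s x)"
      using norm_triangle_ineq4[of "f x" "f x - s x"] by simp
    then have "ennreal (norm (s x)) \<le> ennreal (norm (f x)) + ennreal (norm (f x - s x))"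
      by (simp flip: ennreal_plus add: ennreal_leI)
    also have "\<dots> \<le> b x + c x"
      using assms(3) s(3) x by (intro add_mono)
    finally show "ennreal (norm (s x)) \<le> b x + c x" .
  qed
  also have "\<dots> = (\<integral>\<^sup>+x. b x \<partial>M) + (\<integral>\<^sup>+x. c x \<partial>M)"
    using assms(2) s(2) by (rule nn_integral_add)
  finally have "ennreal (norm I) \<le> ennreal (\<epsilon> / 2) + ((\<integral>\<^sup>+x. b x \<partial>M) + (\<integral>\<^sup>+x. c x \<partial>M))"
    by (simp add: add_left_mono)
  also have "\<dots> \<le> ennreal (\<epsilon> / 2) + ((\<integral>\<^sup>+x. b x \<partial>M) + ennreal (\<epsilon> / 2))"
    using s(4) by (intro add_left_mono) simp
  also have "\<dots> = (\<integral>\<^sup>+x. b x \<partial>M) + (ennreal (\<epsilon> / 2) + ennreal (\<epsilon> / 2))"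
    by (simp only: ac_simps)
  also have "ennreal (\<epsilon> / 2) + ennreal (\<epsilon> / 2) = ennreal \<epsilon>"
    using e by (simp flip: ennreal_plus)
  finally show "ennreal (norm I) \<le> (\<integral>\<^sup>+x. b x \<partial>M) + ennreal \<epsilon>" .
qed

lemma vint_add:
  assumes "vint M f I" "vint M g J"
  shows "vint M (\<lambda>x. f x + g x) (I + J)"
  unfolding vint_def
proof (intro allI impI)
  fix \<epsilon> :: real assume e: "\<epsilon> > 0"
  obtain s c where s: "Bochner_Integration.simple_bochner_integrable M s" "c \<in> borel_measurable M"
     "\<And>x. x \<in> space M \<Longrightarrow> ennreal (norm (f x - s x)) \<le> c x" "(\<integral>\<^sup>+x. c x \<partial>M) < ennreal (\<epsilon> / 2)"
     "norm (Bochner_Integration.simple_bochner_integral M s - I) < \<epsilon> / 2"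
    using vintE[OF assms(1), of "\<epsilon> / 2"] e by auto
  obtain t d where t: "Bochner_Integration.simple_bochner_integrable M t" "d \<in> borel_measurable M"
     "\<And>x. x \<in> space M \<Longrightarrow> ennreal (norm (g x - t x)) \<le> d x" "(\<integral>\<^sup>+x. d x \<partial>M) < ennreal (\<epsilon> / 2)"
     "norm (Bochner_Integration.simple_bochner_integral M t - J) < \<epsilon> / 2"
    using vintE[OF assms(2), of "\<epsilon> / 2"] e by auto
  have "Bochner_Integration.simple_bochner_integrable M (\<lambda>x. s x + t x)"
    by (rule simple_bochner_integrable_compose2[OF _ s(1) t(1)]) simp
  moreover have "ennreal (norm (f x + g x - (s x + t x))) \<le> c x + d x" if "x \<in> space M" for x
  proof -
    have "norm (f x + g x - (s x + t x)) \<le> norm (f x - s x) + norm (g x - t x)"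
      using norm_triangle_ineq[of "f x - s x" "g x - t x"] by (simp add: algebra_simps)
    then have "ennreal (norm (f x + g x - (s x + t x))) \<le> ennreal (norm (f x - s x)) + ennreal (norm (g x - t x))"
      by (simp flip: ennreal_plus add: ennreal_leI)
    also have "\<dots> \<le> c x + d x"
      using s(3) t(3) that by (intro add_mono)
    finally show ?thesis .
  qed
  moreover have "(\<integral>\<^sup>+x. c x + d x \<partial>M) < ennreal \<epsilon>"
  proof -
    have "(\<integral>\<^sup>+x. c x + d x \<partial>M) = (\<integral>\<^sup>+x. c x \<partial>M) + (\<integral>\<^sup>+x. d x \<partial>M)"
      using s(2) t(2) by (rule nn_integral_add)
    also have "\<dots> < ennreal (\<epsilon> / 2) + ennreal (\<epsilon> / 2)"
      using s(4) t(4) by (rule add_strict_mono)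
    also have "\<dots> = ennreal \<epsilon>" using e by (simp flip: ennreal_plus)
    finally show ?thesis .
  qed
  moreover have "norm (Bochner_Integration.simple_bochner_integral M (\<lambda>x. s x + t x) - (I + J)) < \<epsilon>"
    using norm_triangle_ineq[of "Bochner_Integration.simple_bochner_integral M s - I" "Bochner_Integration.simple_bochner_integral M t - J"] s(5) t(5)
    by (simp add: simple_bochner_integral_add[OF s(1) t(1)] algebra_simps)
  ultimately show "\<exists>s b. Bochner_Integration.simple_bochner_integrable M s \<and> b \<in> borel_measurable M \<and>
     (\<forall>x\<in>space M. ennreal (norm (f x + g x - s x)) \<le> b x) \<and> (\<integral>\<^sup>+x. b x \<partial>M) < ennreal \<epsilon> \<and>
     norm (Bochner_Integration.simple_bochner_integral M s - (I + J)) < \<epsilon>"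
    using s(2) t(2) by (intro exI[of _ "\<lambda>x. s x + t x"] exI[of _ "\<lambda>x. c x + d x"]) auto
qed

lemma vint_diff:
  assumes "vint M f I" "vint M g J"
  shows "vint M (\<lambda>x. f x - g x) (I - J)"
  using vint_add[OF assms(1) vint_linear[OF bounded_linear_minus[OF bounded_linear_ident] assms(2)]]
  by simp

lemma vint_unique:
  assumes "vint M f I" "vint M f J"
  shows "I = J"
proof -
  have "ennreal (norm (I - J)) \<le> (\<integral>\<^sup>+x. 0 \<partial>M)"
    by (rule vint_norm_bound[OF vint_diff[OF assms]]) auto
  then show ?thesis by simp
qed

lemma vint_zero: "vint M (\<lambda>x. 0) 0"
  using vint_scaleR[of M "\<lambda>x. 0" 0] by simp

lemma vint_sum:
  assumes "\<And>k. k \<in> F \<Longrightarrow> vint M (g k) (I k)"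
  shows "vint M (\<lambda>x. \<Sum>k\<in>F. g k x) (\<Sum>k\<in>F. I k)"
  using assms
  by (induction F rule: infinite_finite_induct) (auto intro: vint_add vint_zero)

lemma ennreal_norm_sums_le:
  fixes a :: "nat \<Rightarrow> 'a::real_normed_vector"
  assumes "a sums s" "\<And>k. ennreal (norm (a k)) \<le> b k"
  shows "ennreal (norm s) \<le> suminf b"
proof (rule LIMSEQ_le_const2)
  show "(\<lambda>n. ennreal (norm (\<Sum>k<n. a k))) \<longlonglongrightarrow> ennreal (norm s)"
    using assms(1) unfolding sums_def by (intro tendsto_ennrealI tendsto_norm)
  have "ennreal (norm (\<Sum>k<n. a k)) \<le> suminf b" for n
  proof -
    have "ennreal (norm (\<Sum>k<n. a k)) \<le> ennreal (\<Sum>k<n. norm (a k))"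
      by (intro ennreal_leI norm_sum)
    also have "\<dots> = (\<Sum>k<n. ennreal (norm (a k)))" by simp
    also have "\<dots> \<le> (\<Sum>k<n. b k)" by (intro sum_mono assms)
    also have "\<dots> \<le> suminf b" by (intro sum_le_suminf) auto
    finally show ?thesis .
  qed
  then show "\<exists>N. \<forall>n\<ge>N. ennreal (norm (\<Sum>k<n. a k)) \<le> suminf b" by blast
qed

text \<open>The partial sums approximate \<open>G\<close> with an error majorised by the tail of the
  \<open>b k\<close>, whose integral is at most a tail of the convergent series of the
  \<open>\<beta> k\<close>. This is the tool for integrating Neumann series term by term.\<close>

lemma vint_sums:
  fixes g :: "nat \<Rightarrow> 'm \<Rightarrow> 'a::banach"
  assumes g: "\<And>k. vint M (g k) (I k)"
    and sums: "\<And>x. x \<in> space M \<Longrightarrow> (\<lambda>k. g k x) sums G x"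
    and b: "\<And>k. b k \<in> borel_measurable M"
      "\<And>k x. x \<in> space M \<Longrightarrow> ennreal (norm (g k x)) \<le> b k x"
      "\<And>k. (\<integral>\<^sup>+x. b k x \<partial>M) \<le> ennreal (\<beta> k)"
    and \<beta>: "\<And>k. 0 \<le> \<beta> k" "summable \<beta>"
  shows "norm (I k) \<le> \<beta> k" "summable I" "vint M G (suminf I)"
proof -
  have le: "norm (I k) \<le> \<beta> k" for k
  proof -
    have "ennreal (norm (I k)) \<le> (\<integral>\<^sup>+x. b k x \<partial>M)"
      by (rule vint_norm_bound[OF g b(1,2)])
    also have "\<dots> \<le> ennreal (\<beta> k)" by (rule b)
    finally show ?thesis using \<beta>(1)[of k] by simp
  qed
  then show "norm (I k) \<le> \<beta> k" .
  show I: "summable I"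
    by (rule summable_comparison_test[OF _ \<beta>(2)]) (use le in blast)
  show "vint M G (suminf I)"
  proof (rule vint_limit)
    fix \<epsilon> :: real assume e: "\<epsilon> > 0"
    have "(\<lambda>n. \<Sum>k. \<beta> (k + n)) \<longlonglongrightarrow> 0" by (rule suminf_exist_split2[OF \<beta>(2)])
    then have "\<forall>\<^sub>F n in sequentially. (\<Sum>k. \<beta> (k + n)) < \<epsilon>"
      using e by (rule order_tendstoD)
    moreover have "\<forall>\<^sub>F n in sequentially. norm ((\<Sum>k<n. I k) - suminf I) < \<epsilon>"
      using summable_LIMSEQ[OF I] e by (auto simp: tendsto_iff dist_norm)
    ultimately obtain n where n: "(\<Sum>k. \<beta> (k + n)) < \<epsilon>" "norm ((\<Sum>k<n. I k) - suminf I) < \<epsilon>"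
      using eventually_happens[OF eventually_conj] by force
    have "ennreal (norm (G x - (\<Sum>k<n. g k x))) \<le> (\<Sum>k. b (k + n) x)" if "x \<in> space M" for x
      by (rule ennreal_norm_sums_le[OF sums_split_initial_segment[OF sums[OF that]]])
        (rule b(2)[OF that])
    moreover have "(\<integral>\<^sup>+x. (\<Sum>k. b (k + n) x) \<partial>M) < ennreal \<epsilon>"
    proof -
      have "(\<integral>\<^sup>+x. (\<Sum>k. b (k + n) x) \<partial>M) = (\<Sum>k. \<integral>\<^sup>+x. b (k + n) x \<partial>M)"
        by (rule nn_integral_suminf) (rule b)
      also have "\<dots> \<le> (\<Sum>k. ennreal (\<beta> (k + n)))"
        by (intro suminf_le b) auto
      also have "\<dots> = ennreal (\<Sum>k. \<beta> (k + n))"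
        using \<beta> by (intro suminf_ennreal2) (auto simp: summable_iff_shift)
      also have "\<dots> < ennreal \<epsilon>"
        using n(1) e by (simp add: ennreal_lessI)
      finally show ?thesis .
    qed
    ultimately show "\<exists>g J b. vint M g J \<and> b \<in> borel_measurable M \<and>
     (\<forall>x\<in>space M. ennreal (norm (G x - g x)) \<le> b x) \<and> (\<integral>\<^sup>+x. b x \<partial>M) < ennreal \<epsilon> \<and> norm (J - suminf I) < \<epsilon>"
      using n(2) b(1)
      by (intro exI[of _ "\<lambda>x. \<Sum>k<n. g k x"] exI[of _ "\<Sum>k<n. I k"] exI[of _ "\<lambda>x. \<Sum>k. b (k + n) x"])
         (auto intro!: vint_sum g borel_measurable_suminf)
  qed
qed

section \<open>Nuclear operators\<close>

interpretation cvec: vector_space "scaleC :: complex \<Rightarrow> 'a \<Rightarrow> 'a::complex_banach"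
proof
  fix x :: 'a
  \<comment> \<open>The class does not postulate that 1 acts as the identity; this follows because 1
    is real.\<close>
  have "1 *\<^sub>R x = complex_of_real 1 *\<^sub>C x" by (rule scaleR_scaleC)
  then show "1 *\<^sub>C x = x" by simp
qed (auto simp: scaleC_add_right scaleC_add_left scaleC_scaleC)

section \<open>Bounded complex-linear maps\<close>

lemma bounded_clinear_add_eq: "bounded_clinear T \<Longrightarrow> T (x + y) = T x + T y"
  and bounded_clinear_scaleC: "bounded_clinear T \<Longrightarrow> T (c *\<^sub>C x) = c *\<^sub>C T x"
  and bounded_clinear_imp_bounded_linear: "bounded_clinear T \<Longrightarrow> bounded_linear T"
  by (auto simp: bounded_clinear_def bounded_linear.linear linear_add)

lemma bounded_clinearI:
  assumes "\<And>x y. T (x + y) = T x + T y" "\<And>c x. T (c *\<^sub>C x) = c *\<^sub>C T x"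
    "\<And>x. norm (T x) \<le> K * norm x"
  shows "bounded_clinear T"
  unfolding bounded_clinear_def
proof (intro conjI allI assms(2) bounded_linear_intro[where K = K])
  show "T (r *\<^sub>R x) = r *\<^sub>R T x" for r x by (simp add: scaleR_scaleC assms(2))
  show "norm (T x) \<le> norm x * K" for x using assms(3)[of x] by (simp add: mult.commute)
qed (rule assms)

lemma bounded_clinear_0: "bounded_clinear (\<lambda>x. 0)"
  by (rule bounded_clinearI[where K = 0]) auto

lemma bounded_clinear_id: "bounded_clinear (\<lambda>x. x)"
  by (rule bounded_clinearI[where K = 1]) auto

lemma bounded_clinear_diff:
  "bounded_clinear S \<Longrightarrow> bounded_clinear T \<Longrightarrow> bounded_clinear (\<lambda>x. S x - T x)"
  by (simp add: bounded_clinear_def bounded_linear_sub cvec.scale_right_diff_distrib)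

lemma bounded_clinear_compose:
  "bounded_clinear S \<Longrightarrow> bounded_clinear T \<Longrightarrow> bounded_clinear (\<lambda>x. S (T x))"
  by (simp add: bounded_clinear_def bounded_linear_compose)

lemma bounded_linear_scaleC_right: "bounded_linear (\<lambda>x::'a::complex_banach. c *\<^sub>C x)"
  by (rule bounded_clinear_imp_bounded_linear, rule bounded_clinearI[where K = "cmod c"])
     (auto simp: scaleC_add_right norm_scaleC mult.commute)

lemma bounded_linear_scaleC_left: "bounded_linear (\<lambda>c. c *\<^sub>C (x::'a::complex_banach))"
  by (rule bounded_clinear_imp_bounded_linear, rule bounded_clinearI[where K = "norm x"])
     (auto simp: scaleC_add_left norm_scaleC scaleC_complex_def mult.commute)

lemma bounded_clinear_scaleC_fun:
  "bounded_clinear T \<Longrightarrow> bounded_clinear (\<lambda>x. c *\<^sub>C T x)"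
  by (simp add: bounded_clinear_def bounded_linear_compose[OF bounded_linear_scaleC_right]
      mult.commute)

lemmas bounded_clinear_sums = bounded_linear.sums[OF bounded_clinear_imp_bounded_linear]

section \<open>Finite-dimensional subspaces and finite rank operators\<close>

text \<open>Dividing by \<open>a\<close> reduces to the distance of \<open>z\<close> from the span.
  So the coefficient of \<open>z\<close> is controlled by the norm of the whole vector; the
  closedness of finite-dimensional spans and the continuity of coordinate functionals both rest on
  this.\<close>

lemma norm_add_scaleC_ge:
  assumes "\<And>s. s \<in> cvec.span S \<Longrightarrow> d \<le> norm (z - s)" "s \<in> cvec.span S"
  shows "cmod a * d \<le> norm (a *\<^sub>C z + s)"
proof (cases "a = 0")
  case False
  have "a *\<^sub>C z + s = a *\<^sub>C (z - (- inverse a) *\<^sub>C s)"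
    using False by (simp add: scaleC_add_right)
  then have "norm (a *\<^sub>C z + s) = cmod a * norm (z - (- inverse a) *\<^sub>C s)"
    by (metis norm_scaleC)
  moreover have "d \<le> norm (z - (- inverse a) *\<^sub>C s)"
    by (intro assms cvec.span_scale)
  ultimately show ?thesis by (simp add: mult_left_mono)
qed simp

lemma positive_distance_span:
  assumes "closed (cvec.span S)" "z \<notin> cvec.span S"
  obtains d where "d > 0" "\<And>s. s \<in> cvec.span S \<Longrightarrow> d \<le> norm (z - s)"
proof -
  have "open (- cvec.span S)" "z \<in> - cvec.span S" using assms by auto
  then obtain d where d: "d > 0" "ball z d \<subseteq> - cvec.span S" by (rule openE)
  then have "d \<le> norm (z - s)" if "s \<in> cvec.span S" for s
    using that by (force simp: dist_norm subset_iff not_less[symmetric])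
  with d(1) show ?thesis using that by blast
qed

text \<open>Induction on the spanning set: along a convergent sequence the coefficients of the new
  vector are Cauchy, because that vector has positive distance from the closed smaller span, and
  what remains converges within the smaller span.\<close>

lemma closed_span_finite:
  assumes "finite S"
  shows "closed (cvec.span S :: 'a::complex_banach set)"
  using assms
proof (induction S rule: finite_induct)
  case (insert z S)
  show ?case
  proof (cases "z \<in> cvec.span S")
    case True
    then show ?thesis using insert.IH by (simp add: cvec.span_redundant)
  next
    case False
    then obtain d where d: "d > 0" "\<And>s. s \<in> cvec.span S \<Longrightarrow> d \<le> norm (z - s)"
      using positive_distance_span insert.IH by blast
    show ?thesis unfolding closed_sequential_limits
    proof (intro allI impI, elim conjE)
      fix x l assume x: "\<forall>n. x n \<in> cvec.span (insert z S)" and l: "x \<longlonglongrightarrow> l"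
      have "\<forall>n. \<exists>k. x n - k *\<^sub>C z \<in> cvec.span S"
        using x by (simp add: cvec.span_breakdown_eq)
      then obtain a where a: "\<And>n. x n - a n *\<^sub>C z \<in> cvec.span S" by metis
      have "Cauchy a"
      proof (rule metric_CauchyI)
        fix e :: real assume "e > 0"
        then obtain N where N: "\<And>m n. m \<ge> N \<Longrightarrow> n \<ge> N \<Longrightarrow> dist (x m) (x n) < e * d"
          using metric_CauchyD[OF LIMSEQ_imp_Cauchy[OF l], of "e * d"] d(1) by auto
        have "dist (a m) (a n) < e" if "m \<ge> N" "n \<ge> N" for m n
        proof -
          have "cmod (a m - a n) * d \<le>
            norm ((a m - a n) *\<^sub>C z + ((x m - a m *\<^sub>C z) - (x n - a n *\<^sub>C z)))"
            by (rule norm_add_scaleC_ge[OF d(2)]) (auto intro: cvec.span_diff a)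
          also have "\<dots> = dist (x m) (x n)"
            by (simp add: dist_norm cvec.scale_left_diff_distrib)
          also have "\<dots> < e * d" by (rule N[OF that])
          finally show ?thesis using d(1) by (simp add: dist_norm)
        qed
        then show "\<exists>N. \<forall>m\<ge>N. \<forall>n\<ge>N. dist (a m) (a n) < e" by blast
      qed
      then obtain b where b: "a \<longlonglongrightarrow> b" by (meson Cauchy_convergent convergentD)
      have "(\<lambda>n. x n - a n *\<^sub>C z) \<longlonglongrightarrow> l - b *\<^sub>C z"
        by (intro tendsto_diff l bounded_linear.tendsto[OF bounded_linear_scaleC_left b])
      then have "l - b *\<^sub>C z \<in> cvec.span S"
        by (rule closed_sequentially[OF insert.IH _, rotated]) (rule a)
      then show "l \<in> cvec.span (insert z S)"
        by (auto simp: cvec.span_breakdown_eq)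
    qed
  qed
qed simp

text \<open>The common value is the trace of the composition of the finite rank operator \<open>F\<close> with the
  nuclear operator.\<close>

lemma finite_rank_trace_eq:
  assumes "finite S"
    and f: "\<And>n. bounded_clinear (f n)" "\<And>x. (\<lambda>n. f n x *\<^sub>C y n) sums T x"
    and g: "\<And>n. bounded_clinear (g n)" "\<And>x. (\<lambda>n. g n x *\<^sub>C z n) sums T x"
    and F: "bounded_clinear F" "range F \<subseteq> cvec.span S"
  shows "\<exists>A. (\<lambda>n. f n (F (y n))) sums A \<and> (\<lambda>n. g n (F (z n))) sums A"
  using assms(1) F
proof (induction S arbitrary: F rule: finite_induct)
  case empty
  then have "F x = 0" for x by auto
  then show ?case
    using f(1) g(1) by (intro exI[of _ 0]) (simp add: bounded_clinear_def bounded_linear.linear linear_0)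
next
  case (insert u S)
  show ?case
  proof (cases "u \<in> cvec.span S")
    case True
    then show ?thesis using insert by (simp add: cvec.span_redundant)
  next
    case False
    then obtain d where d: "d > 0" "\<And>s. s \<in> cvec.span S \<Longrightarrow> d \<le> norm (u - s)"
      using positive_distance_span closed_span_finite insert.hyps(1) by blast
    \<comment> \<open>The coordinate \<open>a\<close> along \<open>u\<close> is unique and bounded
      because \<open>u\<close> has positive distance from the smaller span. Subtracting this rank
      one part leaves a map \<open>G\<close> into the smaller span, to which the induction
      hypothesis applies.\<close>
    have "\<forall>x. \<exists>k. F x - k *\<^sub>C u \<in> cvec.span S"
      using insert.prems(2) by (simp add: cvec.span_breakdown_eq[symmetric] image_subset_iff)
    then obtain a where a: "\<And>x. F x - a x *\<^sub>C u \<in> cvec.span S" by metis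
    have uniq: "k = k'" if "v - k *\<^sub>C u \<in> cvec.span S" "v - k' *\<^sub>C u \<in> cvec.span S" for k k' v
    proof -
      have "cmod (k' - k) * d \<le> norm ((k' - k) *\<^sub>C u + ((v - k' *\<^sub>C u) - (v - k *\<^sub>C u)))"
        by (rule norm_add_scaleC_ge[OF d(2)]) (assumption | rule that cvec.span_diff)+
      also have "\<dots> = 0" by (simp add: cvec.scale_left_diff_distrib)
      finally show ?thesis using d(1) by (simp add: mult_le_0_iff)
    qed
    obtain C where C: "\<And>x. norm (F x) \<le> C * norm x"
      using bounded_linear.bounded[OF bounded_clinear_imp_bounded_linear[OF insert.prems(1)]]
      by (metis mult.commute)
    have "bounded_clinear a"
    proof (rule bounded_clinearI[where K = "C / d"])
      fix x w
      have "(F x - a x *\<^sub>C u) + (F w - a w *\<^sub>C u) \<in> cvec.span S"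
        by (intro cvec.span_add a)
      then have "F (x + w) - (a x + a w) *\<^sub>C u \<in> cvec.span S"
        by (simp add: bounded_clinear_add_eq[OF insert.prems(1)] scaleC_add_left algebra_simps)
      then show "a (x + w) = a x + a w" using uniq a by blast
    next
      fix c x
      have "c *\<^sub>C (F x - a x *\<^sub>C u) \<in> cvec.span S"
        by (intro cvec.span_scale a)
      then have "F (c *\<^sub>C x) - (c * a x) *\<^sub>C u \<in> cvec.span S"
        by (simp add: bounded_clinear_scaleC[OF insert.prems(1)] cvec.scale_right_diff_distrib)
      then show "a (c *\<^sub>C x) = c *\<^sub>C a x" using uniq a by (simp add: scaleC_complex_def) blast
    next
      fix x
      have "cmod (a x) * d \<le> norm (a x *\<^sub>C u + (F x - a x *\<^sub>C u))"
        by (rule norm_add_scaleC_ge[OF d(2) a])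
      also have "\<dots> \<le> C * norm x" using C by simp
      finally show "norm (a x) \<le> C / d * norm x" using d(1) by (simp add: field_simps)
    qed
    note a_lin = this
    define G where "G = (\<lambda>x. F x - a x *\<^sub>C u)"
    have "bounded_clinear (\<lambda>x. a x *\<^sub>C u)"
      using a_lin unfolding bounded_clinear_def
      by (auto intro: bounded_linear_compose[OF bounded_linear_scaleC_left] simp: scaleC_complex_def)
    then have "bounded_clinear G"
      unfolding G_def using insert.prems(1) by (intro bounded_clinear_diff)
    moreover have "range G \<subseteq> cvec.span S" using a by (auto simp: G_def)
    ultimately obtain A where A: "(\<lambda>n. f n (G (y n))) sums A" "(\<lambda>n. g n (G (z n))) sums A"
      using insert.IH by blast
    have F: "F x = G x + a x *\<^sub>C u" for x by (simp add: G_def)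
    \<comment> \<open>On the rank one part the terms of the two series are the images under
      \<open>a\<close> of \<open>f n u *\<^sub>C y n\<close> and of
      \<open>g n u *\<^sub>C z n\<close>; hence both sum to \<open>a (T u)\<close>, which does not
      see the representation.\<close>
    have "(\<lambda>n. f n (F (y n))) sums (A + a (T u))" "(\<lambda>n. g n (F (z n))) sums (A + a (T u))"
      using sums_add[OF A(1) bounded_clinear_sums[OF a_lin f(2)[of u]]]
            sums_add[OF A(2) bounded_clinear_sums[OF a_lin g(2)[of u]]]
      by (simp_all add: F bounded_clinear_add_eq[OF f(1)] bounded_clinear_scaleC[OF f(1)]
          bounded_clinear_add_eq[OF g(1)] bounded_clinear_scaleC[OF g(1)]
          bounded_clinear_scaleC[OF a_lin] scaleC_complex_def mult.commute)
    then show ?thesis by blast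
  qed
qed

text \<open>The sequence \<open>c\<close> consists of the inverse square roots of the tails of the series.\<close>

lemma summable_times_unbounded:
  fixes a :: "nat \<Rightarrow> real"
  assumes "\<And>n. 0 \<le> a n" "summable a"
  obtains c where "\<And>n. 0 < c n" "filterlim c at_top sequentially" "summable (\<lambda>n. a n * c n)"
proof -
  \<comment> \<open>The geometric summand keeps all tails strictly positive, even if
    \<open>a\<close> vanishes from some index on.\<close>
  define b where "b n = a n + (1 / 2) ^ n" for n
  have b: "summable b" unfolding b_def by (intro summable_add assms summable_geometric) auto
  have b_pos: "b n > 0" for n unfolding b_def using assms(1)[of n] by (simp add: add_nonneg_pos)
  define r where "r n = (\<Sum>k. b (k + n))" for n
  have r_pos: "r n > 0" for n
    unfolding r_def using b b_pos by (intro suminf_pos) (simp_all add: summable_iff_shift)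
  have r_Suc: "r n = b n + r (Suc n)" for n
  proof -
    have "r n = (\<Sum>k. b (Suc k + n)) + b n"
      unfolding r_def using suminf_split_initial_segment[of "\<lambda>k. b (k + n)" 1] b by (simp add: summable_iff_shift)
    then show ?thesis by (simp add: r_def)
  qed
  have r0: "r \<longlonglongrightarrow> 0" unfolding r_def by (rule suminf_exist_split2[OF b])
  define c where "c n = 1 / sqrt (r n)" for n
  have s0: "(\<lambda>n. sqrt (r n)) \<longlonglongrightarrow> 0" using tendsto_real_sqrt[OF r0] by simp
  have "summable (\<lambda>n. 2 * (sqrt (r n) - sqrt (r (Suc n))))"
    by (intro summable_mult telescope_summable'[OF s0])
  \<comment> \<open>The term \<open>b n = r n - r (Suc n)\<close> is a difference of squares of the
    roots; dividing it by \<open>sqrt (r n)\<close> leaves at most twice the difference of the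
    roots, which telescopes.\<close>
  moreover have "norm (a n * c n) \<le> 2 * (sqrt (r n) - sqrt (r (Suc n)))" for n
  proof -
    have le: "sqrt (r (Suc n)) \<le> sqrt (r n)" using r_Suc[of n] b_pos[of n] by simp
    have "a n \<le> b n" by (simp add: b_def)
    also have "b n = (sqrt (r n))\<^sup>2 - (sqrt (r (Suc n)))\<^sup>2"
      using r_Suc[of n] r_pos[of n] r_pos[of "Suc n"] by simp
    also have "\<dots> = (sqrt (r n) - sqrt (r (Suc n))) * (sqrt (r n) + sqrt (r (Suc n)))"
      by (simp add: power2_eq_square algebra_simps)
    also have "\<dots> \<le> (sqrt (r n) - sqrt (r (Suc n))) * (2 * sqrt (r n))"
      using le by (intro mult_left_mono) auto
    finally have "a n \<le> 2 * (sqrt (r n) - sqrt (r (Suc n))) * sqrt (r n)" by (simp only: mult_ac)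
    then have "a n / sqrt (r n) \<le> 2 * (sqrt (r n) - sqrt (r (Suc n)))"
      using r_pos[of n] by (simp only: pos_divide_le_eq real_sqrt_gt_zero)
    then show ?thesis using r_pos[of n] assms(1)[of n] by (simp add: c_def)
  qed
  ultimately have "summable (\<lambda>n. a n * c n)" by (rule summable_comparison_test'[of _ 0])
  moreover have "filterlim c at_top sequentially"
    unfolding c_def using r_pos
    by (intro filterlim_at_top_mult_tendsto_pos filterlim_inverse_at_top[OF s0, unfolded inverse_eq_divide])
       (auto intro!: always_eventually)
  ultimately show ?thesis using that[of c] r_pos by (simp add: c_def)
qed

text \<open>The bound \<open>w\<close> and the trace \<open>c\<close> belong to one and the same representation; only with the
  approximation property is \<open>c\<close> determined by \<open>T\<close>.\<close>

definition nuc :: "('a::complex_banach \<Rightarrow> 'a) \<Rightarrow> real \<Rightarrow> complex \<Rightarrow> bool" where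
  "nuc T w c \<longleftrightarrow> (\<exists>f y a. (\<forall>n. bounded_clinear (f n)) \<and> (\<forall>n. 0 \<le> a n) \<and> summable a \<and> suminf a \<le> w \<and>
     (\<forall>n x. cmod (f n x) * norm (y n) \<le> a n * norm x) \<and>
     (\<forall>x. (\<lambda>n. f n x *\<^sub>C y n) sums T x) \<and> (\<lambda>n. f n (y n)) sums c)"

lemma norm_trace_term_le:
  assumes "bounded_clinear f" "\<And>x. cmod (f x) * norm y \<le> a * norm x" "0 \<le> a"
  shows "cmod (f y) \<le> a"
proof (cases "y = 0")
  case True
  then show ?thesis
    using assms(1,3) by (simp add: bounded_clinear_def bounded_linear.linear linear_0)
next
  case False
  then show ?thesis using assms(2)[of y] by simp
qed

lemma nuclear_series_bound:
  assumes "nuclear_series f y T"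
  shows "cmod (f n x) * norm (y n) \<le> onorm (\<lambda>x. f n x *\<^sub>C y n) * norm x"
proof -
  have "bounded_linear (\<lambda>x. f n x *\<^sub>C y n)"
    using assms unfolding nuclear_series_def bounded_clinear_def
    by (auto intro: bounded_linear_compose[OF bounded_linear_scaleC_left])
  from onorm[OF this, of x] show ?thesis by (simp add: norm_scaleC)
qed

lemma nuclear_series_nonneg:
  assumes "nuclear_series f y T"
  shows "0 \<le> onorm (\<lambda>x. f n x *\<^sub>C y n)"
proof -
  have "bounded_linear (\<lambda>x. f n x *\<^sub>C y n)"
    using assms unfolding nuclear_series_def bounded_clinear_def
    by (auto intro: bounded_linear_compose[OF bounded_linear_scaleC_left])
  then show ?thesis by (rule onorm_pos_le)
qed

lemma nuclear_series_trace_summable: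
  assumes "nuclear_series f y T"
  shows "summable (\<lambda>n. f n (y n))"
proof (rule summable_comparison_test')
  show "summable (\<lambda>n. onorm (\<lambda>x. f n x *\<^sub>C y n))" using assms by (simp add: nuclear_series_def)
  show "norm (f n (y n)) \<le> onorm (\<lambda>x. f n x *\<^sub>C y n)" if "n \<ge> 0" for n
    by (rule norm_trace_term_le[OF _ nuclear_series_bound[OF assms] nuclear_series_nonneg[OF assms]])
       (use assms in \<open>simp add: nuclear_series_def\<close>)
qed

lemma nuclear_series_imp_nuc:
  assumes "nuclear_series f y T"
  shows "\<exists>w. nuc T w (\<Sum>n. f n (y n))"
  unfolding nuc_def
  using nuclear_series_bound[OF assms] nuclear_series_nonneg[OF assms]
    nuclear_series_trace_summable[OF assms] assms
  by (intro exI[of _ "\<Sum>n. onorm (\<lambda>x. f n x *\<^sub>C y n)"] exI[of _ f] exI[of _ y]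
      exI[of _ "\<lambda>n. onorm (\<lambda>x. f n x *\<^sub>C y n)"])
     (auto simp: nuclear_series_def summable_sums)

lemma nuc_imp_nuclear_series:
  assumes "nuc T w c"
  obtains f y where "nuclear_series f y T" "c = (\<Sum>n. f n (y n))"
proof -
  obtain f y a where f: "\<And>n. bounded_clinear (f n)" "\<And>n. 0 \<le> a n" "summable a"
     "\<And>n x. cmod (f n x) * norm (y n) \<le> a n * norm x"
     "\<And>x. (\<lambda>n. f n x *\<^sub>C y n) sums T x" "(\<lambda>n. f n (y n)) sums c"
    using assms unfolding nuc_def by blast
  have "onorm (\<lambda>x. f n x *\<^sub>C y n) \<le> a n" for n
    using f(2,4) by (intro onorm_bound) (simp_all add: norm_scaleC)
  moreover have "0 \<le> onorm (\<lambda>x. f n x *\<^sub>C y n)" for n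
    by (intro onorm_pos_le bounded_linear_compose[OF bounded_linear_scaleC_left]
        bounded_clinear_imp_bounded_linear f)
  ultimately have "summable (\<lambda>n. onorm (\<lambda>x. f n x *\<^sub>C y n))"
    by (intro summable_comparison_test'[OF f(3), of 0]) auto
  then show ?thesis using that[of f y] f by (auto simp: nuclear_series_def sums_iff)
qed

section \<open>Uniqueness of the trace\<close>

lemma compact_insert_range:
  fixes f :: "nat \<Rightarrow> 'b::metric_space"
  assumes "f \<longlonglongrightarrow> l"
  shows "compact (insert l (range f))"
proof (rule compactI)
  fix C assume C: "\<forall>t\<in>C. open t" "insert l (range f) \<subseteq> \<Union>C"
  then obtain U where U: "U \<in> C" "l \<in> U" by blast
  with C(1) obtain N where N: "\<And>n. n \<ge> N \<Longrightarrow> f n \<in> U"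
    using topological_tendstoD[OF assms, of U] by (auto simp: eventually_sequentially)
  have "\<forall>n. \<exists>V\<in>C. f n \<in> V" using C(2) by blast
  then obtain V where V: "\<And>n. V n \<in> C" "\<And>n. f n \<in> V n" by metis
  have "insert l (range f) \<subseteq> \<Union>(insert U (V ` {..<N}))"
  proof
    fix x assume "x \<in> insert l (range f)"
    then consider "x = l" | n where "x = f n" by blast
    then show "x \<in> \<Union>(insert U (V ` {..<N}))"
    proof cases
      case 2
      then show ?thesis using N[of n] V(2)[of n] by (cases "n < N") auto
    qed (use U in simp)
  qed
  then show "\<exists>C'\<subseteq>C. finite C' \<and> insert l (range f) \<subseteq> \<Union>C'"
    using U(1) V(1) by (intro exI[of _ "insert U (V ` {..<N})"]) auto
qed

text \<open>After rescaling, the vectors of a nuclear representation form a null sequence, and a finite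
  rank approximation of the identity on it approximates the trace.\<close>

lemma nuclear_series_compact:
  assumes "nuclear_series f y T"
  obtains K C where "compact K" "C \<ge> 0"
    "\<And>F \<epsilon> A. bounded_clinear F \<Longrightarrow> (\<And>x. x \<in> K \<Longrightarrow> norm (F x - x) < \<epsilon>) \<Longrightarrow>
       (\<lambda>n. f n (F (y n))) sums A \<Longrightarrow> cmod (A - (\<Sum>n. f n (y n))) \<le> C * \<epsilon>"
proof -
  define a where "a n = onorm (\<lambda>x. f n x *\<^sub>C y n)" for n
  have a: "\<And>n. 0 \<le> a n" "summable a" "\<And>n x. cmod (f n x) * norm (y n) \<le> a n * norm x"
    using assms nuclear_series_bound[OF assms] nuclear_series_nonneg[OF assms]
    unfolding a_def nuclear_series_def by auto
  have f: "bounded_clinear (f n)" for n using assms by (simp add: nuclear_series_def)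
  obtain c where c: "\<And>n. 0 < c n" "filterlim c at_top sequentially" "summable (\<lambda>n. a n * c n)"
    using summable_times_unbounded[OF a(1,2)] by blast
  \<comment> \<open>The vectors are normalised and then shrunk by \<open>c n\<close>, so that they
    tend to 0, while the weights \<open>a n * c n\<close> that absorb the rescaling remain summable.
    For \<open>y n = 0\<close> division by zero makes \<open>v n = 0\<close>, as wanted.\<close>
  define v where "v n = (1 / (norm (y n) * c n)) *\<^sub>R y n" for n
  have nv: "norm (v n) \<le> 1 / c n" for n
    using c(1)[of n] by (cases "y n = 0") (auto simp: v_def)
  have "(\<lambda>n. 1 / c n) \<longlonglongrightarrow> 0"
    using c(2) by (intro real_tendsto_divide_at_top[OF tendsto_const])
  then have v0: "v \<longlonglongrightarrow> 0"
    by (rule tendsto_0_le[where K = 1]) (use nv c(1) in \<open>auto simp: less_imp_le\<close>)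
  define K where "K = insert 0 (range v)"
  have K: "compact K" unfolding K_def by (rule compact_insert_range[OF v0])
  define C where "C = (\<Sum>n. a n * c n)"
  have C: "C \<ge> 0" unfolding C_def using a(1) c(1) by (intro suminf_nonneg c(3)) (simp add: less_imp_le)
  have "cmod (A - (\<Sum>n. f n (y n))) \<le> C * \<epsilon>"
    if F: "bounded_clinear F" and close: "\<And>x. x \<in> K \<Longrightarrow> norm (F x - x) < \<epsilon>"
      and A: "(\<lambda>n. f n (F (y n))) sums A" for F \<epsilon> A
  proof -
    have bound: "cmod (f n (F (y n)) - f n (y n)) \<le> a n * c n * \<epsilon>" for n
    proof (cases "y n = 0")
      case True
      have "f n 0 = 0" "F 0 = 0"
        using f[of n] F by (auto simp: bounded_clinear_def bounded_linear.linear linear_0)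
      \<comment> \<open>The point 0 belongs to \<open>K\<close>, and the strict bound there forces
        \<open>\<epsilon>\<close> to be positive.\<close>
      moreover have "\<epsilon> > 0" using close[of 0] by (simp add: K_def) (meson norm_ge_zero le_less_trans)
      ultimately show ?thesis using True a(1)[of n] c(1)[of n] by simp
    next
      case False
      define k where "k = norm (y n) * c n"
      have k: "k > 0" using False c(1)[of n] by (simp add: k_def)
      have "y n = k *\<^sub>R v n" using k by (simp add: v_def k_def[symmetric])
      then have "F (y n) - y n = k *\<^sub>R (F (v n) - v n)"
        using F by (simp add: bounded_clinear_def bounded_linear.linear linear_scale scaleR_diff_right)
      moreover have "f n (F (y n)) - f n (y n) = f n (F (y n) - y n)"
        using f[of n] by (simp add: bounded_clinear_def bounded_linear.linear linear_diff)
      ultimately have "cmod (f n (F (y n)) - f n (y n)) = k * cmod (f n (F (v n) - v n))"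
        using f[of n] k by (simp add: bounded_clinear_def bounded_linear.linear linear_scale)
      also have "\<dots> = c n * (cmod (f n (F (v n) - v n)) * norm (y n))" by (simp add: k_def)
      also have "\<dots> \<le> c n * (a n * norm (F (v n) - v n))"
        using a(3) c(1)[of n] by (intro mult_left_mono) auto
      also have "\<dots> \<le> c n * (a n * \<epsilon>)"
        using close[of "v n"] a(1)[of n] c(1)[of n] by (intro mult_left_mono) (auto simp: K_def)
      finally show ?thesis by (simp add: mult_ac)
    qed
    have "(\<lambda>n. f n (F (y n)) - f n (y n)) sums (A - (\<Sum>n. f n (y n)))"
      by (intro sums_diff A summable_sums nuclear_series_trace_summable[OF assms])
    moreover have sum: "summable (\<lambda>n. a n * c n * \<epsilon>)" by (intro summable_mult2 c)
    ultimately have "cmod (A - (\<Sum>n. f n (y n))) \<le> (\<Sum>n. a n * c n * \<epsilon>)"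
      using norm_suminf_le[OF bound sum] by (simp add: sums_iff)
    then show ?thesis using c(3) by (simp add: C_def suminf_mult2)
  qed
  then show ?thesis using that[OF K C] by blast
qed

text \<open>A single finite rank \<open>F\<close> is chosen close to the identity on the compact
  sets of both representations. The two series for the trace of the composition with
  \<open>F\<close> have a common sum \<open>A\<close>, and each candidate trace lies within a
  multiple of \<open>\<epsilon>\<close> of it.\<close>

lemma nuclear_trace_unique:
  assumes AP: "approximation_property TYPE('a::complex_banach)"
    and f: "nuclear_series f y (T :: 'a \<Rightarrow> 'a)" and g: "nuclear_series g z T"
  shows "(\<Sum>n. f n (y n)) = (\<Sum>n. g n (z n))"
proof -
  obtain K C where K: "compact K" "C \<ge> 0"
    "\<And>F \<epsilon> A. bounded_clinear F \<Longrightarrow> (\<And>x. x \<in> K \<Longrightarrow> norm (F x - x) < \<epsilon>) \<Longrightarrow>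
       (\<lambda>n. f n (F (y n))) sums A \<Longrightarrow> cmod (A - (\<Sum>n. f n (y n))) \<le> C * \<epsilon>"
    using nuclear_series_compact[OF f] by blast
  obtain L D where L: "compact L" "D \<ge> 0"
    "\<And>F \<epsilon> A. bounded_clinear F \<Longrightarrow> (\<And>x. x \<in> L \<Longrightarrow> norm (F x - x) < \<epsilon>) \<Longrightarrow>
       (\<lambda>n. g n (F (z n))) sums A \<Longrightarrow> cmod (A - (\<Sum>n. g n (z n))) \<le> D * \<epsilon>"
    using nuclear_series_compact[OF g] by blast
  have "cmod ((\<Sum>n. f n (y n)) - (\<Sum>n. g n (z n))) \<le> e" if e: "e > 0" for e
  proof -
    define \<epsilon> where "\<epsilon> = e / (C + D + 1)"
    have \<epsilon>: "\<epsilon> > 0" using e K(2) L(2) by (simp add: \<epsilon>_def)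
    obtain F where F: "finite_rank F" "\<And>x. x \<in> K \<union> L \<Longrightarrow> norm (F x - x) < \<epsilon>"
      using AP K(1) L(1) \<epsilon> unfolding approximation_property_def by (meson compact_Un)
    then obtain S where S: "finite S" "range F \<subseteq> cvec.span S" "bounded_clinear F"
      by (auto simp: finite_rank_def)
    obtain A where A: "(\<lambda>n. f n (F (y n))) sums A" "(\<lambda>n. g n (F (z n))) sums A"
      using finite_rank_trace_eq[OF S(1) _ _ _ _ S(3,2)] f g unfolding nuclear_series_def by meson
    have "cmod (A - (\<Sum>n. f n (y n))) \<le> C * \<epsilon>" "cmod (A - (\<Sum>n. g n (z n))) \<le> D * \<epsilon>"
      using F(2) by (auto intro!: K(3)[OF S(3) _ A(1)] L(3)[OF S(3) _ A(2)])
    then have "cmod ((\<Sum>n. f n (y n)) - (\<Sum>n. g n (z n))) \<le> C * \<epsilon> + D * \<epsilon>"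
      using norm_triangle_ineq4[of "A - (\<Sum>n. g n (z n))" "A - (\<Sum>n. f n (y n))"] by simp
    also have "\<dots> \<le> (C + D + 1) * \<epsilon>" using \<epsilon> by (simp add: algebra_simps)
    also have "\<dots> = e" using K(2) L(2) by (simp add: \<epsilon>_def)
    finally show ?thesis .
  qed
  then have "cmod ((\<Sum>n. f n (y n)) - (\<Sum>n. g n (z n))) \<le> 0"
    by (rule field_le_epsilon[of _ 0, simplified])
  then show ?thesis by simp
qed

lemma nuc_imp_nuclear: "nuc T w c \<Longrightarrow> nuclear T"
  by (metis nuc_imp_nuclear_series nuclear_def)

lemma nuc_trace:
  assumes AP: "approximation_property TYPE('a::complex_banach)" and T: "nuc (T :: 'a \<Rightarrow> 'a) w c"
  shows "nuclear_trace T = c"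
  unfolding nuclear_trace_def
proof (rule the_equality)
  show "\<exists>f y. nuclear_series f y T \<and> c = (\<Sum>n. f n (y n))"
    using nuc_imp_nuclear_series[OF T] by blast
next
  fix d assume "\<exists>f y. nuclear_series f y T \<and> d = (\<Sum>n. f n (y n))"
  then show "d = c"
    using nuc_imp_nuclear_series[OF T] nuclear_trace_unique[OF AP] by metis
qed

section \<open>Series, sums and products of nuclear operators\<close>

text \<open>An absolutely convergent double series may be rearranged into a single one along the
  pairing function. The majorant \<open>a\<close> supplies the unconditional summability over all
  pairs, and the iterated sum then has to agree with it.\<close>

lemma sums_prod_decode:
  fixes F :: "nat \<Rightarrow> nat \<Rightarrow> 'b::banach" and a :: "nat \<Rightarrow> nat \<Rightarrow> real"
  assumes F: "\<And>k n. norm (F k n) \<le> a k n" "\<And>k. (F k) sums s k"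
    and a: "\<And>k. (a k) sums r k" "summable r"
  shows "(\<lambda>i. case prod_decode i of (k, n) \<Rightarrow> F k n) sums suminf s"
proof -
  have a0: "0 \<le> a k n" for k n using F(1)[of k n] norm_ge_zero order_trans by blast
  have has: "((\<lambda>n. a k n) has_sum r k) UNIV" for k
    by (rule norm_summable_imp_has_sum[OF _ a(1)]) (use a0 a(1) in \<open>simp add: sums_iff\<close>)
  have r0: "0 \<le> r k" for k using a0 a(1) by (metis sums_le sums_zero)
  have "r summable_on UNIV"
    by (rule norm_summable_imp_summable_on) (use r0 a(2) in simp)
  then have "(\<lambda>(k, n). a k n) summable_on (SIGMA k:UNIV. UNIV)"
    using has a0 by (intro summable_on_SigmaI) auto
  moreover have "(\<lambda>p. norm ((\<lambda>(k, n). a k n) p)) = (\<lambda>(k, n). a k n)"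
    using a0 by auto
  ultimately have "(\<lambda>p. norm ((\<lambda>(k, n). a k n) p)) summable_on (UNIV \<times> UNIV)"
    by simp
  then have "(\<lambda>(k, n). F k n) abs_summable_on (UNIV \<times> UNIV)"
    by (rule Infinite_Sum.summable_on_comparison_test) (use F(1) a0 in \<open>auto simp: case_prod_beta\<close>)
  then have "(\<lambda>(k, n). F k n) summable_on (UNIV \<times> UNIV)"
    by (rule abs_summable_summable)
  then obtain S where S: "((\<lambda>(k, n). F k n) has_sum S) (UNIV \<times> UNIV)"
    by (auto simp: summable_on_def)
  have "((\<lambda>n. F k n) has_sum s k) UNIV" for k
    by (rule norm_summable_imp_has_sum[OF _ F(2)])
       (rule summable_comparison_test'[where g = "a k" and N = 0], use F(1) a(1) in \<open>auto simp: sums_iff\<close>)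
  then have "(s has_sum S) UNIV"
    using has_sum_SigmaD[OF S] by auto
  then have "S = suminf s" using has_sum_imp_sums sums_unique by blast
  moreover have "((\<lambda>i. (\<lambda>(k, n). F k n) (prod_decode i)) has_sum S) UNIV"
    using S by (subst has_sum_reindex_bij_betw[OF bij_prod_decode]) simp
  ultimately show ?thesis using has_sum_imp_sums by blast
qed

lemma nuc_norm:
  assumes "nuc T w c"
  shows "norm (T x) \<le> w * norm x" "cmod c \<le> w"
proof -
  obtain f y a where f: "\<And>n. bounded_clinear (f n)" "\<And>n. 0 \<le> a n" "summable a" "suminf a \<le> w"
     "\<And>n x. cmod (f n x) * norm (y n) \<le> a n * norm x"
     "\<And>x. (\<lambda>n. f n x *\<^sub>C y n) sums T x" "(\<lambda>n. f n (y n)) sums c"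
    using assms unfolding nuc_def by blast
  have "norm (T x) \<le> (\<Sum>n. a n * norm x)"
    using norm_suminf_le[of "\<lambda>n. f n x *\<^sub>C y n" "\<lambda>n. a n * norm x"] f
    by (simp add: norm_scaleC sums_iff summable_mult2)
  also have "\<dots> = suminf a * norm x" using f(3) by (simp add: suminf_mult2)
  also have "\<dots> \<le> w * norm x" using f(4) by (simp add: mult_right_mono)
  finally show "norm (T x) \<le> w * norm x" .
  have "cmod c \<le> suminf a"
    using norm_suminf_le[of "\<lambda>n. f n (y n)" a] norm_trace_term_le[OF f(1,5,2)] f(3,7)
    by (simp add: sums_iff)
  then show "cmod c \<le> w" using f(4) by simp
qed

text \<open>All rank one terms of all representations are enumerated along
  \<open>prod_decode\<close>. The same enumeration serves the operator, the bound and the trace, so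
  the three stay attached to one representation of the sum; this is how the trace passes through
  infinite series.\<close>

lemma nuc_suminf:
  assumes T: "\<And>k. nuc (T k) (w k) (c k)" and w: "summable w"
  shows "summable (\<lambda>k. T k x)" "summable c"
    "nuc (\<lambda>x. \<Sum>k. T k x) (suminf w) (suminf c)"
proof -
  show s: "summable (\<lambda>k. T k x)" for x
    by (rule summable_comparison_test'[OF summable_mult2[OF w], of 0]) (rule nuc_norm[OF T])
  show "summable c"
    by (rule summable_comparison_test'[OF w, of 0]) (rule nuc_norm[OF T])
  define R where "R k f y a \<longleftrightarrow> (\<forall>n. bounded_clinear (f n)) \<and> (\<forall>n. 0 \<le> a n) \<and> summable a \<and> suminf a \<le> w k \<and>
     (\<forall>n x. cmod (f n x) * norm (y n) \<le> a n * norm x) \<and>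
     (\<forall>x. (\<lambda>n. f n x *\<^sub>C y n) sums T k x) \<and> (\<lambda>n. f n (y n)) sums c k" for k f y a
  have "\<forall>k. \<exists>f y a. R k f y a"
    using T unfolding nuc_def R_def by blast
  then obtain f y a where "\<And>k. R k (f k) (y k) (a k)" by metis
  then have f: "\<And>k n. bounded_clinear (f k n)" "\<And>k n. 0 \<le> a k n" "\<And>k. summable (a k)"
     "\<And>k. suminf (a k) \<le> w k" "\<And>k n x. cmod (f k n x) * norm (y k n) \<le> a k n * norm x"
     "\<And>k x. (\<lambda>n. f k n x *\<^sub>C y k n) sums T k x" "\<And>k. (\<lambda>n. f k n (y k n)) sums c k"
    unfolding R_def by blast+
  have a: "(a k) sums suminf (a k)" for k using f(3) by (rule summable_sums)
  have a0: "0 \<le> suminf (a k)" for k using f(2,3) by (simp add: suminf_nonneg)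
  have sa: "summable (\<lambda>k. suminf (a k))"
    by (rule summable_comparison_test'[OF w, of 0]) (use f(4) a0 in auto)
  let ?f = "\<lambda>i. case prod_decode i of (k, n) \<Rightarrow> f k n"
  let ?y = "\<lambda>i. case prod_decode i of (k, n) \<Rightarrow> y k n"
  let ?a = "\<lambda>i. case prod_decode i of (k, n) \<Rightarrow> a k n"
  have "?a sums (\<Sum>k. suminf (a k))"
    by (rule sums_prod_decode[OF _ a a sa]) (use f(2) in auto)
  moreover have "(\<Sum>k. suminf (a k)) \<le> suminf w"
    by (intro suminf_le f sa w)
  moreover have "(\<lambda>i. ?f i x *\<^sub>C ?y i) sums (\<Sum>k. T k x)" for x
    using sums_prod_decode[where F = "\<lambda>k n. f k n x *\<^sub>C y k n" and a = "\<lambda>k n. a k n * norm x",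
        OF _ f(6) sums_mult2[OF a] summable_mult2[OF sa]] f(5)
    by (simp add: case_prod_beta norm_scaleC)
  moreover have "(\<lambda>i. ?f i (?y i)) sums suminf c"
    using sums_prod_decode[where F = "\<lambda>k n. f k n (y k n)" and a = a, OF _ f(7) a sa]
      norm_trace_term_le[OF f(1,5,2)] by (simp add: case_prod_beta)
  ultimately show "nuc (\<lambda>x. \<Sum>k. T k x) (suminf w) (suminf c)"
    unfolding nuc_def using f(1,2,5)
    by (intro exI[of _ ?f] exI[of _ ?y] exI[of _ ?a]) (auto simp: case_prod_beta sums_iff)
qed

lemma nuc_zero: "nuc (\<lambda>x. 0) 0 0"
  unfolding nuc_def
  by (intro exI[of _ "\<lambda>n x. 0"] exI[of _ "\<lambda>n. 0"]) (auto simp: bounded_clinear_0)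

text \<open>Two summands are a series with at most two nonzero terms, so the rearrangement argument
  is reused.\<close>

lemma nuc_add:
  assumes "nuc S v b" "nuc T w c"
  shows "nuc (\<lambda>x. S x + T x) (v + w) (b + c)"
proof -
  have sums: "(\<lambda>k. if k = 0 then p else if k = 1 then q else 0) sums (p + q)" for p q :: "'c::real_normed_vector"
    using sums_finite[of "{0, 1::nat}" "\<lambda>k. if k = 0 then p else if k = 1 then q else 0"] by simp
  have "nuc (\<lambda>x. \<Sum>k. (if k = 0 then S else if k = 1 then T else (\<lambda>x. 0)) x)
     (\<Sum>k::nat. if k = 0 then v else if k = 1 then w else 0)
     (\<Sum>k::nat. if k = 0 then b else if k = 1 then c else 0)"
    by (rule nuc_suminf(3)) (use assms nuc_zero sums[of v w] in \<open>auto simp: sums_iff\<close>)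
  moreover have "(if k = 0 then S else if k = 1 then T else (\<lambda>x. 0)) x = (if k = 0 then S x else if k = 1 then T x else 0)"
    for k :: nat and x by simp
  ultimately show ?thesis
    using sums[of v w] sums[of b c] sums[of "S x" "T x" for x] by (simp only: sums_iff)
qed

text \<open>\<open>P\<close> is applied to the vectors of the representation. The trace is left
  existential because only the bound is tracked through products; under the approximation property
  it is afterwards named \<open>nuclear_trace\<close>.\<close>

lemma nuc_compose_left:
  assumes P: "bounded_clinear P" "\<And>x. norm (P x) \<le> p * norm x" and T: "nuc T w c" and "0 \<le> p"
  shows "\<exists>c. nuc (\<lambda>x. P (T x)) (p * w) c"
proof -
  obtain f y a where f: "\<And>n. bounded_clinear (f n)" "\<And>n. 0 \<le> a n" "summable a" "suminf a \<le> w"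
     "\<And>n x. cmod (f n x) * norm (y n) \<le> a n * norm x"
     "\<And>x. (\<lambda>n. f n x *\<^sub>C y n) sums T x"
    using T unfolding nuc_def by blast
  have 1: "cmod (f n x) * norm (P (y n)) \<le> p * a n * norm x" for n x
  proof -
    have "cmod (f n x) * norm (P (y n)) \<le> cmod (f n x) * (p * norm (y n))"
      by (intro mult_left_mono P) simp
    also have "\<dots> = p * (cmod (f n x) * norm (y n))" by simp
    also have "\<dots> \<le> p * (a n * norm x)" by (intro mult_left_mono f \<open>0 \<le> p\<close>)
    finally show ?thesis by simp
  qed
  have 2: "summable (\<lambda>n. f n (P (y n)))"
    by (rule summable_comparison_test'[OF summable_mult[OF f(3)], of 0])
       (rule norm_trace_term_le[OF f(1) 1], use f(2) \<open>0 \<le> p\<close> in simp)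
  have 3: "(\<lambda>n. f n x *\<^sub>C P (y n)) sums P (T x)" for x
    using bounded_clinear_sums[OF P(1) f(6)] by (simp add: bounded_clinear_scaleC[OF P(1)])
  have 4: "(\<Sum>n. p * a n) \<le> p * w"
    using f(3,4) \<open>0 \<le> p\<close> by (simp add: suminf_mult mult_left_mono)
  show ?thesis unfolding nuc_def
    using f(1,2,3) 1 summable_sums[OF 2] 3 4 \<open>0 \<le> p\<close>
    by (intro exI[of _ "\<Sum>n. f n (P (y n))"] exI[of _ f] exI[of _ "\<lambda>n. P (y n)"] exI[of _ "\<lambda>n. p * a n"])
       (auto simp: summable_mult)
qed

lemma nuc_compose_right:
  assumes P: "bounded_clinear P" "\<And>x. norm (P x) \<le> p * norm x" and T: "nuc T w c" and "0 \<le> p"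
  shows "\<exists>c. nuc (\<lambda>x. T (P x)) (p * w) c"
proof -
  obtain f y a where f: "\<And>n. bounded_clinear (f n)" "\<And>n. 0 \<le> a n" "summable a" "suminf a \<le> w"
     "\<And>n x. cmod (f n x) * norm (y n) \<le> a n * norm x"
     "\<And>x. (\<lambda>n. f n x *\<^sub>C y n) sums T x"
    using T unfolding nuc_def by blast
  have 1: "cmod (f n (P x)) * norm (y n) \<le> p * a n * norm x" for n x
  proof -
    have "cmod (f n (P x)) * norm (y n) \<le> a n * norm (P x)" by (rule f)
    also have "\<dots> \<le> a n * (p * norm x)" by (intro mult_left_mono f P)
    finally show ?thesis by (simp add: mult_ac)
  qed
  have lin: "bounded_clinear (\<lambda>x. f n (P x))" for n by (rule bounded_clinear_compose[OF f(1) P(1)])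
  have 2: "summable (\<lambda>n. f n (P (y n)))"
    by (rule summable_comparison_test'[OF summable_mult[OF f(3)], of 0])
       (rule norm_trace_term_le[OF lin 1], use f(2) \<open>0 \<le> p\<close> in simp)
  have 4: "(\<Sum>n. p * a n) \<le> p * w"
    using f(3,4) \<open>0 \<le> p\<close> by (simp add: suminf_mult mult_left_mono)
  show ?thesis unfolding nuc_def
    using f(2,3,6) lin 1 summable_sums[OF 2] 4 \<open>0 \<le> p\<close>
    by (intro exI[of _ "\<Sum>n. f n (P (y n))"] exI[of _ "\<lambda>n x. f n (P x)"] exI[of _ y] exI[of _ "\<lambda>n. p * a n"])
       (auto simp: summable_mult)
qed

lemma nuc_scaleC:
  assumes T: "nuc T w c"
  shows "nuc (\<lambda>x. r *\<^sub>C T x) (cmod r * w) (r * c)"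
proof -
  obtain f y a where f: "\<And>n. bounded_clinear (f n)" "\<And>n. 0 \<le> a n" "summable a" "suminf a \<le> w"
     "\<And>n x. cmod (f n x) * norm (y n) \<le> a n * norm x"
     "\<And>x. (\<lambda>n. f n x *\<^sub>C y n) sums T x" "(\<lambda>n. f n (y n)) sums c"
    using T unfolding nuc_def by blast
  have 1: "cmod (r * f n x) * norm (y n) \<le> cmod r * a n * norm x" for n x
    using mult_left_mono[OF f(5)[of n x], of "cmod r"] by (simp add: norm_mult mult_ac)
  have lin: "bounded_clinear (\<lambda>x. r * f n x)" for n
    using bounded_clinear_scaleC_fun[OF f(1)] by (simp add: scaleC_complex_def)
  have 3: "(\<lambda>n. (r * f n x) *\<^sub>C y n) sums (r *\<^sub>C T x)" for x
    using bounded_linear.sums[OF bounded_linear_scaleC_right f(6)] by simp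
  have 4: "(\<Sum>n. cmod r * a n) \<le> cmod r * w"
    using f(3,4) by (simp add: suminf_mult mult_left_mono)
  show ?thesis unfolding nuc_def
    using f(2,3) lin 1 3 4 sums_mult[OF f(7), of r]
    by (intro exI[of _ "\<lambda>n x. r * f n x"] exI[of _ y] exI[of _ "\<lambda>n. cmod r * a n"])
       (auto simp: summable_mult)
qed

lemma nuc_bounded_clinear:
  assumes "nuc T w c"
  shows "bounded_clinear T"
proof -
  obtain f y where f: "\<And>n. bounded_clinear (f n)" "\<And>x. (\<lambda>n. f n x *\<^sub>C y n) sums T x"
    using assms unfolding nuc_def by blast
  show ?thesis
  proof (rule bounded_clinearI[OF _ _ nuc_norm(1)[OF assms]])
    fix x z
    show "T (x + z) = T x + T z"
      using sums_add[OF f(2)[of x] f(2)[of z]] f(2)[of "x + z"]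
      by (simp add: bounded_clinear_add_eq[OF f(1)] scaleC_add_left sums_iff)
  next
    fix d x
    show "T (d *\<^sub>C x) = d *\<^sub>C T x"
      using bounded_linear.sums[OF bounded_linear_scaleC_right f(2)[of x], of d] f(2)[of "d *\<^sub>C x"]
      by (simp add: bounded_clinear_scaleC[OF f(1)] scaleC_complex_def sums_iff)
  qed
qed

section \<open>Resolvents\<close>

text \<open>Inverse of \<open>z - A\<close> on both sides, phrased through the graph of
  \<open>A\<close>. In this form a resolvent can be exhibited and compared with others without
  unfolding definite descriptions.\<close>

definition is_resolvent :: "'a::complex_banach oper \<Rightarrow> complex \<Rightarrow> ('a \<Rightarrow> 'a) \<Rightarrow> bool" where
  "is_resolvent A z R \<longleftrightarrow> bounded_clinear R \<and> (\<forall>y. (R y, z *\<^sub>C R y - y) \<in> A) \<and>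
     (\<forall>x u. (x, u) \<in> A \<longrightarrow> R (z *\<^sub>C x - u) = x)"

lemma linear_oper_add: "linear_oper A \<Longrightarrow> (x, y) \<in> A \<Longrightarrow> (x', y') \<in> A \<Longrightarrow> (x + x', y + y') \<in> A"
  and linear_oper_scaleC: "linear_oper A \<Longrightarrow> (x, y) \<in> A \<Longrightarrow> (c *\<^sub>C x, c *\<^sub>C y) \<in> A"
  unfolding linear_oper_def by blast+

lemma linear_oper_diff:
  assumes "linear_oper A" "(x, y) \<in> A" "(x', y') \<in> A"
  shows "(x - x', y - y') \<in> A"
  using linear_oper_add[OF assms(1,2) linear_oper_scaleC[OF assms(1,3), of "-1"]]
  by simp

lemma app_eq: "single_valued A \<Longrightarrow> (x, y) \<in> A \<Longrightarrow> app A x = y"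
  unfolding app_def by (rule the_equality) (auto dest: single_valuedD)

lemma linear_oper_app_eq: "linear_oper A \<Longrightarrow> (x, y) \<in> A \<Longrightarrow> app A x = y"
  by (rule app_eq) (auto simp: linear_oper_def)

lemma app_in: "linear_oper A \<Longrightarrow> x \<in> Domain A \<Longrightarrow> (x, app A x) \<in> A"
  using linear_oper_app_eq by (metis DomainE)

lemma single_valued_scalar_minus: "single_valued A \<Longrightarrow> single_valued (scalar_minus z A)"
  by (auto simp: single_valued_def scalar_minus_def)

lemma app_scalar_minus:
  assumes "linear_oper A" "x \<in> Domain A"
  shows "app (scalar_minus z A) x = z *\<^sub>C x - app A x"
  using app_in[OF assms] assms(1)
  by (intro app_eq single_valued_scalar_minus) (auto simp: scalar_minus_def linear_oper_def)

lemma is_resolvent_resolvent: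
  assumes A: "linear_oper A" and z: "z \<in> resolvent_set A"
  shows "is_resolvent A z (resolvent z A)"
proof -
  have bij: "bij_betw (app (scalar_minus z A)) (Domain A) UNIV"
    and lin: "bounded_clinear (resolvent z A)" using z by (auto simp: resolvent_set_def)
  have eq: "resolvent z A (z *\<^sub>C x - u) = x" if "(x, u) \<in> A" for x u
    unfolding resolvent_def app_def
  proof (rule the_equality)
    show "(z *\<^sub>C x - u, x) \<in> (scalar_minus z A)\<inverse>" using that by (auto simp: scalar_minus_def)
  next
    fix x' assume "(z *\<^sub>C x - u, x') \<in> (scalar_minus z A)\<inverse>"
    then obtain u' where u': "(x', u') \<in> A" "z *\<^sub>C x - u = z *\<^sub>C x' - u'"
      by (auto simp: scalar_minus_def)
    have "app (scalar_minus z A) x' = app (scalar_minus z A) x"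
      using that u' A by (simp add: app_scalar_minus DomainI linear_oper_app_eq)
    then show "x' = x" using bij u'(1) that by (auto simp: bij_betw_def inj_on_def)
  qed
  have "(resolvent z A y, z *\<^sub>C resolvent z A y - y) \<in> A" for y
  proof -
    obtain x where x: "x \<in> Domain A" "app (scalar_minus z A) x = y"
      using bij by (metis UNIV_I bij_betw_def imageE)
    then have "y = z *\<^sub>C x - app A x" using A by (simp add: app_scalar_minus)
    then show ?thesis using eq[OF app_in[OF A x(1)]] app_in[OF A x(1)] by simp
  qed
  then show ?thesis using lin eq by (simp add: is_resolvent_def)
qed

lemma resolvent_eq:
  assumes "is_resolvent A z R"
  shows "resolvent z A = R"
proof
  fix y
  show "resolvent z A y = R y"
    unfolding resolvent_def app_def
  proof (rule the_equality)
    have "(R y, z *\<^sub>C R y - y) \<in> A" using assms by (simp add: is_resolvent_def)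
    then show "(y, R y) \<in> (scalar_minus z A)\<inverse>" by (force simp: scalar_minus_def)
  next
    fix x assume "(y, x) \<in> (scalar_minus z A)\<inverse>"
    then show "x = R y" using assms by (auto simp: scalar_minus_def is_resolvent_def)
  qed
qed

lemma bounded_clinear_funpow:
  fixes R :: "'a::complex_banach \<Rightarrow> 'a"
  shows "bounded_clinear R \<Longrightarrow> bounded_clinear (R ^^ n)"
proof (induction n)
  case 0
  have "R ^^ 0 = (\<lambda>x. x)" by auto
  then show ?case using bounded_clinear_id by (simp only:)
next
  case (Suc n)
  have "R ^^ Suc n = (\<lambda>x. R ((R ^^ n) x))" by auto
  then show ?case using bounded_clinear_compose[of R "R ^^ n"] Suc by (simp only:)
qed

lemma norm_funpow_le:
  fixes R :: "'a::real_normed_vector \<Rightarrow> 'a"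
  assumes "\<And>x. norm (R x) \<le> r * norm x" "0 \<le> r"
  shows "norm ((R ^^ n) x) \<le> r ^ n * norm x"
proof (induction n)
  case (Suc n)
  have "norm ((R ^^ Suc n) x) \<le> r * norm ((R ^^ n) x)" using assms(1) by simp
  also have "\<dots> \<le> r * (r ^ n * norm x)" by (intro mult_left_mono Suc assms)
  finally show ?case by simp
qed simp

text \<open>With \<open>z - A = (w - A) - (w - z)\<close> the inverse is \<open>R\<close> composed
  with the geometric series of \<open>(w - z) R\<close>. The ratio is required to be at most 1/2
  rather than merely less than 1, so that later bounds are uniform in the base point.\<close>

lemma neumann_series:
  assumes A: "linear_oper A" and R: "is_resolvent A w R"
    and r: "\<And>x. norm (R x) \<le> r * norm x" "0 \<le> r" and z: "cmod (w - z) * r \<le> 1 / 2"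
  shows "is_resolvent A z (resolvent z A)"
    and "(\<lambda>k. (w - z) ^ k *\<^sub>C (R ^^ Suc k) y) sums resolvent z A y"
proof -
  have lin: "bounded_clinear R" using R by (simp add: is_resolvent_def)
  have linp: "bounded_clinear (R ^^ k)" for k by (rule bounded_clinear_funpow[OF lin])
  have le: "norm ((w - z) ^ k *\<^sub>C (R ^^ Suc k) y) \<le> (1 / 2) ^ k * (r * norm y)" for k y
  proof -
    have "norm ((w - z) ^ k *\<^sub>C (R ^^ Suc k) y) \<le> cmod (w - z) ^ k * (r ^ Suc k * norm y)"
      unfolding norm_scaleC norm_power by (intro mult_left_mono norm_funpow_le r) auto
    also have "\<dots> = (cmod (w - z) * r) ^ k * (r * norm y)"
      by (simp add: power_mult_distrib)
    also have "\<dots> \<le> (1 / 2) ^ k * (r * norm y)"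
      using z r(2) by (intro mult_right_mono power_mono) auto
    finally show ?thesis .
  qed
  have sm: "summable (\<lambda>k. (1 / 2) ^ k * (r * norm y))" for y :: 'a
    by (intro summable_mult2 summable_geometric) simp
  have summ: "summable (\<lambda>k. (w - z) ^ k *\<^sub>C (R ^^ Suc k) y)" for y
    by (rule summable_comparison_test'[OF sm, of 0]) (rule le)
  define S where "S y = (\<Sum>k. (w - z) ^ k *\<^sub>C (R ^^ Suc k) y)" for y
  have S: "(\<lambda>k. (w - z) ^ k *\<^sub>C (R ^^ Suc k) y) sums S y" for y
    unfolding S_def by (rule summable_sums[OF summ])
  have S_lin: "bounded_clinear S"
  proof (rule bounded_clinearI[where K = "2 * r"])
    show "S (x + y) = S x + S y" for x y
    proof (rule sums_unique2[OF S])
      show "(\<lambda>k. (w - z) ^ k *\<^sub>C (R ^^ Suc k) (x + y)) sums (S x + S y)"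
        using sums_add[OF S S, of x y] by (simp only: bounded_clinear_add_eq[OF linp] scaleC_add_right)
    qed
    show "S (c *\<^sub>C x) = c *\<^sub>C S x" for c x
    proof (rule sums_unique2[OF S])
      show "(\<lambda>k. (w - z) ^ k *\<^sub>C (R ^^ Suc k) (c *\<^sub>C x)) sums (c *\<^sub>C S x)"
        using bounded_linear.sums[OF bounded_linear_scaleC_right S, of c x]
        by (simp only: bounded_clinear_scaleC[OF linp] scaleC_scaleC mult.commute)
    qed
    fix x
    have "norm (S x) \<le> (\<Sum>k. (1 / 2) ^ k * (r * norm x))"
      unfolding S_def by (rule norm_suminf_le[OF le sm])
    also have "\<dots> = 2 * r * norm x"
      by (subst suminf_mult2[symmetric]) (simp_all add: suminf_geometric)
    finally show "norm (S x) \<le> 2 * r * norm x" .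
  qed
  have S_eq: "S y = R (y + (w - z) *\<^sub>C S y)" for y
  proof -
    have "(\<lambda>k. (w - z) *\<^sub>C R ((w - z) ^ k *\<^sub>C (R ^^ Suc k) y)) sums ((w - z) *\<^sub>C R (S y))"
      by (intro bounded_linear.sums[OF bounded_linear_scaleC_right] bounded_clinear_sums[OF lin S])
    then have "(\<lambda>k. (w - z) ^ Suc k *\<^sub>C (R ^^ Suc (Suc k)) y) sums ((w - z) *\<^sub>C R (S y))"
      by (simp add: bounded_clinear_scaleC[OF lin])
    from sums_Suc[OF this] have "(\<lambda>k. (w - z) ^ k *\<^sub>C (R ^^ Suc k) y) sums ((w - z) *\<^sub>C R (S y) + R y)"
      by simp
    from sums_unique2[OF S this] show ?thesis
      by (simp add: bounded_clinear_add_eq[OF lin] bounded_clinear_scaleC[OF lin] add.commute)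
  qed
  have "is_resolvent A z S"
    unfolding is_resolvent_def
  proof (intro conjI allI impI S_lin)
    have graph: "(S y, z *\<^sub>C S y - y) \<in> A" for y
    proof -
      let ?v = "y + (w - z) *\<^sub>C S y"
      have "(R ?v, w *\<^sub>C R ?v - ?v) \<in> A" using R by (simp add: is_resolvent_def)
      then show ?thesis using S_eq[of y] by (simp add: cvec.scale_left_diff_distrib algebra_simps)
    qed
    then show "(S y, z *\<^sub>C S y - y) \<in> A" for y .
    fix x u assume xu: "(x, u) \<in> A"
    \<comment> \<open>The defect \<open>d\<close> satisfies \<open>A d = z d\<close>, so
      \<open>R\<close> sends \<open>(w - z) d\<close> back to \<open>d\<close>; as the norm of
      \<open>(w - z) R\<close> is at most 1/2, this is possible only for
      \<open>d = 0\<close>.\<close>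
    define d where "d = x - S (z *\<^sub>C x - u)"
    have "(d, u - (z *\<^sub>C S (z *\<^sub>C x - u) - (z *\<^sub>C x - u))) \<in> A"
      unfolding d_def by (rule linear_oper_diff[OF A xu graph])
    then have "(d, z *\<^sub>C d) \<in> A"
      by (simp add: d_def cvec.scale_right_diff_distrib)
    then have "R (w *\<^sub>C d - z *\<^sub>C d) = d" using R by (simp add: is_resolvent_def)
    then have "norm d \<le> r * norm ((w - z) *\<^sub>C d)"
      using r(1)[of "w *\<^sub>C d - z *\<^sub>C d"] by (simp add: cvec.scale_left_diff_distrib)
    also have "\<dots> = (cmod (w - z) * r) * norm d" by (simp add: norm_scaleC)
    also have "\<dots> \<le> 1 / 2 * norm d" using z by (rule mult_right_mono) simp
    finally show "S (z *\<^sub>C x - u) = x" by (simp add: d_def)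
  qed
  then show "is_resolvent A z (resolvent z A)"
    "(\<lambda>k. (w - z) ^ k *\<^sub>C (R ^^ Suc k) y) sums resolvent z A y"
    using resolvent_eq S by metis+
qed

lemma resolvent_identity:
  assumes "is_resolvent A s R" "is_resolvent A t S"
  shows "R y - S y = (t - s) *\<^sub>C R (S y)"
proof -
  have R: "bounded_clinear R" using assms(1) by (simp add: is_resolvent_def)
  have "(S y, t *\<^sub>C S y - y) \<in> A" using assms(2) by (simp add: is_resolvent_def)
  then have "R (s *\<^sub>C S y - (t *\<^sub>C S y - y)) = S y" using assms(1) by (simp add: is_resolvent_def)
  moreover have "s *\<^sub>C S y - (t *\<^sub>C S y - y) = (s - t) *\<^sub>C S y + y"
    by (simp add: cvec.scale_left_diff_distrib)
  ultimately have "(s - t) *\<^sub>C R (S y) + R y = S y"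
    by (simp add: bounded_clinear_add_eq[OF R] bounded_clinear_scaleC[OF R])
  then show ?thesis by (simp add: cvec.scale_left_diff_distrib algebra_simps)
qed

text \<open>\<open>R x\<close> lies in the domain of \<open>A\<close> and hence of \<open>B\<close>,
  and \<open>z - B\<close> maps it to \<open>x + V (R x)\<close>; it remains to apply
  \<open>S\<close>.\<close>

lemma resolvent_difference:
  assumes "linear_oper A" "linear_oper B" "difference_on (Domain A) A B V"
    and R: "is_resolvent A z R" and S: "is_resolvent B z S"
  shows "R x - S x = S (V (R x))"
proof -
  have lin: "bounded_clinear S" using S by (simp add: is_resolvent_def)
  have RA: "(R x, z *\<^sub>C R x - x) \<in> A" using R by (simp add: is_resolvent_def)
  then have D: "R x \<in> Domain A" "app A (R x) = z *\<^sub>C R x - x"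
    using linear_oper_app_eq[OF assms(1)] by auto
  then have "R x \<in> Domain B" "V (R x) = app A (R x) - app B (R x)"
    using assms(3) by (auto simp: difference_on_def)
  moreover from this(2) have "app B (R x) = z *\<^sub>C R x - x - V (R x)" by (simp add: D(2))
  ultimately have "(R x, z *\<^sub>C R x - x - V (R x)) \<in> B"
    using app_in[OF assms(2)] by metis
  then have "S (z *\<^sub>C R x - (z *\<^sub>C R x - x - V (R x))) = R x" using S unfolding is_resolvent_def by blast
  then show ?thesis by (simp add: bounded_clinear_add_eq[OF lin] algebra_simps)
qed

lemma nuc_mono: "nuc T v c \<Longrightarrow> v \<le> w \<Longrightarrow> nuc T w c"
  unfolding nuc_def using order_trans by blast

text \<open>Telescoping: the difference of the next powers is \<open>(R - S)\<close> after a power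
  of \<open>R\<close>, plus \<open>S\<close> after the previous difference. Unrolled, there are
  \<open>p + 1\<close> terms, each containing \<open>V\<close> once and \<open>p + 2\<close>
  resolvents of norm at most \<open>r\<close>, which explains the bound.\<close>

lemma nuc_power_difference:
  fixes r v :: real
  assumes "bounded_clinear R" "bounded_clinear S" "\<And>x. R x - S x = S (V (R x))"
    and r: "\<And>x. norm (R x) \<le> r * norm x" "\<And>x. norm (S x) \<le> r * norm x" "0 \<le> r"
    and V: "nuc V v c"
  shows "\<exists>c. nuc (\<lambda>x. (R ^^ Suc p) x - (S ^^ Suc p) x) (Suc p * r ^ (p + 2) * v) c"
proof (induction p)
  case 0
  obtain c1 where "nuc (\<lambda>x. V (R x)) (r * v) c1"
    using nuc_compose_right[OF assms(1) r(1) V r(3)] by blast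
  then obtain c2 where "nuc (\<lambda>x. S (V (R x))) (r * (r * v)) c2"
    using nuc_compose_left[OF assms(2) r(2) _ r(3)] by blast
  then show ?case using assms(3) by (auto simp: power2_eq_square mult_ac)
next
  case (Suc p)
  have base: "\<exists>c. nuc (\<lambda>x. R x - S x) (r * (r * v)) c"
  proof -
    obtain c1 where "nuc (\<lambda>x. V (R x)) (r * v) c1"
      using nuc_compose_right[OF assms(1) r(1) V r(3)] by blast
    then obtain c2 where "nuc (\<lambda>x. S (V (R x))) (r * (r * v)) c2"
      using nuc_compose_left[OF assms(2) r(2) _ r(3)] by blast
    then show ?thesis using assms(3) by auto
  qed
  then obtain c0 where "nuc (\<lambda>x. R x - S x) (r * (r * v)) c0" by blast
  from nuc_compose_right[OF bounded_clinear_funpow[OF assms(1)] norm_funpow_le[OF r(1,3)] this]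
  obtain c1 where c1: "nuc (\<lambda>x. R ((R ^^ Suc p) x) - S ((R ^^ Suc p) x)) (r ^ Suc p * (r * (r * v))) c1"
    using r(3) by (meson zero_le_power)
  obtain c2 where "nuc (\<lambda>x. (R ^^ Suc p) x - (S ^^ Suc p) x) (Suc p * r ^ (p + 2) * v) c2"
    using Suc.IH by blast
  from nuc_compose_left[OF assms(2) r(2) this r(3)]
  obtain c3 where c3: "nuc (\<lambda>x. S ((R ^^ Suc p) x - (S ^^ Suc p) x)) (r * (Suc p * r ^ (p + 2) * v)) c3"
    by blast
  have "S ((R ^^ Suc p) x - (S ^^ Suc p) x) = S ((R ^^ Suc p) x) - S ((S ^^ Suc p) x)" for x
    using assms(2) by (simp only: bounded_clinear_def bounded_linear.linear linear_diff)
  then have "(\<lambda>x. (R ^^ Suc (Suc p)) x - (S ^^ Suc (Suc p)) x)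
    = (\<lambda>x. (R ((R ^^ Suc p) x) - S ((R ^^ Suc p) x)) + S ((R ^^ Suc p) x - (S ^^ Suc p) x))"
    by (intro ext) simp
  then have "nuc (\<lambda>x. (R ^^ Suc (Suc p)) x - (S ^^ Suc (Suc p)) x)
     (r ^ Suc p * (r * (r * v)) + r * (Suc p * r ^ (p + 2) * v)) (c1 + c3)"
    using nuc_add[OF c1 c3] by (simp only:)
  moreover have "r ^ Suc p * (r * (r * v)) + r * (Suc p * r ^ (p + 2) * v)
     = Suc (Suc p) * r ^ (Suc p + 2) * v" by (simp add: algebra_simps)
  ultimately show ?case by metis
qed

text \<open>The norm of the resolvent at \<open>0\<close> is not covered by the supremum in the definition.\<close>

lemma negative_oper_bound:
  assumes "negative_oper A"
  obtains K where "K \<ge> 1"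
    "\<And>t. t \<ge> 0 \<Longrightarrow> is_resolvent A (of_real t) (resolvent (of_real t) A)"
    "\<And>t x. t \<ge> 0 \<Longrightarrow> norm (resolvent (of_real t) A x) \<le> K / (1 + t) * norm x"
proof -
  have A: "linear_oper A" using assms by (simp add: negative_oper_def)
  have res: "is_resolvent A (of_real t) (resolvent (of_real t) A)" if "t \<ge> 0" for t
    using assms that by (intro is_resolvent_resolvent[OF A]) (auto simp: negative_oper_def)
  then have lin: "bounded_linear (resolvent (of_real t) A)" if "t \<ge> 0" for t
    using that by (auto simp: is_resolvent_def bounded_clinear_def)
  obtain M where M: "\<And>t. t > 0 \<Longrightarrow> onorm (\<lambda>x. (1 + t) *\<^sub>R resolvent (of_real t) A x) \<le> M"
    using assms unfolding negative_oper_def bdd_above_def by auto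
  \<comment> \<open>The entry 1 ensures \<open>1 / (2 * K) \<le> 1 / 2\<close>, which keeps all
    expansion radii and cell lengths small.\<close>
  define K where "K = Max {1, M, onorm (resolvent (of_real 0) A)}"
  have K: "1 \<le> K" "M \<le> K" "onorm (resolvent (of_real 0) A) \<le> K" by (auto simp: K_def)
  have "norm (resolvent (of_real t) A x) \<le> K / (1 + t) * norm x" if t: "t \<ge> 0" for t x
  proof (cases "t = 0")
    case True
    have "norm (resolvent (of_real 0) A x) \<le> onorm (resolvent (of_real 0) A) * norm x"
      by (rule onorm[OF lin]) simp
    also have "\<dots> \<le> K * norm x" using K(3) by (rule mult_right_mono) simp
    finally show ?thesis using True by simp
  next
    case False
    then have "norm ((1 + t) *\<^sub>R resolvent (of_real t) A x)
       \<le> onorm (\<lambda>x. (1 + t) *\<^sub>R resolvent (of_real t) A x) * norm x"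
      using t by (intro onorm bounded_linear_compose[OF bounded_linear_scaleR_right lin]) auto
    also have "\<dots> \<le> K * norm x"
      using M[of t] K(2) t False by (intro mult_right_mono) auto
    finally have "(1 + t) * norm (resolvent (of_real t) A x) \<le> K * norm x"
      using t by (simp only: norm_scaleR)
    then show ?thesis using t by (simp add: field_simps)
  qed
  then show ?thesis using that[of K] K(1) res by blast
qed

section \<open>The difference of the two resolvents and its trace\<close>

text \<open>One constant \<open>K\<close> serves both operators, so that their resolvents expand on
  the same discs and the expansions can be subtracted term by term.\<close>

locale neg_pair =
  fixes A B :: "'a::complex_banach oper" and V :: "'a \<Rightarrow> 'a" and K v :: real and \<tau> :: complex
  assumes AP: "approximation_property TYPE('a)"
    and linA: "linear_oper A" and linB: "linear_oper B" and K: "K \<ge> 1"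
    and resA: "\<And>t. t \<ge> 0 \<Longrightarrow> is_resolvent A (of_real t) (resolvent (of_real t) A)"
    and resB: "\<And>t. t \<ge> 0 \<Longrightarrow> is_resolvent B (of_real t) (resolvent (of_real t) B)"
    and boundA: "\<And>t x. t \<ge> 0 \<Longrightarrow> norm (resolvent (of_real t) A x) \<le> K / (1 + t) * norm x"
    and boundB: "\<And>t x. t \<ge> 0 \<Longrightarrow> norm (resolvent (of_real t) B x) \<le> K / (1 + t) * norm x"
    and diff: "difference_on (Domain A) A B V"
    and dense: "closure (Domain A) = UNIV"
    and V: "nuc V v \<tau>"
begin

text \<open>Up to sign, \<open>W t p\<close> is the \<open>p\<close>-th Taylor coefficient of \<open>D\<close> at \<open>t\<close>.\<close>

definition W :: "real \<Rightarrow> nat \<Rightarrow> 'a \<Rightarrow> 'a" where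
  "W t p x = (resolvent (of_real t) A ^^ Suc p) x - (resolvent (of_real t) B ^^ Suc p) x"

definition D :: "complex \<Rightarrow> 'a \<Rightarrow> 'a" where
  "D z x = resolvent z A x - resolvent z B x"

definition h :: "complex \<Rightarrow> complex" where "h z = nuclear_trace (D z)"

lemma v_nonneg: "0 \<le> v"
  using nuc_norm(2)[OF V] norm_ge_zero order_trans by blast

lemma nuc_W:
  assumes "t \<ge> 0"
  shows "nuc (W t p) (Suc p * (K / (1 + t)) ^ (p + 2) * v) (nuclear_trace (W t p))"
proof -
  have "\<exists>c. nuc (\<lambda>x. (resolvent (of_real t) A ^^ Suc p) x - (resolvent (of_real t) B ^^ Suc p) x)
     (Suc p * (K / (1 + t)) ^ (p + 2) * v) c"
    using resA[OF assms] resB[OF assms] boundA[OF assms] boundB[OF assms] K assms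
    by (intro nuc_power_difference[OF _ _ resolvent_difference[OF linA linB diff resA[OF assms] resB[OF assms]] _ _ _ V])
       (auto simp: is_resolvent_def)
  then obtain c where "nuc (W t p) (Suc p * (K / (1 + t)) ^ (p + 2) * v) c"
    unfolding W_def[abs_def] by blast
  with nuc_trace[OF AP this] show ?thesis by simp
qed

lemma expansion_resolvent:
  assumes t: "t \<ge> 0" and z: "cmod (of_real t - z) \<le> (1 + t) / (2 * K)"
  shows "(\<lambda>p. (of_real t - z) ^ p *\<^sub>C (resolvent (of_real t) A ^^ Suc p) x) sums resolvent z A x"
    and "(\<lambda>p. (of_real t - z) ^ p *\<^sub>C (resolvent (of_real t) B ^^ Suc p) x) sums resolvent z B x"
proof -
  have "cmod (of_real t - z) * (K / (1 + t)) \<le> 1 / 2"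
    using z t K by (simp add: field_simps)
  moreover have "0 \<le> K / (1 + t)" using K t by simp
  ultimately show "(\<lambda>p. (of_real t - z) ^ p *\<^sub>C (resolvent (of_real t) A ^^ Suc p) x) sums resolvent z A x"
    "(\<lambda>p. (of_real t - z) ^ p *\<^sub>C (resolvent (of_real t) B ^^ Suc p) x) sums resolvent z B x"
    by (rule neumann_series(2)[OF linA resA[OF t] boundA[OF t], rotated],
        rule neumann_series(2)[OF linB resB[OF t] boundB[OF t], rotated])
qed

text \<open>The Neumann series of the two resolvents are subtracted and then summed in the nuclear
  sense, which makes the trace a power series as well. The factor 4 is the sum of
  \<open>(p + 1) / 2 ^ p\<close>, and each power difference contributes \<open>(K / (1 + t))\<close>
  squared times \<open>v\<close>.\<close>

lemma expansion_D:
  assumes t: "t \<ge> 0" and z: "cmod (of_real t - z) \<le> (1 + t) / (2 * K)"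
  shows "(\<lambda>p. (of_real t - z) ^ p *\<^sub>C W t p x) sums D z x"
    and "(\<lambda>p. (of_real t - z) ^ p * nuclear_trace (W t p)) sums h z"
    and "cmod (h z) \<le> 4 * K\<^sup>2 * v / (1 + t)\<^sup>2"
    and "nuc (D z) (4 * K\<^sup>2 * v / (1 + t)\<^sup>2) (h z)"
proof -
  let ?r = "K / (1 + t)"
  show s: "(\<lambda>p. (of_real t - z) ^ p *\<^sub>C W t p x) sums D z x" for x
    using sums_diff[OF expansion_resolvent[OF assms], of x x]
    unfolding W_def D_def cvec.scale_right_diff_distrib .
  let ?w = "\<lambda>p. real (Suc p) * (1 / 2) ^ p * (?r\<^sup>2 * v)"
  have "(\<lambda>p. of_nat (Suc p) * (1 / 2) ^ p) sums (1 / (1 - 1 / 2 :: real)\<^sup>2)"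
    by (rule geometric_deriv_sums) simp
  from sums_mult2[OF this, of "?r\<^sup>2 * v"] have w: "?w sums (4 * K\<^sup>2 * v / (1 + t)\<^sup>2)"
    by (simp add: power2_eq_square field_simps)
  have nuc: "nuc (\<lambda>x. (of_real t - z) ^ p *\<^sub>C W t p x) (?w p) ((of_real t - z) ^ p * nuclear_trace (W t p))" for p
  proof (rule nuc_mono[OF nuc_scaleC[OF nuc_W[OF t]]])
    have "cmod ((of_real t - z) ^ p) * (Suc p * ?r ^ (p + 2) * v)
       = (cmod (of_real t - z) * ?r) ^ p * (Suc p * (?r\<^sup>2 * v))"
      by (simp only: norm_power power_mult_distrib power_add mult_ac)
    also have "\<dots> \<le> (1 / 2) ^ p * (Suc p * (?r\<^sup>2 * v))"
      using z t K v_nonneg by (intro mult_right_mono power_mono) (simp_all add: field_simps)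
    finally show "cmod ((of_real t - z) ^ p) * (Suc p * ?r ^ (p + 2) * v) \<le> ?w p" by (simp add: mult_ac)
  qed
  have "D z = (\<lambda>x. \<Sum>p. (of_real t - z) ^ p *\<^sub>C W t p x)"
    using s by (auto simp: sums_iff)
  with nuc_suminf(2,3)[OF nuc sums_summable[OF w]] w
  have 1: "nuc (D z) (4 * K\<^sup>2 * v / (1 + t)\<^sup>2) (\<Sum>p. (of_real t - z) ^ p * nuclear_trace (W t p))"
    "summable (\<lambda>p. (of_real t - z) ^ p * nuclear_trace (W t p))"
    by (simp_all add: sums_iff)
  have h: "h z = (\<Sum>p. (of_real t - z) ^ p * nuclear_trace (W t p))"
    unfolding h_def by (rule nuc_trace[OF AP 1(1)])
  show "(\<lambda>p. (of_real t - z) ^ p * nuclear_trace (W t p)) sums h z"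
    unfolding h using 1(2) by (rule summable_sums)
  show "nuc (D z) (4 * K\<^sup>2 * v / (1 + t)\<^sup>2) (h z)" using 1(1) h by simp
  then show "cmod (h z) \<le> 4 * K\<^sup>2 * v / (1 + t)\<^sup>2" by (rule nuc_norm)
qed

text \<open>On each disc \<open>h\<close> is given by the power series of traces. Since the radii
  grow linearly with the centre, the union of the discs contains a whole sector and not only a
  strip.\<close>

lemma h_holomorphic: "h holomorphic_on (\<Union>t\<in>{0..}. ball (of_real t) ((1 + t) / (2 * K)))"
proof (rule holomorphic_on_UN_open)
  fix t :: real assume "t \<in> {0..}"
  then have t: "t \<ge> 0" by simp
  show "h holomorphic_on ball (of_real t) ((1 + t) / (2 * K))"
  proof (rule power_series_holomorphic)
    fix z :: complex assume "z \<in> ball (of_real t) ((1 + t) / (2 * K))"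
    then have "cmod (of_real t - z) \<le> (1 + t) / (2 * K)" by (simp add: dist_norm)
    from expansion_D(2)[OF t this]
    have "(\<lambda>p. (of_real t - z) ^ p * nuclear_trace (W t p)) sums h z" .
    moreover have "(of_real t - z) ^ p = (-1) ^ p * (z - of_real t) ^ p" for p
      by (simp flip: power_mult_distrib)
    ultimately show "(\<lambda>p. ((-1) ^ p * nuclear_trace (W t p)) * (z - of_real t) ^ p) sums h z"
      by (simp add: mult_ac)
  qed
qed auto

text \<open>By the resolvent identity the resolvents are Lipschitz on the closed half-line.
  Continuity supplies the Borel measurability that the Bochner integral in \<open>oper_fun\<close>
  demands.\<close>

lemma resolvent_continuous:
  "continuous_on {0..} (\<lambda>t. resolvent (of_real t) A x)"
  "continuous_on {0..} (\<lambda>t. resolvent (of_real t) B x)"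
proof -
  have gen: "continuous_on {0..} (\<lambda>t. resolvent (of_real t) C x)"
    if res: "\<And>t. t \<ge> 0 \<Longrightarrow> is_resolvent C (of_real t) (resolvent (of_real t) C)"
      and b: "\<And>t x. t \<ge> 0 \<Longrightarrow> norm (resolvent (of_real t) C x) \<le> K / (1 + t) * norm x" for C
  proof (rule lipschitz_on_continuous_on[where L = "K * (K * norm x)"], rule lipschitz_onI)
    have b': "norm (resolvent (of_real t) C y) \<le> K * norm y" if "t \<ge> 0" for t y
    proof -
      have "K / (1 + t) \<le> K" using that K by (simp add: field_simps)
      then show ?thesis using b[OF that, of y] by (meson mult_right_mono norm_ge_zero order_trans)
    qed
    fix s t :: real assume st: "s \<in> {0..}" "t \<in> {0..}"
    have "dist (resolvent (of_real s) C x) (resolvent (of_real t) C x)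
      = norm ((of_real t - of_real s) *\<^sub>C resolvent (of_real s) C (resolvent (of_real t) C x))"
      using resolvent_identity[OF res res] st by (simp add: dist_norm)
    also have "\<dots> = \<bar>t - s\<bar> * norm (resolvent (of_real s) C (resolvent (of_real t) C x))"
      by (simp add: norm_scaleC flip: of_real_diff)
    also have "\<dots> \<le> \<bar>t - s\<bar> * (K * (K * norm x))"
      using st K by (intro mult_left_mono order_trans[OF b'] b') auto
    finally show "dist (resolvent (of_real s) C x) (resolvent (of_real t) C x) \<le> K * (K * norm x) * dist s t"
      by (simp add: dist_real_def abs_minus_commute mult_ac)
  qed (use K in simp)
  show "continuous_on {0..} (\<lambda>t. resolvent (of_real t) A x)"
    "continuous_on {0..} (\<lambda>t. resolvent (of_real t) B x)"
    by (intro gen resA resB boundA boundB; assumption)+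
qed

end

section \<open>The keyhole contour\<close>

lemma set_integrable_inverse_square:
  assumes "0 < a + c"
  shows "set_integrable lborel {a..} (\<lambda>x::real. C / (x + c)\<^sup>2)"
proof -
  have "(\<integral>\<^sup>+x. ennreal (1 / (x + c)\<^sup>2) * indicator {a..} x \<partial>lborel) = ennreal (0 - (- 1 / (a + c)))"
  proof (rule nn_integral_FTC_atLeast)
    fix x assume "a \<le> x"
    then show "((\<lambda>x. - 1 / (x + c)) has_real_derivative 1 / (x + c)\<^sup>2) (at x)"
      using assms by (auto intro!: derivative_eq_intros simp: power2_eq_square)
  next
    show "((\<lambda>x. - 1 / (x + c)) \<longlongrightarrow> 0) at_top" by real_asymp
  qed auto
  then have fin: "(\<integral>\<^sup>+x. ennreal (1 / (x + c)\<^sup>2) * indicator {a..} x \<partial>lborel) < \<infinity>" by simp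
  have "integrable lborel (\<lambda>x. indicator {a..} x *\<^sub>R (1 / (x + c)\<^sup>2))"
  proof (rule integrableI_bounded)
    have "(\<integral>\<^sup>+x. ennreal (norm (indicator {a..} x *\<^sub>R (1 / (x + c)\<^sup>2))) \<partial>lborel)
       = (\<integral>\<^sup>+x. ennreal (1 / (x + c)\<^sup>2) * indicator {a..} x \<partial>lborel)"
      by (intro nn_integral_cong) (auto simp: indicator_def)
    then show "(\<integral>\<^sup>+x. ennreal (norm (indicator {a..} x *\<^sub>R (1 / (x + c)\<^sup>2))) \<partial>lborel) < \<infinity>"
      using fin by simp
  qed auto
  then have "set_integrable lborel {a..} (\<lambda>x. 1 / (x + c)\<^sup>2)" by (simp add: set_integrable_def)
  from set_integrable_mult_right[OF this, of C] show ?thesis by simp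
qed

lemma set_integrable_continuous_bound:
  fixes g :: "real \<Rightarrow> complex"
  assumes "0 < a + c" "continuous_on {a..} g" "\<And>x. x \<ge> a \<Longrightarrow> norm (g x) \<le> C / (x + c)\<^sup>2"
  shows "set_integrable lborel {a..} g"
proof (rule set_integrable_bound[OF set_integrable_inverse_square[OF assms(1), of C]])
  show "set_borel_measurable lborel {a..} g"
    using set_measurable_continuous_on[OF _ assms(2)] by (simp add: set_borel_measurable_def)
  show "AE x in lborel. x \<in> {a..} \<longrightarrow> norm (g x) \<le> norm (C / (x + c)\<^sup>2)"
    by (intro AE_I2 impI order_trans[OF assms(3)]) (simp_all only: real_norm_def abs_ge_self atLeast_iff)
qed

lemma set_integral_FTC_atLeast:
  fixes f P :: "real \<Rightarrow> complex"
  assumes int: "set_integrable lborel {l..} f"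
    and der: "\<And>t S. t \<ge> l \<Longrightarrow> (P has_vector_derivative f t) (at t within S)"
    and lim: "(P \<longlongrightarrow> L) at_top"
  shows "(LINT t:{l..}|lborel. f t) = L - P l"
proof -
  have "((\<lambda>b. LINT t:{l..b}|lborel. f t) \<longlongrightarrow> (LINT t:{l..}|lborel. f t)) at_top"
    by (rule tendsto_set_lebesgue_integral_at_top[OF _ int]) auto
  moreover have "\<forall>\<^sub>F b in at_top. (LINT t:{l..b}|lborel. f t) = P b - P l"
  proof (rule eventually_mono[OF eventually_ge_at_top[of l]])
    fix b assume b: "l \<le> b"
    have hi: "(f has_integral (P b - P l)) {l..b}"
      by (rule fundamental_theorem_of_calculus[OF b der]) simp
    have "set_integrable lborel {l..b} f" by (rule set_integrable_subset[OF int]) auto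
    from trans[OF set_borel_integral_eq_integral(2)[OF this] integral_unique[OF hi]]
    show "(LINT t:{l..b}|lborel. f t) = P b - P l" .
  qed
  ultimately have "((\<lambda>b. P b - P l) \<longlongrightarrow> (LINT t:{l..}|lborel. f t)) at_top"
    by (rule Lim_transform_eventually)
  moreover have "((\<lambda>b. P b - P l) \<longlongrightarrow> L - P l) at_top" by (intro tendsto_intros lim)
  ultimately show ?thesis by (rule tendsto_unique[OF trivial_limit_at_top_linorder])
qed

lemma has_contour_integral_ray:
  assumes "a < b"
  shows "(g has_contour_integral I) (linepath (of_real a * c) (of_real b * c)) \<longleftrightarrow>
    ((\<lambda>r. g (of_real r * c) * c) has_integral I) {a..b}"
proof -
  have "(g has_contour_integral I) (linepath (of_real a * c) (of_real b * c)) \<longleftrightarrow>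
    ((\<lambda>z. g (z * c) * c) has_contour_integral I) (linepath (of_real a) (of_real b))"
  proof -
    have "linepath (of_real a * c) (of_real b * c) x = linepath (of_real a) (of_real b) x * c" for x
      by (simp add: linepath_def scaleR_conv_of_real algebra_simps)
    moreover have "of_real b * c - of_real a * c = c * (of_real b - of_real a)" by (simp add: algebra_simps)
    ultimately show ?thesis
      unfolding has_contour_integral_linepath by (simp only: mult.assoc)
  qed
  also have "\<dots> \<longleftrightarrow> ((\<lambda>r. g (of_real r * c) * c) has_integral I) {a..b}"
    using assms by (subst has_contour_integral_linepath_Reals_iff) auto
  finally show ?thesis .
qed

text \<open>Put \<open>a\<close> for the square of \<open>sin (\<theta> / 2)\<close>. By the law of
  cosines the squared distance is at least \<open>t^2 + r^2 - 2 t r cos \<theta>\<close>, which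
  equals \<open>a (t + r)^2 + (1 - a) (t - r)^2\<close>; dropping the last term gives the bound. All
  kernel estimates on the contour come from here.\<close>

lemma norm_diff_off_sector:
  assumes "cos s \<le> cos \<theta>" "0 \<le> t" "0 \<le> r" "0 \<le> \<theta>" "\<theta> \<le> 2 * pi"
  shows "sin (\<theta> / 2) * (t + r) \<le> cmod (of_real t - of_real r * cis s)"
proof (rule power2_le_imp_le)
  have c: "cos \<theta> = 1 - 2 * (sin (\<theta> / 2))\<^sup>2" using cos_double_sin[of "\<theta> / 2"] by simp
  have "(sin (\<theta> / 2) * (t + r))\<^sup>2 = (sin (\<theta> / 2))\<^sup>2 * (t + r)\<^sup>2" by (simp add: power_mult_distrib)
  also have "\<dots> \<le> (sin (\<theta> / 2))\<^sup>2 * (t + r)\<^sup>2 + (1 - (sin (\<theta> / 2))\<^sup>2) * (t - r)\<^sup>2"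
    by (simp add: abs_square_le_1)
  also have "\<dots> = t\<^sup>2 + r\<^sup>2 - 2 * t * r * cos \<theta>"
    unfolding c by (simp add: power2_eq_square algebra_simps)
  also have "\<dots> \<le> t\<^sup>2 + r\<^sup>2 - 2 * t * r * cos s"
    using mult_left_mono[OF assms(1), of "2 * t * r"] assms(2,3) by simp
  also have "\<dots> = (t - r * cos s)\<^sup>2 + (r * sin s)\<^sup>2"
  proof -
    have "(r * sin s)\<^sup>2 = r\<^sup>2 - r\<^sup>2 * (cos s)\<^sup>2" by (simp add: power_mult_distrib sin_squared_eq algebra_simps)
    then show ?thesis by (simp add: power2_eq_square algebra_simps)
  qed
  also have "\<dots> = (cmod (of_real t - of_real r * cis s))\<^sup>2"
    by (simp add: cmod_power2)
  finally show "(sin (\<theta> / 2) * (t + r))\<^sup>2 \<le> (cmod (of_real t - of_real r * cis s))\<^sup>2" .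
qed simp

lemma cos_le_of_between:
  assumes "0 \<le> \<theta>" "\<theta> \<le> s" "s \<le> 2 * pi - \<theta>"
  shows "cos s \<le> cos \<theta>"
proof (cases "s \<le> pi")
  case True
  then show ?thesis using assms by (intro cos_monotone_0_pi_le) auto
next
  case False
  have "cos (2 * pi - s) \<le> cos \<theta>" using assms False by (intro cos_monotone_0_pi_le) auto
  then show ?thesis by (simp add: cos_diff)
qed

locale keyhole =
  fixes \<theta> \<delta> :: real
  assumes \<theta>: "0 < \<theta>" "\<theta> < pi / 2" and \<delta>: "0 < \<delta>"
begin

abbreviation inner_arc :: "real \<Rightarrow> complex" where "inner_arc \<equiv> part_circlepath 0 \<delta> \<theta> (2 * pi - \<theta>)"

text \<open>The far end is closed by a vertical chord instead of an arc: its real part is constant,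
  so the distance to a point \<open>t\<close> of the axis and the branch of the logarithm are under
  control along it.\<close>

definition truncated :: "real \<Rightarrow> real \<Rightarrow> complex" where
  "truncated R = linepath (of_real R * cis \<theta>) (of_real \<delta> * cis \<theta>) +++ inner_arc +++
     linepath (of_real \<delta> * cis (- \<theta>)) (of_real R * cis (- \<theta>)) +++
     linepath (of_real R * cis (- \<theta>)) (of_real R * cis \<theta>)"

lemma sin_cos_pos: "0 < sin \<theta>" "0 < cos \<theta>" "0 < sin (\<theta> / 2)"
  using \<theta> by (auto intro!: sin_gt_zero cos_gt_zero)

lemma cis_end: "cis (2 * pi - \<theta>) = cis (- \<theta>)"
  by (simp add: complex_eq_iff cos_diff sin_diff)

lemma arc_ends: "pathstart inner_arc = of_real \<delta> * cis \<theta>" "pathfinish inner_arc = of_real \<delta> * cis (- \<theta>)"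
  using cis_end by (simp_all add: cis_conv_exp)

lemma path_image_arc: "path_image inner_arc = (\<lambda>s. of_real \<delta> * cis s) ` {\<theta>..2 * pi - \<theta>}"
  using \<theta> by (subst path_image_part_circlepath') (auto simp: closed_segment_eq_real_ivl)

lemma segment_image:
  fixes c :: complex
  shows "closed_segment (of_real a * c) (of_real b * c) = (\<lambda>r. of_real r * c) ` closed_segment a b"
proof -
  have "linear (\<lambda>r. of_real r * c)" by (rule linearI) (simp_all add: algebra_simps scaleR_conv_of_real)
  from closed_segment_linear_image[OF this] show ?thesis .
qed

lemma valid_truncated [simp]: "valid_path (truncated R)" "pathstart (truncated R) = of_real R * cis \<theta>"
  "pathfinish (truncated R) = of_real R * cis \<theta>"
  by (auto simp: truncated_def arc_ends simp del: pathstart_part_circlepath pathfinish_part_circlepath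
      intro!: valid_path_join)

lemma has_contour_integral_truncatedI:
  assumes "(g has_contour_integral i1) (linepath (of_real R * cis \<theta>) (of_real \<delta> * cis \<theta>))"
    "(g has_contour_integral i2) inner_arc"
    "(g has_contour_integral i3) (linepath (of_real \<delta> * cis (- \<theta>)) (of_real R * cis (- \<theta>)))"
    "(g has_contour_integral i4) (linepath (of_real R * cis (- \<theta>)) (of_real R * cis \<theta>))"
  shows "(g has_contour_integral (i1 + (i2 + (i3 + i4)))) (truncated R)"
  unfolding truncated_def
  by (intro has_contour_integral_join assms valid_path_join)
     (auto simp: arc_ends simp del: pathstart_part_circlepath pathfinish_part_circlepath)

lemma path_image_truncated:
  "path_image (truncated R) = closed_segment (of_real R * cis \<theta>) (of_real \<delta> * cis \<theta>) \<union>
     path_image inner_arc \<union> closed_segment (of_real \<delta> * cis (- \<theta>)) (of_real R * cis (- \<theta>)) \<union>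
     closed_segment (of_real R * cis (- \<theta>)) (of_real R * cis \<theta>)"
  unfolding truncated_def 
  by (simp add: path_image_join arc_ends Un_assoc del: pathstart_part_circlepath pathfinish_part_circlepath)

text \<open>These three pieces of the contour do not meet the half-line to the right of
  \<open>t\<close>. Hence the principal branch of \<open>Ln (of_real t - z)\<close> is holomorphic
  along them and can serve as a primitive there.\<close>

lemma rays_off_positive:
  assumes "t > 0" "R > \<delta>"
  shows "closed_segment (of_real R * cis \<theta>) (of_real \<delta> * cis \<theta>) \<subseteq> {z. of_real t - z \<notin> \<real>\<^sub>\<le>\<^sub>0}"
    "closed_segment (of_real \<delta> * cis (- \<theta>)) (of_real R * cis (- \<theta>)) \<subseteq> {z. of_real t - z \<notin> \<real>\<^sub>\<le>\<^sub>0}"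
    "path_image inner_arc \<subseteq> {z. of_real t - z \<notin> \<real>\<^sub>\<le>\<^sub>0}"
proof -
  show "closed_segment (of_real R * cis \<theta>) (of_real \<delta> * cis \<theta>) \<subseteq> {z. of_real t - z \<notin> \<real>\<^sub>\<le>\<^sub>0}"
    "closed_segment (of_real \<delta> * cis (- \<theta>)) (of_real R * cis (- \<theta>)) \<subseteq> {z. of_real t - z \<notin> \<real>\<^sub>\<le>\<^sub>0}"
    using sin_cos_pos \<delta> assms unfolding segment_image
    by (auto simp: complex_nonpos_Reals_iff closed_segment_eq_real_ivl)
  show "path_image inner_arc \<subseteq> {z. of_real t - z \<notin> \<real>\<^sub>\<le>\<^sub>0}"
    unfolding path_image_arc
  proof safe
    fix s assume s: "s \<in> {\<theta>..2 * pi - \<theta>}" and neg: "of_real t - of_real \<delta> * cis s \<in> \<real>\<^sub>\<le>\<^sub>0"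
    have "cos s \<le> cos \<theta>" using s \<theta> by (intro cos_le_of_between) auto
    moreover have "cos \<theta> < 1" using cos_monotone_0_pi[of 0 \<theta>] \<theta> by simp
    moreover have "sin s = 0" "\<delta> * cos s \<ge> t" using neg \<delta> by (auto simp: complex_nonpos_Reals_iff)
    moreover from this(2) have "0 < \<delta> * cos s" using assms(1) by linarith
    then have "cos s > 0" using \<delta> by (simp add: zero_less_mult_iff)
    moreover have "cos s = 1 \<or> cos s = - 1"
      using sin_cos_squared_add[of s] \<open>sin s = 0\<close> by (simp add: power2_eq_1_iff)
    ultimately show False by linarith
  qed
qed

lemma end_segment_Re:
  assumes "z \<in> closed_segment (of_real R * cis (- \<theta>)) (of_real R * cis \<theta>)"
  shows "Re z = R * cos \<theta>"
proof -
  obtain u where "z = (1 - u) *\<^sub>R (of_real R * cis (- \<theta>)) + u *\<^sub>R (of_real R * cis \<theta>)"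
    using assms by (auto simp: closed_segment_def)
  then have "Re z = (1 - u) * (R * cos \<theta>) + u * (R * cos \<theta>)" by simp
  then show ?thesis by (simp add: algebra_simps)
qed

lemma not_in_truncated:
  assumes "t > 0" "R > \<delta>" "R * cos \<theta> > t"
  shows "of_real t \<notin> path_image (truncated R)"
  using rays_off_positive[OF assms(1,2)] end_segment_Re[of "of_real t" R] assms(3)
  unfolding path_image_truncated by (auto simp: subset_iff)

text \<open>Along the rays and the arc \<open>Ln (of_real t - z)\<close> is a primitive of
  \<open>1 / (z - t)\<close>; the chord crosses its cut and needs \<open>Ln (z - of_real t)\<close>
  instead. At the two corners the branches differ by \<open>\<i> * pi\<close> with opposite signs,
  and these two jumps add up to the full \<open>2 * pi * \<i>\<close>.\<close>

lemma winding_number_truncated: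
  assumes t: "t > 0" and R: "R > \<delta>" "R * cos \<theta> > t"
  shows "winding_number (truncated R) (of_real t) = 1"
proof -
  let ?p = "of_real R * cis \<theta>" and ?q = "of_real R * cis (- \<theta>)"
  let ?S = "{z. of_real t - z \<notin> \<real>\<^sub>\<le>\<^sub>0}"
  have L: "((\<lambda>z. Ln (of_real t - z)) has_field_derivative 1 / (z - of_real t)) (at z within ?S)" if "z \<in> ?S" for z
  proof -
    have "of_real t - z \<noteq> 0" using that by auto
    then have "- inverse (of_real t - z) = 1 / (z - of_real t)" by (simp add: field_simps)
    then show ?thesis using that by (auto intro!: derivative_eq_intros)
  qed
  note prim = contour_integral_primitive[where S = ?S and f = "\<lambda>z. Ln (of_real t - z)", OF L]
  have 1: "((\<lambda>z. 1 / (z - of_real t)) has_contour_integral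
      (Ln (of_real t - of_real \<delta> * cis \<theta>) - Ln (of_real t - ?p))) (linepath ?p (of_real \<delta> * cis \<theta>))"
    using prim[of "linepath ?p (of_real \<delta> * cis \<theta>)"] rays_off_positive[OF t R(1)] by simp
  have 2: "((\<lambda>z. 1 / (z - of_real t)) has_contour_integral
      (Ln (of_real t - of_real \<delta> * cis (- \<theta>)) - Ln (of_real t - of_real \<delta> * cis \<theta>))) inner_arc"
    using prim[of inner_arc] rays_off_positive[OF t R(1)] by (simp only: arc_ends valid_path_part_circlepath)
  have 3: "((\<lambda>z. 1 / (z - of_real t)) has_contour_integral
      (Ln (of_real t - ?q) - Ln (of_real t - of_real \<delta> * cis (- \<theta>)))) (linepath (of_real \<delta> * cis (- \<theta>)) ?q)"
    using prim[of "linepath (of_real \<delta> * cis (- \<theta>)) ?q"] rays_off_positive[OF t R(1)] by simp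
  have 4: "((\<lambda>z. 1 / (z - of_real t)) has_contour_integral
      (Ln (?p - of_real t) - Ln (?q - of_real t))) (linepath ?q ?p)"
  proof -
    have "((\<lambda>z. Ln (z - of_real t)) has_field_derivative 1 / (z - of_real t)) (at z within {z. Re z = R * cos \<theta>})"
      if "z \<in> {z. Re z = R * cos \<theta>}" for z
    proof -
      have "z - of_real t \<notin> \<real>\<^sub>\<le>\<^sub>0" using that R(2) by (auto simp: complex_nonpos_Reals_iff)
      then show ?thesis by (auto intro!: derivative_eq_intros simp: divide_inverse)
    qed
    from contour_integral_primitive[OF this, of "linepath ?q ?p"] show ?thesis
      using end_segment_Re by fastforce
  qed
  have "R > 0" using R(1) \<delta> by simp
  then have Im: "Im (?p - of_real t) > 0" "Im (?q - of_real t) < 0" using sin_cos_pos by auto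
  have Lp: "Ln (of_real t - ?p) = Ln (?p - of_real t) - \<i> * pi"
  proof -
    have "?p - of_real t \<noteq> 0" using Im(1) by force
    from Ln_minus[OF this] show ?thesis using Im(1) by (simp only: minus_diff_eq) simp
  qed
  have Lq: "Ln (of_real t - ?q) = Ln (?q - of_real t) + \<i> * pi"
  proof -
    have "?q - of_real t \<noteq> 0" using Im(2) by force
    from Ln_minus[OF this] show ?thesis using Im(2) by (simp only: minus_diff_eq) auto
  qed
  have "((\<lambda>z. 1 / (z - of_real t)) has_contour_integral (2 * pi * \<i>)) (truncated R)"
    using has_contour_integral_truncatedI[OF 1 2 3 4] unfolding Lp Lq by (simp add: mult_ac)
  then have "contour_integral (truncated R) (\<lambda>z. 1 / (z - of_real t)) = 2 * pi * \<i>"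
    by (rule contour_integral_unique)
  then show ?thesis
    using winding_number_valid_path[OF valid_truncated(1) not_in_truncated[OF t R]] by simp
qed

text \<open>Integration by parts: the difference of \<open>h w / (w - t)\<close> and
  \<open>\<Xi> w / (w - t)^2\<close> is the derivative of \<open>\<Xi> w / (w - t)\<close>, so it
  integrates to 0 over the closed path. Cauchy's formula for \<open>h\<close> thus becomes one for
  its primitive.\<close>

lemma Cauchy_truncated:
  assumes U: "open U" "convex U" and der: "\<And>z. z \<in> U \<Longrightarrow> (\<Xi> has_field_derivative h z) (at z)"
    and sub: "path_image (truncated R) \<subseteq> U" "of_real t \<in> U"
    and t: "t > 0" and R: "R > \<delta>" "R * cos \<theta> > t"
  shows "((\<lambda>z. \<Xi> z / (z - of_real t)\<^sup>2) has_contour_integral (2 * pi * \<i> * h (of_real t))) (truncated R)"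
proof -
  have hol: "h holomorphic_on U"
  proof -
    have "\<Xi> holomorphic_on U" using der U(1) by (meson holomorphic_onI field_differentiable_at_within field_differentiable_def)
    then have "deriv \<Xi> holomorphic_on U" using U(1) by (rule holomorphic_deriv)
    then show ?thesis using der by (metis DERIV_imp_deriv holomorphic_transform)
  qed
  have nin: "of_real t \<notin> path_image (truncated R)" by (rule not_in_truncated[OF t R])
  have "((\<lambda>w. h w / (w - of_real t)) has_contour_integral
    (2 * pi * \<i> * winding_number (truncated R) (of_real t) * h (of_real t))) (truncated R)"
    using sub nin U by (intro Cauchy_integral_formula_convex_simple[OF U(2) hol]) (auto simp: interior_open)
  then have 1: "((\<lambda>w. h w / (w - of_real t)) has_contour_integral (2 * pi * \<i> * h (of_real t))) (truncated R)"
    by (simp add: winding_number_truncated[OF t R])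
  have "((\<lambda>w. h w / (w - of_real t) - \<Xi> w / (w - of_real t)\<^sup>2) has_contour_integral
    (\<Xi> (pathfinish (truncated R)) / (pathfinish (truncated R) - of_real t)
     - \<Xi> (pathstart (truncated R)) / (pathstart (truncated R) - of_real t))) (truncated R)"
  proof (rule contour_integral_primitive[where S = "U - {of_real t}" and f = "\<lambda>w. \<Xi> w / (w - of_real t)"])
    fix w assume w: "w \<in> U - {of_real t}"
    then have ne: "w - of_real t \<noteq> 0" and "w \<in> U" by auto
    have "((\<lambda>w. \<Xi> w / (w - of_real t)) has_field_derivative
       (h w * (w - of_real t) - \<Xi> w * 1) / ((w - of_real t) * (w - of_real t))) (at w within U - {of_real t})"
      by (rule DERIV_divide)
         (use ne \<open>w \<in> U\<close> in \<open>auto intro!: derivative_eq_intros has_field_derivative_at_within[OF der]\<close>)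
    also have "(h w * (w - of_real t) - \<Xi> w * 1) / ((w - of_real t) * (w - of_real t))
      = h w / (w - of_real t) - \<Xi> w / (w - of_real t)\<^sup>2"
      using ne by (simp add: diff_divide_distrib power2_eq_square)
    finally show "((\<lambda>w. \<Xi> w / (w - of_real t)) has_field_derivative
       h w / (w - of_real t) - \<Xi> w / (w - of_real t)\<^sup>2) (at w within U - {of_real t})" .
  qed (use sub nin in auto)
  then have 2: "((\<lambda>w. h w / (w - of_real t) - \<Xi> w / (w - of_real t)\<^sup>2) has_contour_integral 0) (truncated R)"
    by simp
  from has_contour_integral_diff[OF 1 2] show ?thesis by simp
qed

lemma set_integrable_ray:
  assumes cont: "continuous_on U \<Xi>" and bnd: "\<And>z. z \<in> U \<Longrightarrow> cmod (\<Xi> z) \<le> C"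
    and ray: "\<And>r. r \<ge> \<delta> \<Longrightarrow> of_real r * cis s \<in> U" and s: "cos s \<le> cos \<theta>" and t: "t > 0"
  shows "set_integrable lborel {\<delta>..} (\<lambda>r. \<Xi> (of_real r * cis s) / (of_real r * cis s - of_real t)\<^sup>2 * cis s)"
proof (rule set_integrable_continuous_bound[where c = t and C = "C / (sin (\<theta> / 2))\<^sup>2"])
  have low: "sin (\<theta> / 2) * (r + t) \<le> cmod (of_real r * cis s - of_real t)" if "r \<ge> \<delta>" for r
    using norm_diff_off_sector[OF s, of t r] that t \<theta> \<delta> by (simp add: norm_minus_commute add.commute)
  have pos: "0 < sin (\<theta> / 2) * (r + t)" if "r \<ge> \<delta>" for r
    using that sin_cos_pos t \<delta> by simp
  have ne: "of_real r * cis s - of_real t \<noteq> 0" if "r \<ge> \<delta>" for r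
    using low[OF that] pos[OF that] by auto
  show "continuous_on {\<delta>..} (\<lambda>r. \<Xi> (of_real r * cis s) / (of_real r * cis s - of_real t)\<^sup>2 * cis s)"
    using ray ne
    by (intro continuous_intros continuous_on_compose2[OF cont]) auto
  fix r assume r: "r \<ge> \<delta>"
  have "norm (\<Xi> (of_real r * cis s) / (of_real r * cis s - of_real t)\<^sup>2 * cis s)
     = cmod (\<Xi> (of_real r * cis s)) / (cmod (of_real r * cis s - of_real t))\<^sup>2"
    by (simp add: norm_mult norm_divide norm_power)
  also have "\<dots> \<le> C / (sin (\<theta> / 2) * (r + t))\<^sup>2"
    using bnd[OF ray[OF r]] low[OF r] pos[OF r] by (intro frac_le power_mono) (auto intro: order_trans[OF norm_ge_zero])
  finally show "norm (\<Xi> (of_real r * cis s) / (of_real r * cis s - of_real t)\<^sup>2 * cis s)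
     \<le> C / (sin (\<theta> / 2))\<^sup>2 / (r + t)\<^sup>2" by (simp add: power_mult_distrib)
qed (use t \<delta> in simp)

text \<open>Let the truncation recede to infinity. The chord has length at most
  \<open>2 * R\<close>, while the integrand on it is at most
  \<open>C / (R * cos \<theta> - t)^2\<close>, so its contribution vanishes and the two rays become
  improper integrals.\<close>

lemma Cauchy_Gamma:
  assumes U: "open U" "convex U" and der: "\<And>z. z \<in> U \<Longrightarrow> (\<Xi> has_field_derivative h z) (at z)"
    and bnd: "\<And>z. z \<in> U \<Longrightarrow> cmod (\<Xi> z) \<le> C"
    and ray: "\<And>r s. 0 \<le> r \<Longrightarrow> \<bar>s\<bar> \<le> \<theta> \<Longrightarrow> of_real r * cis s \<in> U" and ball: "cball 0 \<delta> \<subseteq> U"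
    and t: "t > 0"
  shows "Gamma_integral \<theta> \<delta> (\<lambda>z. \<Xi> z / (z - of_real t)\<^sup>2) = 2 * pi * \<i> * h (of_real t)"
proof -
  let ?g = "\<lambda>z. \<Xi> z / (z - of_real t)\<^sup>2"
  have cont: "continuous_on U \<Xi>"
    using der by (meson DERIV_isCont continuous_at_imp_continuous_on)
  have sub: "path_image (truncated R) \<subseteq> U" if "R > \<delta>" for R
  proof -
    have "closed_segment (of_real a * cis s) (of_real b * cis s') \<subseteq> U"
      if "0 \<le> a" "0 \<le> b" "\<bar>s\<bar> \<le> \<theta>" "\<bar>s'\<bar> \<le> \<theta>" for a b s s'
      using that by (intro closed_segment_subset ray U)
    moreover have "path_image inner_arc \<subseteq> cball 0 \<delta>"
      unfolding path_image_arc using \<delta> by (auto simp: norm_mult)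
    ultimately show ?thesis
      unfolding path_image_truncated using ball that \<delta> \<theta> by auto
  qed
  have tU: "of_real t \<in> U" using ray[of t 0] t \<theta> by simp
  have int: "set_integrable lborel {\<delta>..} (\<lambda>r. ?g (of_real r * cis s) * cis s)" if "s = \<theta> \<or> s = - \<theta>" for s
    using that \<theta> \<delta> t by (intro set_integrable_ray[OF cont bnd]) (auto intro!: ray)
  have ray_int: "(?g has_contour_integral (LINT r:{\<delta>..R}|lborel. ?g (of_real r * cis s) * cis s))
      (linepath (of_real \<delta> * cis s) (of_real R * cis s))" if s: "s = \<theta> \<or> s = - \<theta>" and R: "R > \<delta>" for s R
  proof -
    have "set_integrable lborel {\<delta>..R} (\<lambda>r. ?g (of_real r * cis s) * cis s)"
      by (rule set_integrable_subset[OF int[OF s]]) auto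
    from set_borel_integral_eq_integral[OF this] show ?thesis
      by (simp add: has_contour_integral_ray[OF R] integrable_integral)
  qed
  have arc_int: "(?g has_contour_integral (contour_integral inner_arc ?g)) inner_arc"
  proof (rule has_contour_integral_integral, rule contour_integrable_continuous_part_circlepath)
    have "path_image inner_arc \<subseteq> U - {of_real t}"
      using rays_off_positive(3)[OF t, of "\<delta> + 1"] ball \<delta>
      by (fastforce simp: path_image_arc norm_mult)
    then show "continuous_on (path_image inner_arc) ?g"
      by (intro continuous_intros continuous_on_subset[OF cont]) auto
  qed
  define E where "E R = contour_integral (linepath (of_real R * cis (- \<theta>)) (of_real R * cis \<theta>)) ?g" for R
  have eq: "- (LINT r:{\<delta>..R}|lborel. ?g (of_real r * cis \<theta>) * cis \<theta>) + contour_integral inner_arc ?g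
     + (LINT r:{\<delta>..R}|lborel. ?g (of_real r * cis (- \<theta>)) * cis (- \<theta>)) = 2 * pi * \<i> * h (of_real t) - E R"
    and E: "cmod (E R) \<le> C / (R * cos \<theta> - t)\<^sup>2 * (2 * R)"
    if R: "R > \<delta>" "R * cos \<theta> > t" for R
  proof -
    let ?seg = "linepath (of_real R * cis (- \<theta>)) (of_real R * cis \<theta>)"
    have segU: "closed_segment (of_real R * cis (- \<theta>)) (of_real R * cis \<theta>) \<subseteq> U"
      using sub[OF R(1)] unfolding path_image_truncated by auto
    have ne: "cmod (z - of_real t) \<ge> R * cos \<theta> - t" if "z \<in> path_image ?seg" for z
      using abs_Re_le_cmod[of "z - of_real t"] end_segment_Re[of z R] that by simp
    have "continuous_on (path_image ?seg) ?g"
    proof (intro continuous_intros continuous_on_subset[OF cont])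
      show "path_image ?seg \<subseteq> U" using segU by simp
      show "\<forall>x\<in>path_image ?seg. (x - of_real t)\<^sup>2 \<noteq> 0"
        using ne R(2) by force
    qed
    then have seg: "(?g has_contour_integral E R) ?seg"
      unfolding E_def by (intro has_contour_integral_integral contour_integrable_continuous_linepath) simp
    have "(?g has_contour_integral (- (LINT r:{\<delta>..R}|lborel. ?g (of_real r * cis \<theta>) * cis \<theta>)))
        (linepath (of_real R * cis \<theta>) (of_real \<delta> * cis \<theta>))"
      using has_contour_integral_reversepath[OF _ ray_int[of \<theta> R]] R(1) by simp
    from has_contour_integral_truncatedI[OF this arc_int ray_int[of "- \<theta>" R] seg]
    have "(?g has_contour_integral (- (LINT r:{\<delta>..R}|lborel. ?g (of_real r * cis \<theta>) * cis \<theta>) + (contour_integral inner_arc ?g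
     + ((LINT r:{\<delta>..R}|lborel. ?g (of_real r * cis (- \<theta>)) * cis (- \<theta>)) + E R)))) (truncated R)"
      using R(1) by blast
    from has_contour_integral_unique[OF this Cauchy_truncated[OF U der sub[OF R(1)] tU t R]]
    show "- (LINT r:{\<delta>..R}|lborel. ?g (of_real r * cis \<theta>) * cis \<theta>) + contour_integral inner_arc ?g
     + (LINT r:{\<delta>..R}|lborel. ?g (of_real r * cis (- \<theta>)) * cis (- \<theta>)) = 2 * pi * \<i> * h (of_real t) - E R"
      by (simp add: algebra_simps)
    have C0: "C \<ge> 0" using bnd[OF tU] norm_ge_zero order_trans by blast
    have R0: "R \<ge> 0" using R(1) \<delta> by simp
    have "cmod (E R) \<le> C / (R * cos \<theta> - t)\<^sup>2 * cmod (of_real R * cis \<theta> - of_real R * cis (- \<theta>))"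
    proof (rule has_contour_integral_bound_linepath[OF seg])
      fix z assume z: "z \<in> closed_segment (of_real R * cis (- \<theta>)) (of_real R * cis \<theta>)"
      have "cmod (\<Xi> z) / (cmod (z - of_real t))\<^sup>2 \<le> C / (R * cos \<theta> - t)\<^sup>2"
        using bnd[of z] ne[of z] z segU R(2) C0 by (intro frac_le power_mono) auto
      then show "cmod (?g z) \<le> C / (R * cos \<theta> - t)\<^sup>2" by (simp add: norm_divide norm_power)
    qed (use C0 in simp)
    also have "\<dots> \<le> C / (R * cos \<theta> - t)\<^sup>2 * (2 * R)"
    proof (rule mult_left_mono)
      have "cmod (of_real R * cis \<theta> - of_real R * cis (- \<theta>)) \<le> cmod (of_real R * cis \<theta>) + cmod (of_real R * cis (- \<theta>))"
        by (rule norm_triangle_ineq4)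
      then show "cmod (of_real R * cis \<theta> - of_real R * cis (- \<theta>)) \<le> 2 * R"
        using R0 by (simp add: norm_mult)
    qed (use C0 in simp)
    finally show "cmod (E R) \<le> C / (R * cos \<theta> - t)\<^sup>2 * (2 * R)" .
  qed
  have ev: "\<forall>\<^sub>F R in at_top. R > \<delta> \<and> R * cos \<theta> > t"
  proof (rule eventually_mono[OF eventually_gt_at_top[of "max \<delta> (t / cos \<theta>)"]])
    fix R assume "R > max \<delta> (t / cos \<theta>)"
    then show "R > \<delta> \<and> R * cos \<theta> > t" using sin_cos_pos by (simp add: field_simps)
  qed
  have "(E \<longlongrightarrow> 0) at_top"
  proof (rule Lim_null_comparison)
    show "\<forall>\<^sub>F R in at_top. cmod (E R) \<le> C / (R * cos \<theta> - t)\<^sup>2 * (2 * R)"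
      by (rule eventually_mono[OF ev]) (use E in blast)
    show "((\<lambda>R. C / (R * cos \<theta> - t)\<^sup>2 * (2 * R)) \<longlongrightarrow> 0) at_top"
      using sin_cos_pos(2) by real_asymp
  qed
  then have "((\<lambda>R. 2 * pi * \<i> * h (of_real t) - E R) \<longlongrightarrow> 2 * pi * \<i> * h (of_real t) - 0) at_top"
    by (intro tendsto_intros)
  moreover have "((\<lambda>R. - (LINT r:{\<delta>..R}|lborel. ?g (of_real r * cis \<theta>) * cis \<theta>) + contour_integral inner_arc ?g
     + (LINT r:{\<delta>..R}|lborel. ?g (of_real r * cis (- \<theta>)) * cis (- \<theta>))) \<longlongrightarrow> Gamma_integral \<theta> \<delta> ?g) at_top"
    unfolding Gamma_integral_def
    by (intro tendsto_intros tendsto_set_lebesgue_integral_at_top int) auto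
  then have "((\<lambda>R. 2 * pi * \<i> * h (of_real t) - E R) \<longlongrightarrow> Gamma_integral \<theta> \<delta> ?g) at_top"
    by (rule Lim_transform_eventually) (rule eventually_mono[OF ev], use eq in blast)
  ultimately show ?thesis
    using tendsto_unique[OF trivial_limit_at_top_linorder] by force
qed

end

section \<open>A convex neighbourhood of the closed domain, and the primitive on it\<close>

text \<open>For \<open>c = 1 / (2 * K)\<close> these are the discs on which the Neumann series are
  known to converge.\<close>

definition sector_nbhd :: "real \<Rightarrow> complex set" where
  "sector_nbhd c = (\<Union>t\<in>{0..}. ball (of_real t) (c * (1 + t)))"

lemma sector_nbhd_iff: "z \<in> sector_nbhd c \<longleftrightarrow> (\<exists>t\<ge>0. cmod (of_real t - z) < c * (1 + t))"
  by (auto simp: sector_nbhd_def dist_norm)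

lemma open_sector_nbhd: "open (sector_nbhd c)"
  by (auto simp: sector_nbhd_def)

text \<open>The radius \<open>c * (1 + t)\<close> is an affine function of the centre, so a convex
  combination of points is close enough to the same combination of their centres.\<close>

lemma convex_sector_nbhd: "convex (sector_nbhd c)"
proof (rule convexI)
  fix x y :: complex and u v :: real
  assume xy: "x \<in> sector_nbhd c" "y \<in> sector_nbhd c" and uv: "0 \<le> u" "0 \<le> v" "u + v = 1"
  obtain s where s: "s \<ge> 0" "cmod (of_real s - x) < c * (1 + s)" using xy(1) by (auto simp: sector_nbhd_iff)
  obtain t where t: "t \<ge> 0" "cmod (of_real t - y) < c * (1 + t)" using xy(2) by (auto simp: sector_nbhd_iff)
  have "of_real (u * s + v * t) - (u *\<^sub>R x + v *\<^sub>R y) = u *\<^sub>R (of_real s - x) + v *\<^sub>R (of_real t - y)"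
    by (simp add: scaleR_conv_of_real algebra_simps)
  then have "cmod (of_real (u * s + v * t) - (u *\<^sub>R x + v *\<^sub>R y)) \<le> u * cmod (of_real s - x) + v * cmod (of_real t - y)"
    using norm_triangle_ineq[of "u *\<^sub>R (of_real s - x)" "v *\<^sub>R (of_real t - y)"] uv by simp
  also have "\<dots> < u * (c * (1 + s)) + v * (c * (1 + t))"
  proof (cases "u = 0")
    case True
    then show ?thesis using uv t by simp
  next
    case False
    then have "u * cmod (of_real s - x) < u * (c * (1 + s))" using uv s by simp
    moreover have "v * cmod (of_real t - y) \<le> v * (c * (1 + t))" using uv t by (intro mult_left_mono) auto
    ultimately show ?thesis by linarith
  qed
  also have "\<dots> = c * ((u + v) + (u * s + v * t))" by (simp add: algebra_simps)
  finally have "cmod (of_real (u * s + v * t) - (u *\<^sub>R x + v *\<^sub>R y)) < c * (1 + (u * s + v * t))"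
    using uv(3) by simp
  then show "u *\<^sub>R x + v *\<^sub>R y \<in> sector_nbhd c"
    unfolding sector_nbhd_iff using s t uv by (intro exI[of _ "u * s + v * t"]) auto
qed

text \<open>The chord from 1 to \<open>cis s\<close> is no longer than the arc, hence the point of
  the ray at radius \<open>r\<close> is at distance at most \<open>c * r\<close> from the real point
  \<open>r\<close>.\<close>

lemma ray_in_sector_nbhd:
  assumes "0 < c" "\<bar>s\<bar> \<le> c" "0 \<le> r"
  shows "of_real r * cis s \<in> sector_nbhd c"
proof -
  have "cmod (of_real r - of_real r * cis s) = r * cmod (1 - cis s)"
  proof -
    have "of_real r - of_real r * cis s = of_real r * (1 - cis s)" by (simp add: algebra_simps)
    then show ?thesis using assms by (simp add: norm_mult)
  qed
  also have "cmod (1 - cis s) \<le> \<bar>s\<bar>"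
  proof (rule power2_le_imp_le)
    have "(cmod (1 - cis s))\<^sup>2 = (1 - cos s)\<^sup>2 + (sin s)\<^sup>2" by (simp add: cmod_power2)
    also have "\<dots> = 2 - 2 * cos s"
      using sin_cos_squared_add[of s] by (simp add: power2_eq_square algebra_simps)
    also have "\<dots> = 4 * (sin (s / 2))\<^sup>2" using cos_double_sin[of "s / 2"] by simp
    also have "\<dots> \<le> 4 * (s / 2)\<^sup>2"
      using abs_le_square_iff[THEN iffD1, OF abs_sin_x_le_abs_x[of "s / 2"]]
      by (intro mult_left_mono) auto
    finally show "(cmod (1 - cis s))\<^sup>2 \<le> \<bar>s\<bar>\<^sup>2" by (simp add: power2_eq_square)
  qed simp
  then have "r * cmod (1 - cis s) \<le> r * c" using assms by (intro mult_left_mono) auto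
  also have "\<dots> < c * (1 + r)" using assms by (simp add: algebra_simps)
  finally show ?thesis unfolding sector_nbhd_iff using assms by (intro exI[of _ r]) auto
qed

lemma cball_subset_sector_nbhd: "\<delta> < c \<Longrightarrow> cball 0 \<delta> \<subseteq> sector_nbhd c"
  by (force simp: sector_nbhd_iff)

lemma of_real_in_sector_nbhd: "0 < c \<Longrightarrow> t \<ge> 0 \<Longrightarrow> of_real t \<in> sector_nbhd c"
  unfolding sector_nbhd_iff by (intro exI[of _ t]) auto

text \<open>The bound \<open>C / (1 + t)^2\<close> is the derivative of
  \<open>- C / (1 + t)\<close>, so any primitive of \<open>h\<close> has a limit along the positive
  axis, and its distance from the limit is at most \<open>C / (1 + t)\<close>. After the limit is
  subtracted, each disc carries this decay from its centre to its other points.\<close>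

lemma primitive_vanishing_at_infinity:
  assumes c: "0 < c" and hol: "h holomorphic_on sector_nbhd c"
    and bnd: "\<And>z t. t \<ge> 0 \<Longrightarrow> cmod (of_real t - z) < c * (1 + t) \<Longrightarrow> cmod (h z) \<le> C / (1 + t)\<^sup>2"
  obtains \<Xi> C' where "\<And>z. z \<in> sector_nbhd c \<Longrightarrow> (\<Xi> has_field_derivative h z) (at z)"
    "\<And>z. z \<in> sector_nbhd c \<Longrightarrow> cmod (\<Xi> z) \<le> C' / (1 + cmod z)"
    "\<And>l. l \<ge> 0 \<Longrightarrow> set_integrable lborel {l..} (\<lambda>t. h (of_real t))"
    "\<And>l. l \<ge> 0 \<Longrightarrow> \<Xi> (of_real l) = - (LINT t:{l..}|lborel. h (of_real t))"
proof -
  have "cmod (h 0) \<le> C" using bnd[of 0 0] c by simp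
  then have C: "C \<ge> 0" using norm_ge_zero order_trans by blast
  have hr: "cmod (h (of_real t)) \<le> C / (1 + t)\<^sup>2" if "t \<ge> 0" for t
    using bnd[OF that, of "of_real t"] c that by simp
  obtain P where P0: "\<And>z. z \<in> sector_nbhd c \<Longrightarrow> (P has_field_derivative h z) (at z within sector_nbhd c)"
    using holomorphic_convex_primitive'[OF convex_sector_nbhd open_sector_nbhd hol] by blast
  have P: "(P has_field_derivative h z) (at z)" if "z \<in> sector_nbhd c" for z
    using P0[OF that] at_within_open[OF that open_sector_nbhd] by simp
  have vec: "((\<lambda>t. P (of_real t)) has_vector_derivative h (of_real t)) (at t within S)" if "t \<ge> 0" for t S
  proof -
    have "(of_real has_vector_derivative 1) (at t within S)"
      by (auto intro!: derivative_eq_intros)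
    from field_vector_diff_chain_within[OF this has_field_derivative_at_within[OF P[OF of_real_in_sector_nbhd[OF c that]]]]
    show ?thesis by (simp add: o_def)
  qed
  have P_diff: "cmod (P (of_real b) - P (of_real a)) \<le> C / (1 + a)" if ab: "0 \<le> a" "a \<le> b" for a b
  proof (cases "a = b")
    case True
    then show ?thesis using C ab by simp
  next
    case False
    have "cmod (P (of_real b) - P (of_real a)) \<le> (- C / (1 + b)) - (- C / (1 + a))"
    proof (rule differentiable_bound_general)
      show "continuous_on {a..b} (\<lambda>t. P (of_real t))"
        by (rule continuous_on_vector_derivative[where f' = "\<lambda>t. h (of_real t)"], rule vec)
           (use ab in auto)
      show "continuous_on {a..b} (\<lambda>t. - C / (1 + t))" using ab by (auto intro!: continuous_intros)
      fix t assume t: "a < t" "t < b"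
      show "((\<lambda>t. P (of_real t)) has_vector_derivative h (of_real t)) (at t)" using vec t ab by simp
      show "((\<lambda>t. - C / (1 + t)) has_vector_derivative C / (1 + t)\<^sup>2) (at t)"
        using t ab unfolding has_real_derivative_iff_has_vector_derivative[symmetric]
        by (auto intro!: derivative_eq_intros simp: power2_eq_square)
      show "cmod (h (of_real t)) \<le> C / (1 + t)\<^sup>2" using t ab by (intro hr) auto
    qed (use ab False in auto)
    also have "\<dots> \<le> C / (1 + a)" using C ab by simp
    finally show ?thesis .
  qed
  have "Cauchy (\<lambda>n. P (of_real (real n)))"
  proof (rule CauchyI)
    fix e :: real assume e: "e > 0"
    obtain N where N: "real N > 2 * C / e" using reals_Archimedean2 by blast
    have "norm (P (of_real (real m)) - P (of_real (real n))) < e" if "m \<ge> N" "n \<ge> N" for m n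
    proof -
      have 1: "cmod (P (of_real (real k)) - P (of_real (real N))) \<le> C / (1 + real N)" if "k \<ge> N" for k
        using P_diff[of "real N" "real k"] that by simp
      have "cmod (P (of_real (real m)) - P (of_real (real n))) \<le> C / (1 + real N) + C / (1 + real N)"
        using norm_triangle_ineq4[of "P (of_real (real m)) - P (of_real (real N))" "P (of_real (real n)) - P (of_real (real N))"]
          1[OF that(1)] 1[OF that(2)] by simp
      also have "\<dots> = 2 * C / (1 + real N)" by simp
      also have "\<dots> < e" using N e C by (simp add: field_simps)
      finally show ?thesis .
    qed
    then show "\<exists>M. \<forall>m\<ge>M. \<forall>n\<ge>M. norm (P (of_real (real m)) - P (of_real (real n))) < e" by blast
  qed
  then obtain L where L: "(\<lambda>n. P (of_real (real n))) \<longlonglongrightarrow> L" by (meson Cauchy_convergent convergentD)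
  have PL: "cmod (P (of_real a) - L) \<le> C / (1 + a)" if a: "0 \<le> a" for a
  proof (rule LIMSEQ_le_const2)
    show "(\<lambda>n. cmod (P (of_real a) - P (of_real (real n)))) \<longlonglongrightarrow> cmod (P (of_real a) - L)"
      by (intro tendsto_intros L)
    show "\<exists>N. \<forall>n\<ge>N. cmod (P (of_real a) - P (of_real (real n))) \<le> C / (1 + a)"
    proof (intro exI allI impI)
      fix n assume "n \<ge> nat \<lceil>a\<rceil>"
      then have "a \<le> real n" by linarith
      from P_diff[OF a this] show "cmod (P (of_real a) - P (of_real (real n))) \<le> C / (1 + a)"
        by (simp add: norm_minus_commute)
    qed
  qed
  define \<Xi> where "\<Xi> z = P z - L" for z
  show ?thesis
  proof
    show "(\<Xi> has_field_derivative h z) (at z)" if "z \<in> sector_nbhd c" for z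
      unfolding \<Xi>_def using P[OF that] by (auto intro!: derivative_eq_intros)
    \<comment> \<open>One factor \<open>1 + c\<close> comes from moving from the axis to
      \<open>z\<close> inside a disc of radius \<open>c * (1 + t)\<close>, the other from
      \<open>1 + cmod z \<le> (1 + c) * (1 + t)\<close>.\<close>
    show "cmod (\<Xi> z) \<le> (1 + c)\<^sup>2 * C / (1 + cmod z)" if z: "z \<in> sector_nbhd c" for z
    proof -
      obtain t where t: "t \<ge> 0" "cmod (of_real t - z) < c * (1 + t)" using z by (auto simp: sector_nbhd_iff)
      let ?B = "ball (of_real t :: complex) (c * (1 + t))"
      have sub: "?B \<subseteq> sector_nbhd c" using t(1) by (auto simp: sector_nbhd_def)
      have "cmod (P z - P (of_real t)) \<le> C / (1 + t)\<^sup>2 * cmod (z - of_real t)"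
      proof (rule field_differentiable_bound[where S = ?B and f' = h])
        fix w assume w: "w \<in> ?B"
        show "(P has_field_derivative h w) (at w within ?B)"
          using w sub by (intro has_field_derivative_at_within[OF P]) auto
        show "cmod (h w) \<le> C / (1 + t)\<^sup>2" using w by (intro bnd[OF t(1)]) (simp add: dist_norm)
      qed (use t c in \<open>auto simp: dist_norm\<close>)
      also have "\<dots> \<le> C / (1 + t)\<^sup>2 * (c * (1 + t))"
        using t C by (intro mult_left_mono) (auto simp: norm_minus_commute)
      also have "\<dots> = c * C / (1 + t)" using t by (simp add: power2_eq_square)
      finally have "cmod (\<Xi> z) \<le> c * C / (1 + t) + C / (1 + t)"
        using PL[OF t(1)] norm_triangle_ineq[of "P z - P (of_real t)" "P (of_real t) - L"]
        by (simp add: \<Xi>_def)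
      also have "\<dots> = (1 + c) * C / (1 + t)" by (simp add: add_divide_distrib distrib_right)
      also have "\<dots> \<le> (1 + c)\<^sup>2 * C / (1 + cmod z)"
      proof -
        have "cmod z \<le> t + c * (1 + t)"
          using norm_triangle_ineq2[of z "of_real t"] t by (simp add: norm_minus_commute)
        then have le: "1 + cmod z \<le> (1 + c) * (1 + t)" by (simp add: algebra_simps)
        have z0: "0 < 1 + cmod z" by (simp add: add_pos_nonneg)
        have "(1 + c) * C * (1 + cmod z) \<le> (1 + c) * C * ((1 + c) * (1 + t))"
          using le C c by (intro mult_left_mono) auto
        then show ?thesis using z0 t(1) by (simp add: divide_simps power2_eq_square mult_ac)
      qed
      finally show ?thesis .
    qed
    have conth: "continuous_on {l..} (\<lambda>t. h (of_real t))" if "l \<ge> 0" for l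
      using that c
      by (intro continuous_on_compose2[OF holomorphic_on_imp_continuous_on[OF hol]] continuous_intros)
         (auto intro!: of_real_in_sector_nbhd)
    show int: "set_integrable lborel {l..} (\<lambda>t. h (of_real t))" if "l \<ge> 0" for l
      by (rule set_integrable_continuous_bound[OF _ conth[OF that], where C = C and c = 1])
         (use that hr in \<open>auto simp: add.commute\<close>)
    show "\<Xi> (of_real l) = - (LINT t:{l..}|lborel. h (of_real t))" if l: "l \<ge> 0" for l
    proof -
      have "((\<lambda>b. P (of_real b) - L) \<longlongrightarrow> 0) at_top"
      proof (rule Lim_null_comparison)
        show "\<forall>\<^sub>F b in at_top. cmod (P (of_real b) - L) \<le> C / (1 + b)"
          by (rule eventually_mono[OF eventually_ge_at_top[of 0]]) (rule PL)
        show "((\<lambda>b. C / (1 + b)) \<longlongrightarrow> 0) at_top" by real_asymp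
      qed
      then have "((\<lambda>b. P (of_real b)) \<longlongrightarrow> L) at_top" by (rule LIM_zero_cancel)
      then have "(LINT t:{l..}|lborel. h (of_real t)) = L - P (of_real l)"
        by (rule set_integral_FTC_atLeast[OF int[OF l], rotated]) (use l in \<open>auto intro: vec\<close>)
      then show ?thesis by (simp add: \<Xi>_def)
    qed
  qed
qed

section \<open>Integrals against the representing measure\<close>

lemma space_OM: "OM_measure \<mu> \<Longrightarrow> space \<mu> = {0<..}"
  using sets_eq_imp_space_eq[of \<mu> "restrict_space borel {0<..}"]
  by (simp add: OM_measure_def space_restrict_space)

lemma measurable_OM:
  assumes "OM_measure \<mu>" "f \<in> measurable (restrict_space borel {0<..}) N"
  shows "f \<in> measurable \<mu> N"
  using assms measurable_cong_sets[of \<mu> "restrict_space borel {0<..}" N N] by (auto simp: OM_measure_def)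

lemma ident_measurable_OM: "OM_measure \<mu> \<Longrightarrow> (\<lambda>t. t) \<in> borel_measurable \<mu>"
  by (rule measurable_OM) (auto intro: measurable_restrict_space1)

lemma borel_measurable_OM:
  "OM_measure \<mu> \<Longrightarrow> f \<in> borel_measurable borel \<Longrightarrow> f \<in> borel_measurable \<mu>"
  by (rule measurable_OM) (auto intro: measurable_restrict_space1)

lemma integrable_OM:
  fixes f :: "real \<Rightarrow> 'b::{banach, second_countable_topology}"
  assumes \<mu>: "OM_measure \<mu>" and f: "f \<in> borel_measurable \<mu>" "\<And>t. t > 0 \<Longrightarrow> norm (f t) \<le> C / (1 + t)"
  shows "integrable \<mu> f"
proof -
  have "integrable \<mu> (\<lambda>t. 1 / (1 + t))"
  proof (rule integrableI_bounded)
    have "(\<integral>\<^sup>+ t. ennreal (norm (1 / (1 + t))) \<partial>\<mu>) = (\<integral>\<^sup>+ t. ennreal (1 / (1 + t)) \<partial>\<mu>)"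
      by (intro nn_integral_cong) (auto simp: space_OM[OF \<mu>])
    then show "(\<integral>\<^sup>+ t. ennreal (norm (1 / (1 + t))) \<partial>\<mu>) < \<infinity>" using \<mu> by (simp add: OM_measure_def)
  qed (intro borel_measurable_OM[OF \<mu>], simp)
  then have "integrable \<mu> (\<lambda>t. C * (1 / (1 + t)))" by (rule integrable_mult_right)
  then show ?thesis
  proof (rule Bochner_Integration.integrable_bound[OF _ f(1)])
    show "AE t in \<mu>. norm (f t) \<le> norm (C * (1 / (1 + t)))"
    proof (rule AE_I2)
      fix t assume "t \<in> space \<mu>"
      then have t: "t > 0" by (simp add: space_OM[OF \<mu>])
      have "C / (1 + t) \<le> \<bar>C\<bar> / (1 + t)" using t by (intro divide_right_mono) auto
      then show "norm (f t) \<le> norm (C * (1 / (1 + t)))" using f(2)[OF t] t by simp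
    qed
  qed
qed

text \<open>On \<open>{0<..real n}\<close> the weight \<open>1 / (1 + t)\<close> is bounded away
  from 0, so the measure is finite there. Fubini's theorem on the contour relies on this.\<close>

lemma sigma_finite_OM:
  assumes \<mu>: "OM_measure \<mu>"
  shows "sigma_finite_measure \<mu>"
proof
  let ?A = "\<lambda>n::nat. {0<..real n}"
  have meas: "?A n \<in> sets \<mu>" for n
  proof -
    have "?A n = {0<..} \<inter> {..real n}" by auto
    then have "?A n \<in> sets (restrict_space borel {0<..})" 
      unfolding sets_restrict_space by (intro image_eqI[of _ _ "{..real n}"]) auto
    then show ?thesis using \<mu> by (simp add: OM_measure_def)
  qed
  have fin: "emeasure \<mu> (?A n) \<noteq> \<infinity>" for n
  proof -
    have "integrable \<mu> (indicator (?A n) :: real \<Rightarrow> real)"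
      by (rule integrable_OM[OF \<mu>, where C = "1 + real n"]) (use meas in \<open>auto simp: indicator_def\<close>)
    then show ?thesis using meas by (simp add: integrable_indicator_iff less_top)
  qed
  show "\<exists>A. countable A \<and> A \<subseteq> sets \<mu> \<and> \<Union>A = space \<mu> \<and> (\<forall>a\<in>A. emeasure \<mu> a \<noteq> \<infinity>)"
  proof (intro exI conjI ballI)
    show "\<Union>(range ?A) = space \<mu>"
    proof -
      have "\<exists>n. x \<in> ?A n" if "x > 0" for x
        using real_arch_simple[of x] that by auto
      then show ?thesis unfolding space_OM[OF \<mu>] by fastforce
    qed
  qed (use meas fin in auto)
qed

text \<open>The sector estimate is applied with the half of the argument of \<open>z\<close> itself,
  and \<open>t + cmod z\<close> is compared with \<open>1 + t\<close> at the price of the factor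
  \<open>min 1 (cmod z)\<close>.\<close>

lemma distance_from_positive_axis:
  assumes "z \<notin> complex_of_real ` {0..}"
  obtains \<kappa> where "\<kappa> > 0" "\<And>t. t \<ge> 0 \<Longrightarrow> \<kappa> * (1 + t) \<le> cmod (of_real t - z)"
proof -
  have z0: "z \<noteq> 0" using assms by (metis atLeast_iff imageI of_real_0 order_refl)
  have zeq: "z = of_real (cmod z) * cis (Arg z)"
    using z0 rcis_cmod_Arg[of z] by (simp add: rcis_def)
  have A0: "Arg z \<noteq> 0"
  proof
    assume "Arg z = 0"
    then have "z = of_real (cmod z)" using zeq by simp
    then show False using assms by (metis atLeast_iff imageI norm_ge_zero)
  qed
  have A: "0 < \<bar>Arg z\<bar> / 2" "\<bar>Arg z\<bar> / 2 < pi" using A0 mpi_less_Arg[of z] Arg_le_pi[of z] by auto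
  define s where "s = sin (\<bar>Arg z\<bar> / 2)"
  have s: "s > 0" unfolding s_def using A by (intro sin_gt_zero)
  define \<kappa> where "\<kappa> = s * min 1 (cmod z)"
  have "\<kappa> * (1 + t) \<le> cmod (of_real t - z)" if t: "t \<ge> 0" for t
  proof -
    have "min 1 (cmod z) * (1 + t) \<le> t + cmod z"
    proof -
      have "min 1 (cmod z) * t \<le> 1 * t" using t by (intro mult_right_mono) auto
      then show ?thesis by (simp add: distrib_left)
    qed
    then have "\<kappa> * (1 + t) \<le> s * (t + cmod z)" unfolding \<kappa>_def mult.assoc using s by (intro mult_left_mono) auto
    also have "\<dots> \<le> cmod (of_real t - of_real (cmod z) * cis (Arg z))"
      unfolding s_def by (rule norm_diff_off_sector) (use t A in \<open>auto simp: abs_if\<close>)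
    finally show ?thesis using zeq by simp
  qed
  moreover have "\<kappa> > 0" unfolding \<kappa>_def using s z0 by simp
  ultimately show ?thesis using that by blast
qed

text \<open>Differentiation under the integral by an explicit remainder: the difference quotient of
  \<open>z / (t - z)\<close> deviates from \<open>t / (t - z)^2\<close> by
  \<open>t k / ((t - z)^2 (t - z - k))\<close>. Increments below \<open>\<kappa> / 2\<close> cost at
  most half of the distance to the axis.\<close>

lemma OM_has_derivative:
  assumes rep: "represents \<mu> \<phi>" and z: "z \<notin> complex_of_real ` {0..}"
  shows "(\<phi> has_field_derivative (\<integral>t. of_real t / (of_real t - z)\<^sup>2 \<partial>\<mu>)) (at z)"
proof -
  have \<mu>: "OM_measure \<mu>" and \<phi>: "\<And>z. z \<notin> complex_of_real ` {0<..} \<Longrightarrow> \<phi> z = (\<integral>t. z / (of_real t - z) \<partial>\<mu>)"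
    using rep by (auto simp: represents_def)
  obtain \<kappa> where \<kappa>: "\<kappa> > 0" "\<And>t. t \<ge> 0 \<Longrightarrow> \<kappa> * (1 + t) \<le> cmod (of_real t - z)"
    using distance_from_positive_axis[OF z] by blast
  let ?I = "\<lambda>t. of_real t / (of_real t - z)\<^sup>2"
  have low: "\<kappa> / 2 * (1 + t) \<le> cmod (of_real t - (z + k))" if "cmod k < \<kappa> / 2" "t \<ge> 0" for k t
  proof -
    have "\<kappa> / 2 * 1 \<le> \<kappa> / 2 * (1 + t)" using \<kappa>(1) that by (intro mult_left_mono) auto
    then show ?thesis
      using \<kappa>(2)[OF that(2)] norm_triangle_ineq2[of "of_real t - z" k] that(1) by (simp add: algebra_simps)
  qed
  have intI: "integrable \<mu> ?I"
  proof (rule integrable_OM[OF \<mu>, where C = "1 / \<kappa>\<^sup>2"])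
    fix t :: real assume t: "t > 0"
    have "norm (?I t) = t / (cmod (of_real t - z))\<^sup>2" using t by (simp add: norm_divide norm_power)
    also have "\<dots> \<le> (1 + t) / (\<kappa> * (1 + t))\<^sup>2"
      using t \<kappa> by (intro frac_le power_mono) auto
    also have "\<dots> = 1 / \<kappa>\<^sup>2 / (1 + t)" using t \<kappa>(1) by (simp add: power2_eq_square)
    finally show "norm (?I t) \<le> 1 / \<kappa>\<^sup>2 / (1 + t)" .
  qed (intro borel_measurable_OM[OF \<mu>], measurable)
  have int\<phi>: "integrable \<mu> (\<lambda>t. (z + k) / (of_real t - (z + k)))" if k: "cmod k < \<kappa> / 2" for k
  proof (rule integrable_OM[OF \<mu>, where C = "cmod (z + k) / (\<kappa> / 2)"])
    fix t :: real assume t: "t > 0"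
    have "norm ((z + k) / (of_real t - (z + k))) \<le> cmod (z + k) / (\<kappa> / 2 * (1 + t))"
      unfolding norm_divide using t \<kappa>(1) low[OF k, of t] by (intro frac_le) auto
    then show "norm ((z + k) / (of_real t - (z + k))) \<le> cmod (z + k) / (\<kappa> / 2) / (1 + t)" by simp
  qed (intro borel_measurable_OM[OF \<mu>], measurable)
  have off: "z + k \<notin> complex_of_real ` {0<..}" if k: "cmod k < \<kappa> / 2" for k
  proof
    assume "z + k \<in> complex_of_real ` {0<..}"
    then obtain t where t: "t > 0" "z + k = of_real t" by auto
    have "0 < \<kappa> / 2 * (1 + t)" using t \<kappa>(1) by simp
    then show False using low[OF k, of t] t by simp
  qed
  \<comment> \<open>The denominator of the remainder contains two factors of size at least
    \<open>\<kappa> * (1 + t)\<close> and one of size at least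
    \<open>\<kappa> / 2 * (1 + t)\<close>; the numerator cancels two of the three powers of
    \<open>1 + t\<close>.\<close>
  let ?M = "2 / \<kappa>^3 * (\<integral>t. 1 / (1 + t) \<partial>\<mu>)"
  have int1: "integrable \<mu> (\<lambda>t. 1 / (1 + t))"
    by (rule integrable_OM[OF \<mu>, where C = 1]) (auto intro!: borel_measurable_OM[OF \<mu>])
  have quot: "cmod ((\<phi> (z + k) - \<phi> z) / k - (\<integral>t. ?I t \<partial>\<mu>)) \<le> cmod k * ?M"
    if k: "k \<noteq> 0" "cmod k < \<kappa> / 2" for k
  proof -
    let ?q = "\<lambda>t. ((z + k) / (of_real t - (z + k)) - z / (of_real t - z)) / k - ?I t"
    have int0: "integrable \<mu> (\<lambda>t. z / (of_real t - z))" using int\<phi>[of 0] \<kappa>(1) by simp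
    have "\<phi> (z + k) = (\<integral>t. (z + k) / (of_real t - (z + k)) \<partial>\<mu>)" "\<phi> z = (\<integral>t. z / (of_real t - z) \<partial>\<mu>)"
      using off[OF k(2)] off[of 0] \<kappa>(1) \<phi> by auto
    then have eq: "(\<phi> (z + k) - \<phi> z) / k - (\<integral>t. ?I t \<partial>\<mu>) = (\<integral>t. ?q t \<partial>\<mu>)"
      using int\<phi>[OF k(2)] int0 intI by simp
    have "cmod (\<integral>t. ?q t \<partial>\<mu>) \<le> (\<integral>t. cmod k * (2 / \<kappa>^3) * (1 / (1 + t)) \<partial>\<mu>)"
    proof (rule order_trans[OF integral_norm_bound integral_mono])
      show "integrable \<mu> (\<lambda>t. cmod (?q t))" using int\<phi>[OF k(2)] int0 intI by auto
      show "integrable \<mu> (\<lambda>t. cmod k * (2 / \<kappa>^3) * (1 / (1 + t)))" using int1 by (intro integrable_mult_right)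
      fix t assume "t \<in> space \<mu>"
      then have t: "t > 0" by (simp add: space_OM[OF \<mu>])
      let ?a = "of_real t - z" and ?b = "of_real t - (z + k)"
      have lb: "\<kappa> * (1 + t) \<le> cmod ?a" "\<kappa> / 2 * (1 + t) \<le> cmod ?b" "0 < \<kappa> * (1 + t)" "0 < \<kappa> / 2 * (1 + t)"
        using \<kappa> t low[OF k(2)] by auto
      then have ne: "?a \<noteq> 0" "?b \<noteq> 0" by auto
      have "(z + k) / ?b - z / ?a = ((z + k) * ?a - z * ?b) / (?a * ?b)"
        using ne by (simp add: diff_frac_eq mult.commute)
      also have "(z + k) * ?a - z * ?b = k * of_real t" by (simp add: algebra_simps)
      finally have "((z + k) / ?b - z / ?a) / k = of_real t / (?a * ?b)" using k(1) by simp
      then have "?q t = of_real t / (?a * ?b) - of_real t / (?a * ?a)" by (simp add: power2_eq_square)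
      also have "\<dots> = of_real t * (?a - ?b) / (?a * ?a * ?b)" using ne by (simp add: divide_simps) (simp add: algebra_simps)
      also have "\<dots> = of_real t * k / (?a\<^sup>2 * ?b)" by (simp add: power2_eq_square)
      finally have "cmod (?q t) = t * cmod k / ((cmod ?a)\<^sup>2 * cmod ?b)"
        using t by (simp add: norm_mult norm_divide norm_power)
      also have "\<dots> \<le> (1 + t)\<^sup>2 * cmod k / ((\<kappa> * (1 + t))\<^sup>2 * (\<kappa> / 2 * (1 + t)))"
      proof (rule frac_le)
        have "t \<le> (1 + t)\<^sup>2" using t by (simp add: power2_eq_square algebra_simps)
        then show "t * cmod k \<le> (1 + t)\<^sup>2 * cmod k" by (rule mult_right_mono) simp
        show "(\<kappa> * (1 + t))\<^sup>2 * (\<kappa> / 2 * (1 + t)) \<le> (cmod ?a)\<^sup>2 * cmod ?b"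
          using lb by (intro mult_mono power_mono) auto
        show "0 < (\<kappa> * (1 + t))\<^sup>2 * (\<kappa> / 2 * (1 + t))"
          using \<kappa>(1) t by (intro mult_pos_pos zero_less_power) auto
      qed (use t in auto)
      also have "\<dots> = cmod k * (2 / \<kappa>^3) * (1 / (1 + t))"
        using t \<kappa>(1) by (simp add: power2_eq_square power3_eq_cube divide_simps)
      finally show "cmod (?q t) \<le> cmod k * (2 / \<kappa>^3) * (1 / (1 + t))" .
    qed
    then show ?thesis unfolding eq by (simp only: integral_mult_right_zero mult.assoc)
  qed
  show ?thesis unfolding DERIV_def
  proof (rule LIM_zero_cancel, rule Lim_null_comparison)
    show "\<forall>\<^sub>F k in at 0. cmod ((\<phi> (z + k) - \<phi> z) / k - (\<integral>t. ?I t \<partial>\<mu>)) \<le> cmod k * ?M"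
      using quot \<kappa>(1) unfolding eventually_at by (intro exI[of _ "\<kappa> / 2"]) auto
    have "((\<lambda>k::complex. cmod k * ?M) \<longlongrightarrow> cmod 0 * ?M) (at 0)" by (intro tendsto_intros)
    then show "((\<lambda>k. cmod k * ?M) \<longlongrightarrow> 0) (at 0)" by simp
  qed
qed

lemma OM_holomorphic:
  assumes "represents \<mu> \<phi>"
  shows "\<phi> holomorphic_on (- complex_of_real ` {0..})"
  using OM_has_derivative[OF assms]
  by (intro holomorphic_onI) (auto simp: field_differentiable_def intro: has_field_derivative_at_within)

lemma open_off_positive_axis: "open (- complex_of_real ` {0..})"
proof -
  have "complex_of_real ` {0..} = {z. Im z = 0} \<inter> {z. 0 \<le> Re z}"
    by (auto simp: image_iff complex_eq_iff intro!: bexI[of _ "Re _"])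
  then have "closed (complex_of_real ` {0..})"
    by (auto intro!: closed_Int closed_Collect_eq closed_Collect_le continuous_intros)
  then show ?thesis by auto
qed

lemma OM_deriv_eq:
  assumes "represents \<mu> \<phi>" "z \<notin> complex_of_real ` {0..}"
  shows "deriv \<phi> z = (\<integral>t. of_real t / (of_real t - z)\<^sup>2 \<partial>\<mu>)"
  by (rule DERIV_imp_deriv[OF OM_has_derivative[OF assms]])

text \<open>On the negative axis the integrand is real and of one sign, so nothing is lost in
  passing to the modulus. This turns the growth condition into a statement about the
  measure.\<close>

lemma cmod_OM_negative:
  assumes rep: "represents \<mu> \<phi>" and r: "0 < r"
  shows "ennreal (cmod (\<phi> (of_real (- r)))) = (\<integral>\<^sup>+t. ennreal (r / (t + r)) \<partial>\<mu>)"
    and "cmod (\<phi> (of_real (- r))) = (\<integral>t. r / (t + r) \<partial>\<mu>)"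
proof -
  have \<mu>: "OM_measure \<mu>" using rep by (simp add: represents_def)
  have "of_real (- r) \<notin> complex_of_real ` {0<..}" using r by (auto simp flip: of_real_minus)
  then have "\<phi> (of_real (- r)) = (\<integral>t. of_real (- r) / (of_real t - of_real (- r)) \<partial>\<mu>)"
    using rep unfolding represents_def by blast
  also have "\<dots> = (\<integral>t. of_real (- (r / (t + r))) \<partial>\<mu>)"
    by (intro Bochner_Integration.integral_cong) auto
  also have "\<dots> = of_real (- (\<integral>t. r / (t + r) \<partial>\<mu>))" by (simp only: integral_complex_of_real integral_minus)
  finally have eq: "\<phi> (of_real (- r)) = of_real (- (\<integral>t. r / (t + r) \<partial>\<mu>))" .
  have nn: "0 \<le> (\<integral>t. r / (t + r) \<partial>\<mu>)"
    using r by (intro integral_nonneg_AE AE_I2) (auto simp: space_OM[OF \<mu>])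
  then show c: "cmod (\<phi> (of_real (- r))) = (\<integral>t. r / (t + r) \<partial>\<mu>)"
    unfolding eq norm_of_real by simp
  have "integrable \<mu> (\<lambda>t. r / (t + r))"
  proof (rule integrable_OM[OF \<mu>, where C = "1 + r"])
    fix t :: real assume t: "t > 0"
    have "r * (1 + t) \<le> (1 + r) * (t + r)" using r t by (simp add: algebra_simps)
    then show "norm (r / (t + r)) \<le> (1 + r) / (1 + t)" using r t by (simp add: field_simps)
  qed (intro borel_measurable_OM[OF \<mu>], measurable)
  then show "ennreal (cmod (\<phi> (of_real (- r)))) = (\<integral>\<^sup>+t. ennreal (r / (t + r)) \<partial>\<mu>)"
    unfolding c using r by (intro nn_integral_eq_integral[symmetric] AE_I2) (auto simp: space_OM[OF \<mu>])
qed

text \<open>Covers rays and arc at once: \<open>p\<close> parametrises a piece of the contour,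
  \<open>G\<close> is the function on it times the derivative of \<open>p\<close>, and
  \<open>r\<close> is the modulus of \<open>p\<close>. The numerator \<open>t\<close> cancels one of
  the two powers of \<open>t + r s\<close>, so the kernel is at most
  \<open>1 / (\<kappa>^2 * (t + r s))\<close>.\<close>

lemma kernel_Fubini:
  fixes p G :: "real \<Rightarrow> complex"
  assumes \<mu>: "OM_measure \<mu>" and S: "S \<in> sets borel" and p: "continuous_on S p" and G: "continuous_on S G"
    and \<kappa>: "\<kappa> > 0" and low: "\<And>s t. s \<in> S \<Longrightarrow> t > 0 \<Longrightarrow> \<kappa> * (t + r s) \<le> cmod (of_real t - p s)"
    and r: "\<And>s. s \<in> S \<Longrightarrow> r s > 0" and w: "\<And>s. s \<in> S \<Longrightarrow> cmod (G s) \<le> w s"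
    and fin: "(\<integral>\<^sup>+s\<in>S. (\<integral>\<^sup>+t. ennreal (w s / (t + r s) / \<kappa>\<^sup>2) \<partial>\<mu>) \<partial>lborel) < \<infinity>"
  shows "set_integrable lborel S (\<lambda>s. G s * (\<integral>t. of_real t / (of_real t - p s)\<^sup>2 \<partial>\<mu>))"
    and "(LINT s:S|lborel. G s * (\<integral>t. of_real t / (of_real t - p s)\<^sup>2 \<partial>\<mu>)) =
      (\<integral>t. of_real t * (LINT s:S|lborel. G s / (p s - of_real t)\<^sup>2) \<partial>\<mu>)"
    and "integrable \<mu> (\<lambda>t. of_real t * (LINT s:S|lborel. G s / (p s - of_real t)\<^sup>2))"
proof -
  interpret sigma_finite_measure \<mu> by (rule sigma_finite_OM[OF \<mu>])
  interpret pair_sigma_finite lborel \<mu> ..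
  \<comment> \<open>Continuity is known on \<open>S\<close> only; cut off by the indicator,
    \<open>g\<close> and \<open>q\<close> are measurable on the whole line, and the integrand is
    unchanged since \<open>g\<close> vanishes outside \<open>S\<close>.\<close>
  define g where "g s = indicator S s *\<^sub>R G s" for s
  define q where "q s = indicator S s *\<^sub>R p s" for s
  have [measurable]: "g \<in> borel_measurable lborel" "q \<in> borel_measurable lborel"
    using set_measurable_continuous_on[OF S p] set_measurable_continuous_on[OF S G]
    by (simp_all add: set_borel_measurable_def g_def[abs_def] q_def[abs_def])
  have [measurable]: "(\<lambda>t. t) \<in> borel_measurable \<mu>" by (rule ident_measurable_OM[OF \<mu>])
  define F where "F s t = g s * (of_real t / (of_real t - q s)\<^sup>2)" for s t
  have F_eq: "F s t = indicator S s *\<^sub>R (G s * (of_real t / (of_real t - p s)\<^sup>2))" for s t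
    by (auto simp: F_def g_def q_def indicator_def)
  have Fm[measurable]: "case_prod F \<in> borel_measurable (lborel \<Otimes>\<^sub>M \<mu>)"
  proof -
    have [measurable]: "(\<lambda>x. snd x) \<in> borel_measurable (lborel \<Otimes>\<^sub>M \<mu>)"
      by (rule measurable_compose[OF measurable_snd ident_measurable_OM[OF \<mu>]])
    show ?thesis unfolding F_def[abs_def] case_prod_beta by measurable
  qed
  have bound: "norm (F s t) \<le> indicator S s * (w s / (t + r s) / \<kappa>\<^sup>2)" if t: "t > 0" for s t
  proof (cases "s \<in> S")
    case True
    have pos: "0 < \<kappa> * (t + r s)" using \<kappa> r[OF True] t by simp
    have w0: "0 \<le> w s" using w[OF True] norm_ge_zero order_trans by blast
    have "norm (F s t) = cmod (G s) * (t / (cmod (of_real t - p s))\<^sup>2)"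
      using True t by (simp add: F_eq norm_mult norm_divide norm_power)
    also have "\<dots> \<le> w s * ((t + r s) / (\<kappa> * (t + r s))\<^sup>2)"
      using w[OF True] low[OF True t] pos t r[OF True] w0
      by (intro mult_mono frac_le power_mono) auto
    also have "\<dots> = w s / (t + r s) / \<kappa>\<^sup>2"
      using pos t r[OF True] by (simp add: power2_eq_square)
    finally show ?thesis using True by simp
  qed (simp add: F_eq)
  have int: "integrable (lborel \<Otimes>\<^sub>M \<mu>) (case_prod F)"
  proof (rule integrableI_bounded[OF Fm])
    have "(\<integral>\<^sup>+x. ennreal (norm (case_prod F x)) \<partial>(lborel \<Otimes>\<^sub>M \<mu>))
      = (\<integral>\<^sup>+s. \<integral>\<^sup>+t. ennreal (norm (F s t)) \<partial>\<mu> \<partial>lborel)"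
      using sigma_finite_measure.nn_integral_fst[OF sigma_finite_OM[OF \<mu>], of "\<lambda>x. ennreal (norm (case_prod F x))" lborel] by simp
    also have "\<dots> \<le> (\<integral>\<^sup>+s\<in>S. (\<integral>\<^sup>+t. ennreal (w s / (t + r s) / \<kappa>\<^sup>2) \<partial>\<mu>) \<partial>lborel)"
    proof (rule nn_integral_mono)
      fix s
      show "(\<integral>\<^sup>+t. ennreal (norm (F s t)) \<partial>\<mu>) \<le> (\<integral>\<^sup>+t. ennreal (w s / (t + r s) / \<kappa>\<^sup>2) \<partial>\<mu>) * indicator S s"
      proof (cases "s \<in> S")
        case True
        have "(\<integral>\<^sup>+t. ennreal (norm (F s t)) \<partial>\<mu>) \<le> (\<integral>\<^sup>+t. ennreal (w s / (t + r s) / \<kappa>\<^sup>2) \<partial>\<mu>)"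
          using bound[of _ s] True
          by (intro nn_integral_mono ennreal_leI) (auto simp: space_OM[OF \<mu>])
        then show ?thesis using True by simp
      qed (simp add: F_eq)
    qed
    also note fin
    finally show "(\<integral>\<^sup>+x. ennreal (norm (case_prod F x)) \<partial>(lborel \<Otimes>\<^sub>M \<mu>)) < \<infinity>" .
  qed
  have 1: "(\<integral>t. F s t \<partial>\<mu>) = indicator S s *\<^sub>R (G s * (\<integral>t. of_real t / (of_real t - p s)\<^sup>2 \<partial>\<mu>))" for s
    by (cases "s \<in> S")
       (simp_all only: F_eq indicator_simps scaleR_one scaleR_zero_left integral_mult_right_zero
         Bochner_Integration.integral_zero simp_thms)
  have 2: "(\<integral>s. F s t \<partial>lborel) = of_real t * (LINT s:S|lborel. G s / (p s - of_real t)\<^sup>2)" for t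
  proof -
    have "F s t = of_real t * (indicator S s *\<^sub>R (G s / (p s - of_real t)\<^sup>2))" for s
      by (simp add: F_eq power2_commute indicator_def)
    then show ?thesis by (simp only: set_lebesgue_integral_def integral_mult_right_zero)
  qed
  from integrable_fst[OF int] show "set_integrable lborel S (\<lambda>s. G s * (\<integral>t. of_real t / (of_real t - p s)\<^sup>2 \<partial>\<mu>))"
    unfolding set_integrable_def 1 .
  from integrable_snd[OF int] show "integrable \<mu> (\<lambda>t. of_real t * (LINT s:S|lborel. G s / (p s - of_real t)\<^sup>2))"
    unfolding 2 .
  from Fubini_integral[OF int]
  show "(LINT s:S|lborel. G s * (\<integral>t. of_real t / (of_real t - p s)\<^sup>2 \<partial>\<mu>)) =
      (\<integral>t. of_real t * (LINT s:S|lborel. G s / (p s - of_real t)\<^sup>2) \<partial>\<mu>)"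
    unfolding 1 2 set_lebesgue_integral_def by simp
qed

text \<open>The inner integral of \<open>1 / (t + s)\<close> equals
  \<open>\<bar>\<phi> (- s)\<bar> / s\<close>; together with the decay \<open>C / (1 + s)\<close>
  this is comparable to the integrand of the growth condition for
  \<open>s \<ge> \<delta>\<close>.\<close>

lemma growth_ray_finite:
  assumes rep: "represents \<mu> \<phi>" and growth: "growth_condition \<phi>" and \<delta>: "\<delta> > 0" and C: "C \<ge> 0"
  shows "(\<integral>\<^sup>+s\<in>{\<delta>..}. (\<integral>\<^sup>+t. ennreal (C / (1 + s) / (t + s) / \<kappa>\<^sup>2) \<partial>\<mu>) \<partial>lborel) < \<infinity>"
proof -
  have \<mu>: "OM_measure \<mu>" using rep by (simp add: represents_def)
  \<comment> \<open>The factor \<open>1 + 1 / \<delta>\<close> is chosen for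
    \<open>1 + s^2 \<le> (1 + 1 / \<delta>) * s * (1 + s)\<close>, which holds because
    \<open>s / \<delta> \<ge> 1\<close>.\<close>
  define K where "K = C / \<kappa>\<^sup>2 * (1 + 1 / \<delta>)"
  have K: "K \<ge> 0" unfolding K_def using C \<delta> by simp
  have pt: "C / (1 + s) / (t + s) / \<kappa>\<^sup>2 \<le> K / (1 + s\<^sup>2) * (s / (t + s))" if "s \<ge> \<delta>" "t > 0" for s t
  proof -
    have "1 / \<delta> * s \<ge> 1" using that \<delta> by (simp add: field_simps)
    then have "1 / \<delta> * s * (1 + s) \<ge> 1 * (1 + s)" using that \<delta> by (intro mult_right_mono) auto
    then have "1 + s\<^sup>2 \<le> (1 + 1 / \<delta>) * (s * (1 + s))"
      using that \<delta> by (simp add: power2_eq_square algebra_simps add_divide_distrib)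
    then have "1 / (1 + s) \<le> (1 + 1 / \<delta>) * s / (1 + s\<^sup>2)"
      using that \<delta> by (simp add: divide_simps add_pos_nonneg mult_ac)
    then have "C / \<kappa>\<^sup>2 / (t + s) * (1 / (1 + s)) \<le> C / \<kappa>\<^sup>2 / (t + s) * ((1 + 1 / \<delta>) * s / (1 + s\<^sup>2))"
      using C that \<delta> by (intro mult_left_mono) auto
    then show ?thesis by (simp add: K_def mult_ac)
  qed
  let ?X = "\<lambda>s. indicator {\<delta>..} s *\<^sub>R (cmod (\<phi> (of_real (- s))) / (1 + s\<^sup>2))"
  have cont: "continuous_on {\<delta>..} (\<lambda>s. cmod (\<phi> (of_real (- s))) / (1 + s\<^sup>2))"
  proof (intro continuous_intros continuous_on_compose2[OF holomorphic_on_imp_continuous_on[OF OM_holomorphic[OF rep]]])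
    show "(\<lambda>s. complex_of_real (- s)) ` {\<delta>..} \<subseteq> - complex_of_real ` {0..}"
      using \<delta> by (auto simp flip: of_real_minus)
    show "\<forall>s\<in>{\<delta>..}. 1 + s\<^sup>2 \<noteq> 0" using \<delta> by (auto simp: add_nonneg_eq_0_iff)
  qed
  have Xm: "?X \<in> borel_measurable borel"
    using set_measurable_continuous_on[OF _ cont] by (simp add: set_borel_measurable_def)
  have "(\<integral>\<^sup>+s\<in>{\<delta>..}. (\<integral>\<^sup>+t. ennreal (C / (1 + s) / (t + s) / \<kappa>\<^sup>2) \<partial>\<mu>) \<partial>lborel)
     \<le> (\<integral>\<^sup>+s. ennreal K * ennreal (?X s) \<partial>lborel)"
  proof (rule nn_integral_mono)
    fix s
    show "(\<integral>\<^sup>+t. ennreal (C / (1 + s) / (t + s) / \<kappa>\<^sup>2) \<partial>\<mu>) * indicator {\<delta>..} s \<le> ennreal K * ennreal (?X s)"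
    proof (cases "s \<ge> \<delta>")
      case True
      have "(\<integral>\<^sup>+t. ennreal (C / (1 + s) / (t + s) / \<kappa>\<^sup>2) \<partial>\<mu>) \<le> (\<integral>\<^sup>+t. ennreal (K / (1 + s\<^sup>2)) * ennreal (s / (t + s)) \<partial>\<mu>)"
      proof (rule nn_integral_mono)
        fix t assume "t \<in> space \<mu>"
        then have t: "t > 0" by (simp add: space_OM[OF \<mu>])
        have "ennreal (K / (1 + s\<^sup>2)) * ennreal (s / (t + s)) = ennreal (K / (1 + s\<^sup>2) * (s / (t + s)))"
          using K True t \<delta> by (intro ennreal_mult[symmetric]) auto
        then show "ennreal (C / (1 + s) / (t + s) / \<kappa>\<^sup>2) \<le> ennreal (K / (1 + s\<^sup>2)) * ennreal (s / (t + s))"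
          using pt[OF True t] by (simp add: ennreal_leI)
      qed
      also have "\<dots> = ennreal (K / (1 + s\<^sup>2)) * (\<integral>\<^sup>+t. ennreal (s / (t + s)) \<partial>\<mu>)"
        by (intro nn_integral_cmult borel_measurable_OM[OF \<mu>]) measurable
      also have "\<dots> = ennreal (K / (1 + s\<^sup>2)) * ennreal (cmod (\<phi> (of_real (- s))))"
        using True \<delta> by (subst cmod_OM_negative(1)[OF rep]) auto
      also have "\<dots> = ennreal K * ennreal (?X s)"
        using True K by (simp flip: ennreal_mult)
      finally show ?thesis using True by simp
    qed simp
  qed
  also have "\<dots> = ennreal K * (\<integral>\<^sup>+s. ennreal (?X s) \<partial>lborel)"
    using Xm by (intro nn_integral_cmult) simp
  also have "(\<integral>\<^sup>+s. ennreal (?X s) \<partial>lborel) \<le> (\<integral>\<^sup>+ x\<in>{0..}. ennreal (cmod (\<phi> (of_real (- x))) / (1 + x\<^sup>2)) \<partial>lborel)"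
    using \<delta> by (intro nn_integral_mono) (auto simp: indicator_def)
  also have "ennreal K * \<dots> < \<infinity>"
    using growth by (simp add: growth_condition_def ennreal_mult_less_top)
  finally show ?thesis by (simp add: mult_left_mono)
qed

section \<open>The measure of the logarithm\<close>

text \<open>The end point \<open>l\<close> has no mass, so the closed half-line may be used, in
  accordance with the integrals over \<open>{l..}\<close> elsewhere.\<close>

definition psi_measure :: "real \<Rightarrow> real measure" where
  "psi_measure l = density (restrict_space lborel {0<..}) (\<lambda>t. ennreal (indicator {l..} t / t))"

lemma psi_density_measurable:
  "(\<lambda>t::real. indicator {l..} t / t :: real) \<in> borel_measurable (restrict_space lborel {0<..})"
  by (rule measurable_restrict_space1) measurable

lemma integral_psi_measure:
  fixes f :: "real \<Rightarrow> complex"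
  assumes l: "l > 0" and fm: "f \<in> borel_measurable (restrict_space lborel {0<..})"
  shows "(\<integral>t. f t \<partial>psi_measure l) = (LINT t:{l..}|lborel. f t / of_real t)"
proof -
  have "(\<integral>t. f t \<partial>psi_measure l) = (\<integral>t. (indicator {l..} t / t) *\<^sub>R f t \<partial>restrict_space lborel {0<..})"
    unfolding psi_measure_def
    by (rule integral_density[OF fm psi_density_measurable]) (auto simp: AE_restrict_space_iff indicator_def)
  also have "\<dots> = (\<integral>t. indicator {0<..} t *\<^sub>R ((indicator {l..} t / t) *\<^sub>R f t) \<partial>lborel)"
    by (rule integral_restrict_space) simp
  also have "\<dots> = (LINT t:{l..}|lborel. f t / of_real t)"
    unfolding set_lebesgue_integral_def
    by (intro Bochner_Integration.integral_cong refl)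
       (use l in \<open>auto simp: indicator_def scaleR_conv_of_real\<close>)
  finally show ?thesis .
qed

lemma OM_psi_measure:
  assumes l: "l > 0"
  shows "OM_measure (psi_measure l)"
  unfolding OM_measure_def
proof
  show "sets (psi_measure l) = sets (restrict_space borel {0<..})"
    unfolding psi_measure_def sets_density by (rule sets_restrict_space_cong) simp
  have "(\<integral>\<^sup>+ t. ennreal (1 / (1 + t)) \<partial>psi_measure l)
    = (\<integral>\<^sup>+ t. ennreal (indicator {l..} t / t) * ennreal (1 / (1 + t)) \<partial>restrict_space lborel {0<..})"
    unfolding psi_measure_def
  proof (rule nn_integral_density)
    show "(\<lambda>t. ennreal (1 / (1 + t))) \<in> borel_measurable (restrict_space lborel {0<..})"
      by (rule measurable_restrict_space1) measurable
  qed (rule measurable_compose[OF psi_density_measurable measurable_ennreal])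
  also have "\<dots> = (\<integral>\<^sup>+ t. ennreal (indicator {l..} t / t) * ennreal (1 / (1 + t)) * indicator {0<..} t \<partial>lborel)"
    by (rule nn_integral_restrict_space) simp
  also have "\<dots> \<le> (\<integral>\<^sup>+ t. ennreal (norm (indicator {l..} t *\<^sub>R (1 / (t + 0)\<^sup>2))) \<partial>lborel)"
  proof (rule nn_integral_mono)
    fix t :: real
    have "1 / t * (1 / (1 + t)) \<le> 1 / t\<^sup>2" if "t > 0"
      using that by (simp add: power2_eq_square divide_simps)
    then show "ennreal (indicator {l..} t / t) * ennreal (1 / (1 + t)) * indicator {0<..} t
      \<le> ennreal (norm (indicator {l..} t *\<^sub>R (1 / (t + 0)\<^sup>2)))"
      using l by (auto simp: indicator_def simp flip: ennreal_mult intro!: ennreal_leI)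
  qed
  also have "\<dots> < \<infinity>"
    using set_integrable_inverse_square[of l 0 1] l
    unfolding set_integrable_def by (simp add: integrable_iff_bounded)
  finally show "(\<integral>\<^sup>+ t. ennreal (1 / (1 + t)) \<partial>psi_measure l) < \<infinity>" .
qed

text \<open>After division by \<open>t\<close> the integrand is \<open>1 / (t - z) - 1 / t\<close>,
  with primitive \<open>Ln (t - z) - Ln t\<close>. It tends to 0 at infinity, and its value at
  \<open>l\<close> is \<open>- psi l z\<close>.\<close>

lemma represents_psi:
  assumes l: "l > 0"
  shows "represents (psi_measure l) (psi l)"
  unfolding represents_def
proof (intro conjI ballI OM_psi_measure l)
  fix z assume z: "z \<in> - complex_of_real ` {0<..}"
  have off: "of_real t - z \<notin> \<real>\<^sub>\<le>\<^sub>0" if t: "t > 0" for t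
  proof
    assume "of_real t - z \<in> \<real>\<^sub>\<le>\<^sub>0"
    then have "z = of_real (Re z)" "Re z > 0" using t by (auto simp: complex_nonpos_Reals_iff complex_eq_iff)
    then show False using z by (metis ComplD greaterThan_iff imageI)
  qed
  obtain \<kappa> where \<kappa>: "\<kappa> > 0" "\<And>t. t \<ge> 0 \<Longrightarrow> \<kappa> * t \<le> cmod (of_real t - z)"
  proof (cases "z = 0")
    case True
    then show ?thesis using that[of 1] by simp
  next
    case False
    have "z \<notin> complex_of_real ` {0..}"
    proof
      assume "z \<in> complex_of_real ` {0..}"
      then obtain t where "t \<ge> 0" "z = of_real t" by auto
      then show False using z False by (cases "t = 0") auto
    qed
    from distance_from_positive_axis[OF this] obtain \<kappa>
      where "\<kappa> > 0" "\<And>t. t \<ge> 0 \<Longrightarrow> \<kappa> * (1 + t) \<le> cmod (of_real t - z)" by blast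
    then have "\<kappa> * t \<le> cmod (of_real t - z)" if "t \<ge> 0" for t
      using that by (force simp: distrib_left)
    with \<open>\<kappa> > 0\<close> show ?thesis using that[of \<kappa>] by blast
  qed
  let ?f = "\<lambda>t. z / (of_real t - z) / of_real t"
  let ?P = "\<lambda>t. Ln (of_real t - z) - Ln (of_real t)"
  have ne: "of_real t - z \<noteq> 0" if "t > 0" for t using off[OF that] by auto
  have int: "set_integrable lborel {l..} ?f"
  proof (rule set_integrable_continuous_bound[where c = 0 and C = "cmod z / \<kappa>"])
    show "continuous_on {l..} ?f" using l ne by (intro continuous_intros) auto
    fix t assume t: "l \<le> t"
    then have t0: "t > 0" using l by simp
    have "norm (?f t) = cmod z / (cmod (of_real t - z) * t)" using t0 by (simp add: norm_divide norm_mult)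
    also have "\<dots> \<le> cmod z / (\<kappa> * t * t)" using \<kappa>(1) \<kappa>(2)[of t] t0 by (intro frac_le mult_mono mult_pos_pos) auto
    finally show "norm (?f t) \<le> cmod z / \<kappa> / (t + 0)\<^sup>2" by (simp add: power2_eq_square)
  qed (use l in simp)
  have der: "(?P has_vector_derivative ?f t) (at t within S)" if "t \<ge> l" for t S
  proof -
    have t: "t > 0" using that l by simp
    then have t': "complex_of_real t \<notin> \<real>\<^sub>\<le>\<^sub>0" "complex_of_real t \<noteq> 0" by auto
    have "((\<lambda>w. Ln (w - z) - Ln w) has_field_derivative ?f t) (at (of_real t))"
      using off[OF t] ne[OF t] t' by (auto intro!: derivative_eq_intros simp: divide_simps)
    from has_vector_derivative_real_field[OF this] show ?thesis .
  qed
  have z0: "((\<lambda>b. z * of_real (1 / b)) \<longlongrightarrow> z * of_real 0) at_top"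
    by (intro tendsto_intros tendsto_of_real) real_asymp
  have "((\<lambda>b. Ln (1 - z * of_real (1 / b))) \<longlongrightarrow> Ln (1 - z * of_real 0)) at_top"
    by (intro tendsto_Ln tendsto_diff tendsto_const z0) simp
  then have "((\<lambda>b. Ln (1 - z * of_real (1 / b))) \<longlongrightarrow> 0) at_top" by simp
  moreover have "\<forall>\<^sub>F b in at_top. Ln (1 - z * of_real (1 / b)) = ?P b"
  proof (rule eventually_mono[OF eventually_gt_at_top[of 0]])
    fix b :: real assume b: "0 < b"
    have eq: "of_real b - z = of_real b * (1 - z * of_real (1 / b))" using b by (simp add: algebra_simps)
    then have "1 - z * of_real (1 / b) \<noteq> 0" using ne[OF b] by auto
    then have "Ln (of_real b - z) = of_real (ln b) + Ln (1 - z * of_real (1 / b))"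
      unfolding eq using b by (subst Ln_times_of_real) (auto simp: Ln_of_real)
    then show "Ln (1 - z * of_real (1 / b)) = ?P b" by (simp only: Ln_of_real[OF b] add_diff_cancel_left')
  qed
  ultimately have "(?P \<longlongrightarrow> 0) at_top" by (rule Lim_transform_eventually)
  then have "(LINT t:{l..}|lborel. ?f t) = 0 - ?P l"
    by (rule set_integral_FTC_atLeast[where P = ?P, OF int, rotated]) (rule der)
  moreover have "psi l z = - ?P l" using l by (simp add: psi_def Ln_of_real)
  moreover have "(\<integral>t. z / (of_real t - z) \<partial>psi_measure l) = (LINT t:{l..}|lborel. ?f t)"
    by (rule integral_psi_measure[OF l], rule measurable_restrict_space1) measurable
  ultimately show "psi l z = (\<integral>t. z / (of_real t - z) \<partial>psi_measure l)" by simp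
qed

lemma psi_OM: "l > 0 \<Longrightarrow> psi l \<in> OM_minus"
  using represents_psi by (auto simp: OM_minus_def)

lemma represents_repr_measure: "\<phi> \<in> OM_minus \<Longrightarrow> represents (repr_measure \<phi>) \<phi>"
  unfolding repr_measure_def OM_minus_def by (auto intro: someI)

text \<open>The logarithm grows more slowly than a square root, which leaves the integrable power
  -3/2. Consequently the contour formula is available for \<open>psi l\<close> itself, and this
  identifies the spectral shift function.\<close>

lemma growth_psi:
  assumes l: "l > 0"
  shows "growth_condition (psi l)"
proof -
  \<comment> \<open>One factor 2 comes from \<open>ln y = 2 * ln (sqrt y)\<close>, the other from
    \<open>(1 + x)^2 \<le> 2 * (1 + x^2)\<close>.\<close>
  define C where "C = 4 * sqrt (1 + 1 / l)"
  have C: "C \<ge> 0" using l by (simp add: C_def)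
  have bnd: "cmod (psi l (of_real (- x))) / (1 + x\<^sup>2) \<le> C * (1 + x) powr (- 3 / 2)" if x: "x \<ge> 0" for x
  proof -
    have "psi l (of_real (- x)) = of_real (ln l - ln (l + x))"
      using l x by (simp add: psi_def Ln_of_real flip: of_real_add)
    then have "cmod (psi l (of_real (- x))) = \<bar>ln l - ln (l + x)\<bar>" by (simp only: norm_of_real)
    also have "\<dots> = ln (1 + x / l)"
    proof -
      have "1 + x / l = (l + x) / l" using l by (simp add: field_simps)
      then have "ln (1 + x / l) = ln (l + x) - ln l" using l x by (simp add: ln_div)
      moreover have "ln l \<le> ln (l + x)" using l x by simp
      ultimately show ?thesis by simp
    qed
    also have "\<dots> = 2 * ln (sqrt (1 + x / l))" using l x by (simp add: ln_sqrt add_pos_nonneg)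
    also have "\<dots> \<le> 2 * sqrt (1 + x / l)"
      using ln_bound[of "sqrt (1 + x / l)"] l x by (simp add: add_pos_nonneg)
    also have "\<dots> \<le> 2 * sqrt ((1 + 1 / l) * (1 + x))"
      using l x by (simp add: field_simps)
    also have "\<dots> = C / 2 * (1 + x) powr (1 / 2)"
      using x by (simp add: C_def real_sqrt_mult powr_half_sqrt)
    finally have 1: "cmod (psi l (of_real (- x))) \<le> C / 2 * (1 + x) powr (1 / 2)" .
    have "(1 + x)\<^sup>2 \<le> 2 * (1 + x\<^sup>2)"
      using sum_squares_bound[of 1 x] by (simp add: power2_eq_square algebra_simps)
    then have 2: "1 / (1 + x\<^sup>2) \<le> 2 / (1 + x)\<^sup>2" using x by (simp add: divide_simps add_pos_nonneg)
    have "cmod (psi l (of_real (- x))) * (1 / (1 + x\<^sup>2)) \<le> (C / 2 * (1 + x) powr (1 / 2)) * (2 / (1 + x)\<^sup>2)"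
      using C by (intro mult_mono 1 2) auto
    also have "\<dots> = C * ((1 + x) powr (1 / 2) / (1 + x) powr 2)" using x by simp
    also have "\<dots> = C * (1 + x) powr (- 3 / 2)" by (simp flip: powr_diff)
    finally show ?thesis by simp
  qed
  have "(\<integral>\<^sup>+ x\<in>{0..}. ennreal (cmod (psi l (of_real (- x))) / (1 + x\<^sup>2)) \<partial>lborel)
    \<le> (\<integral>\<^sup>+ x. ennreal (C * (1 + x) powr (- 3 / 2)) * indicator {0..} x \<partial>lborel)"
    using bnd by (intro nn_integral_mono) (auto simp: indicator_def intro!: ennreal_leI)
  also have "\<dots> = ennreal (0 - (- 2 * C * (1 + 0) powr (- 1 / 2)))"
  proof (rule nn_integral_FTC_atLeast)
    fix x :: real assume "0 \<le> x"
    then show "((\<lambda>x. - 2 * C * (1 + x) powr (- 1 / 2)) has_real_derivative C * (1 + x) powr (- 3 / 2)) (at x)"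
      by (auto intro!: derivative_eq_intros)
  next
    show "((\<lambda>x. - 2 * C * (1 + x) powr (- 1 / 2)) \<longlongrightarrow> 0) at_top"
      by real_asymp
  qed (use C in auto)
  finally show ?thesis unfolding growth_condition_def by (rule le_less_trans) simp
qed

text \<open>The order of integration is exchanged on the rays and the arc separately; for each fixed
  \<open>t\<close> the three inner integrals reassemble to the contour integral of
  \<open>Cauchy_Gamma\<close>. The left-hand side does not mention \<open>\<mu>\<close>, so all
  representing measures give the same integral of \<open>t * h t\<close>.\<close>

lemma (in keyhole) trace_integral_Gamma:
  assumes c: "0 < c" "\<theta> \<le> c" "\<delta> < c"
    and der: "\<And>z. z \<in> sector_nbhd c \<Longrightarrow> (\<Xi> has_field_derivative h z) (at z)"
    and bnd: "\<And>z. z \<in> sector_nbhd c \<Longrightarrow> cmod (\<Xi> z) \<le> C / (1 + cmod z)"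
    and rep: "represents \<mu> \<phi>" and growth: "growth_condition \<phi>"
  shows "Gamma_integrable \<theta> \<delta> (\<lambda>z. \<Xi> z * deriv \<phi> z)"
    and "Gamma_integral \<theta> \<delta> (\<lambda>z. \<Xi> z * deriv \<phi> z) = 2 * pi * \<i> * (\<integral>t. of_real t * h (of_real t) \<partial>\<mu>)"
proof -
  let ?U = "sector_nbhd c"
  define \<kappa> where "\<kappa> = sin (\<theta> / 2)"
  have \<kappa>: "\<kappa> > 0" unfolding \<kappa>_def by (rule sin_cos_pos)
  have \<mu>: "OM_measure \<mu>" using rep by (simp add: represents_def)
  have ray: "of_real r * cis s \<in> ?U" if "0 \<le> r" "\<bar>s\<bar> \<le> \<theta>" for r s
    using that c by (intro ray_in_sector_nbhd) auto
  have ball: "cball 0 \<delta> \<subseteq> ?U" using c by (intro cball_subset_sector_nbhd)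
  have cont: "continuous_on ?U \<Xi>"
    using der by (meson DERIV_isCont continuous_at_imp_continuous_on)
  have "0 \<in> ?U" using ball \<delta> by auto
  from bnd[OF this] have C: "C \<ge> 0" by (auto intro: order_trans[OF norm_ge_zero])
  have bnd': "cmod (\<Xi> z) \<le> C" if "z \<in> ?U" for z
  proof -
    have "C / (1 + cmod z) \<le> C" using C by (simp add: divide_le_eq add_pos_nonneg mult_left_mono)
      (simp add: distrib_left)
    then show ?thesis using bnd[OF that] by simp
  qed
  have low: "\<kappa> * (t + r) \<le> cmod (of_real t - of_real r * cis s)" if "cos s \<le> cos \<theta>" "t > 0" "0 \<le> r" for s t r
    unfolding \<kappa>_def using that \<theta> by (intro norm_diff_off_sector) auto
  have off: "of_real r * cis s \<notin> complex_of_real ` {0..}" if s: "cos s \<le> cos \<theta>" and r: "r > 0" for r s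
  proof
    assume "of_real r * cis s \<in> complex_of_real ` {0..}"
    then obtain t where t: "t \<ge> 0" "of_real r * cis s = complex_of_real t" by auto
    have "cmod (of_real r * cis s) = r" using r by (simp add: norm_mult)
    then have "t = r" using t by simp
    then show False using low[OF s, of t r] t r mult_pos_pos[OF \<kappa> r] by simp
  qed
  have d\<phi>: "deriv \<phi> (of_real r * cis s) = (\<integral>t. of_real t / (of_real t - of_real r * cis s)\<^sup>2 \<partial>\<mu>)"
    if "cos s \<le> cos \<theta>" "r > 0" for r s
    using OM_deriv_eq[OF rep off[OF that]] .
  have ray_facts:
    "set_integrable lborel {\<delta>..} (\<lambda>r. \<Xi> (of_real r * cis s) * deriv \<phi> (of_real r * cis s) * cis s)" (is ?R1)
    "(LINT r:{\<delta>..}|lborel. \<Xi> (of_real r * cis s) * deriv \<phi> (of_real r * cis s) * cis s) =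
      (\<integral>t. of_real t * (LINT r:{\<delta>..}|lborel. \<Xi> (of_real r * cis s) / (of_real r * cis s - of_real t)\<^sup>2 * cis s) \<partial>\<mu>)" (is ?R2)
    "integrable \<mu> (\<lambda>t. of_real t * (LINT r:{\<delta>..}|lborel. \<Xi> (of_real r * cis s) / (of_real r * cis s - of_real t)\<^sup>2 * cis s))" (is ?R3)
    if s: "\<bar>s\<bar> \<le> \<theta>" "cos s \<le> cos \<theta>" for s
  proof -
    let ?G = "\<lambda>r. \<Xi> (of_real r * cis s) * cis s" and ?p = "\<lambda>r. complex_of_real r * cis s"
    have contp: "continuous_on {\<delta>..} ?p" by (intro continuous_intros)
    have contG: "continuous_on {\<delta>..} ?G"
      using ray s \<delta> by (intro continuous_intros continuous_on_compose2[OF cont]) auto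
    have lo: "\<kappa> * (t + r) \<le> cmod (of_real t - ?p r)" if "r \<in> {\<delta>..}" "t > 0" for r t
      using low[OF s(2)] that \<delta> by auto
    have w: "cmod (?G r) \<le> C / (1 + r)" if "r \<in> {\<delta>..}" for r
      using bnd[OF ray[of r s]] that s \<delta> by (simp add: norm_mult)
    have pos: "r > 0" if "r \<in> {\<delta>..}" for r using that \<delta> by auto
    note F = kernel_Fubini[OF \<mu> _ contp contG \<kappa> lo pos w growth_ray_finite[OF rep growth \<delta> C]]
    have eq: "\<Xi> (?p r) * deriv \<phi> (?p r) * cis s = ?G r * (\<integral>t. of_real t / (of_real t - ?p r)\<^sup>2 \<partial>\<mu>)"
      if "r \<in> {\<delta>..}" for r
      using d\<phi>[OF s(2), of r] that \<delta> by simp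
    have "set_integrable lborel {\<delta>..} (\<lambda>r. ?G r * (\<integral>t. of_real t / (of_real t - ?p r)\<^sup>2 \<partial>\<mu>))"
      by (rule F(1)) auto
    then show ?R1 by (subst set_integrable_cong[OF refl refl eq]) auto
    have "(LINT r:{\<delta>..}|lborel. \<Xi> (?p r) * deriv \<phi> (?p r) * cis s) =
      (LINT r:{\<delta>..}|lborel. ?G r * (\<integral>t. of_real t / (of_real t - ?p r)\<^sup>2 \<partial>\<mu>))"
      by (rule set_lebesgue_integral_cong) (use eq in auto)
    also have "\<dots> = (\<integral>t. of_real t * (LINT r:{\<delta>..}|lborel. ?G r / (?p r - of_real t)\<^sup>2) \<partial>\<mu>)"
      by (rule F(2)) auto
    finally show ?R2 by simp
    have "integrable \<mu> (\<lambda>t. of_real t * (LINT r:{\<delta>..}|lborel. ?G r / (?p r - of_real t)\<^sup>2))"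
      by (rule F(3)) auto
    then show ?R3 by simp
  qed
  have arcU: "of_real \<delta> * cis s \<in> ?U" for s using ball \<delta> by (auto simp: norm_mult)
  have cosarc: "cos s \<le> cos \<theta>" if "s \<in> {\<theta>..2 * pi - \<theta>}" for s
    using that \<theta> by (intro cos_le_of_between) auto
  have arc_eq: "contour_integral inner_arc g = (LINT s:{\<theta>..2 * pi - \<theta>}|lborel. g (of_real \<delta> * cis s) * \<delta> * \<i> * cis s)"
    if "set_integrable lborel {\<theta>..2 * pi - \<theta>} (\<lambda>s. g (of_real \<delta> * cis s) * \<delta> * \<i> * cis s)" for g :: "complex \<Rightarrow> complex"
    using contour_integral_part_circlepath_eq[of \<theta> "2 * pi - \<theta>" 0 \<delta> g] \<theta>
      set_borel_integral_eq_integral(2)[OF that] by simp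
  let ?G = "\<lambda>s. \<Xi> (of_real \<delta> * cis s) * \<delta> * \<i> * cis s"
  let ?p = "\<lambda>s. complex_of_real \<delta> * cis s"
  let ?S = "{\<theta>..2 * pi - \<theta>}"
  have contp: "continuous_on ?S ?p" by (intro continuous_intros)
  have contG: "continuous_on ?S ?G"
    using arcU by (intro continuous_intros continuous_on_compose2[OF cont]) auto
  have w: "cmod (?G s) \<le> C * \<delta>" for s
    using bnd'[OF arcU[of s]] \<delta> by (simp add: norm_mult mult_right_mono)
  have lo: "\<kappa> * (t + \<delta>) \<le> cmod (of_real t - ?p s)" if "s \<in> ?S" "t > 0" for s t
    using low[OF cosarc[OF that(1)] that(2)] \<delta> by simp
  \<comment> \<open>On the arc the modulus is constant and the length finite, so the integrability
    of \<open>1 / (t + \<delta>)\<close> suffices.\<close>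
  have fin: "(\<integral>\<^sup>+s\<in>?S. (\<integral>\<^sup>+t. ennreal (C * \<delta> / (t + \<delta>) / \<kappa>\<^sup>2) \<partial>\<mu>) \<partial>lborel) < \<infinity>"
  proof -
    have "integrable \<mu> (\<lambda>t. C * \<delta> / (t + \<delta>) / \<kappa>\<^sup>2)"
    proof (rule integrable_OM[OF \<mu>, where C = "C / \<kappa>\<^sup>2 * (1 + \<delta>)"])
      fix t :: real assume t: "t > 0"
      have "\<delta> * (1 + t) \<le> (1 + \<delta>) * (t + \<delta>)" using \<delta> t by (simp add: algebra_simps)
      then have "\<delta> / (t + \<delta>) \<le> (1 + \<delta>) / (1 + t)" using \<delta> t by (simp add: field_simps)
      then have "C / \<kappa>\<^sup>2 * (\<delta> / (t + \<delta>)) \<le> C / \<kappa>\<^sup>2 * ((1 + \<delta>) / (1 + t))"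
        using C by (intro mult_left_mono) auto
      then show "norm (C * \<delta> / (t + \<delta>) / \<kappa>\<^sup>2) \<le> C / \<kappa>\<^sup>2 * (1 + \<delta>) / (1 + t)"
        using C \<delta> t by (simp add: mult_ac)
    qed (intro borel_measurable_OM[OF \<mu>], measurable)
    then have "(\<integral>\<^sup>+t. ennreal (norm (C * \<delta> / (t + \<delta>) / \<kappa>\<^sup>2)) \<partial>\<mu>) < \<infinity>"
      by (simp add: integrable_iff_bounded)
    moreover have "(\<integral>\<^sup>+t. ennreal (C * \<delta> / (t + \<delta>) / \<kappa>\<^sup>2) \<partial>\<mu>) \<le> (\<integral>\<^sup>+t. ennreal (norm (C * \<delta> / (t + \<delta>) / \<kappa>\<^sup>2)) \<partial>\<mu>)"
      by (intro nn_integral_mono ennreal_leI) (unfold real_norm_def, rule abs_ge_self)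
    ultimately have "(\<integral>\<^sup>+t. ennreal (C * \<delta> / (t + \<delta>) / \<kappa>\<^sup>2) \<partial>\<mu>) < \<infinity>" by (rule le_less_trans[rotated])
    then show ?thesis
      by (subst nn_integral_cmult_indicator) (auto simp: ennreal_mult_less_top emeasure_lborel_Icc_eq)
  qed
  note F = kernel_Fubini[OF \<mu> _ contp contG \<kappa> lo \<delta> w fin]
  have eq: "\<Xi> (?p s) * deriv \<phi> (?p s) * \<delta> * \<i> * cis s = ?G s * (\<integral>t. of_real t / (of_real t - ?p s)\<^sup>2 \<partial>\<mu>)"
    if "s \<in> ?S" for s
    using d\<phi>[OF cosarc[OF that] \<delta>] by simp
  have arc_int: "set_integrable lborel ?S (\<lambda>s. \<Xi> (?p s) * deriv \<phi> (?p s) * \<delta> * \<i> * cis s)"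
  proof -
    have "set_integrable lborel ?S (\<lambda>s. ?G s * (\<integral>t. of_real t / (of_real t - ?p s)\<^sup>2 \<partial>\<mu>))"
      by (rule F(1)) auto
    then show ?thesis by (subst set_integrable_cong[OF refl refl eq]) auto
  qed
  have arc_kernel: "contour_integral inner_arc (\<lambda>z. \<Xi> z / (z - of_real t)\<^sup>2) = (LINT s:?S|lborel. ?G s / (?p s - of_real t)\<^sup>2)"
    if t: "t > 0" for t
  proof -
    have ne: "?p s - of_real t \<noteq> 0" if "s \<in> ?S" for s
      using off[OF cosarc[OF that] \<delta>] t by auto
    have "continuous_on ?S (\<lambda>s. \<Xi> (?p s) / (?p s - of_real t)\<^sup>2 * \<delta> * \<i> * cis s)"
      using arcU ne by (intro continuous_intros continuous_on_compose2[OF cont]) auto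
    then have "set_integrable lborel ?S (\<lambda>s. \<Xi> (?p s) / (?p s - of_real t)\<^sup>2 * \<delta> * \<i> * cis s)"
      unfolding set_integrable_def by (intro borel_integrable_compact) auto
    from arc_eq[OF this] show ?thesis by (simp add: mult_ac)
  qed
  have arc_facts: "contour_integral inner_arc (\<lambda>z. \<Xi> z * deriv \<phi> z)
      = (\<integral>t. of_real t * contour_integral inner_arc (\<lambda>z. \<Xi> z / (z - of_real t)\<^sup>2) \<partial>\<mu>)"
    "integrable \<mu> (\<lambda>t. of_real t * contour_integral inner_arc (\<lambda>z. \<Xi> z / (z - of_real t)\<^sup>2))"
  proof -
    have "contour_integral inner_arc (\<lambda>z. \<Xi> z * deriv \<phi> z) = (LINT s:?S|lborel. \<Xi> (?p s) * deriv \<phi> (?p s) * \<delta> * \<i> * cis s)"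
      by (rule arc_eq[OF arc_int])
    also have "\<dots> = (LINT s:?S|lborel. ?G s * (\<integral>t. of_real t / (of_real t - ?p s)\<^sup>2 \<partial>\<mu>))"
      by (rule set_lebesgue_integral_cong) (use eq in auto)
    also have "\<dots> = (\<integral>t. of_real t * (LINT s:?S|lborel. ?G s / (?p s - of_real t)\<^sup>2) \<partial>\<mu>)"
      by (rule F(2)) auto
    also have "\<dots> = (\<integral>t. of_real t * contour_integral inner_arc (\<lambda>z. \<Xi> z / (z - of_real t)\<^sup>2) \<partial>\<mu>)"
      by (intro Bochner_Integration.integral_cong refl) (simp add: arc_kernel space_OM[OF \<mu>])
    finally show "contour_integral inner_arc (\<lambda>z. \<Xi> z * deriv \<phi> z)
      = (\<integral>t. of_real t * contour_integral inner_arc (\<lambda>z. \<Xi> z / (z - of_real t)\<^sup>2) \<partial>\<mu>)" .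
    have "integrable \<mu> (\<lambda>t. of_real t * (LINT s:?S|lborel. ?G s / (?p s - of_real t)\<^sup>2))"
      by (rule F(3)) auto
    then show "integrable \<mu> (\<lambda>t. of_real t * contour_integral inner_arc (\<lambda>z. \<Xi> z / (z - of_real t)\<^sup>2))"
      by (subst Bochner_Integration.integrable_cong[OF refl]) (simp_all add: arc_kernel space_OM[OF \<mu>])
  qed
  have "continuous_on (path_image inner_arc) (\<lambda>z. \<Xi> z * deriv \<phi> z)"
  proof (intro continuous_intros)
    show "continuous_on (path_image inner_arc) \<Xi>"
      by (rule continuous_on_subset[OF cont]) (use arcU in \<open>auto simp: path_image_arc\<close>)
    have "deriv \<phi> holomorphic_on - complex_of_real ` {0..}"
      by (rule holomorphic_deriv[OF OM_holomorphic[OF rep] open_off_positive_axis])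
    moreover have "path_image inner_arc \<subseteq> - complex_of_real ` {0..}"
      unfolding path_image_arc
      by (intro image_subsetI) (simp only: Compl_iff off[OF cosarc \<delta>] not_False_eq_True)
    ultimately show "continuous_on (path_image inner_arc) (deriv \<phi>)"
      using holomorphic_on_imp_continuous_on continuous_on_subset by blast
  qed
  then have "(\<lambda>z. \<Xi> z * deriv \<phi> z) contour_integrable_on inner_arc"
    by (rule contour_integrable_continuous_part_circlepath)
  moreover have s: "\<bar>\<theta>\<bar> \<le> \<theta>" "cos \<theta> \<le> cos \<theta>" "\<bar>- \<theta>\<bar> \<le> \<theta>" "cos (- \<theta>) \<le> cos \<theta>" using \<theta> by auto
  ultimately show "Gamma_integrable \<theta> \<delta> (\<lambda>z. \<Xi> z * deriv \<phi> z)"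
    unfolding Gamma_integrable_def using ray_facts(1)[OF s(1,2)] ray_facts(1)[OF s(3,4)] by blast
  let ?L = "\<lambda>s t. LINT r:{\<delta>..}|lborel. \<Xi> (of_real r * cis s) / (of_real r * cis s - of_real t)\<^sup>2 * cis s"
  let ?A = "\<lambda>t. contour_integral inner_arc (\<lambda>z. \<Xi> z / (z - of_real t)\<^sup>2)"
  have "Gamma_integral \<theta> \<delta> (\<lambda>z. \<Xi> z * deriv \<phi> z) =
     - (\<integral>t. of_real t * ?L \<theta> t \<partial>\<mu>) + (\<integral>t. of_real t * ?A t \<partial>\<mu>) + (\<integral>t. of_real t * ?L (- \<theta>) t \<partial>\<mu>)"
    unfolding Gamma_integral_def ray_facts(2)[OF s(1,2)] ray_facts(2)[OF s(3,4)] arc_facts(1) ..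
  also have "\<dots> = (\<integral>t. - (of_real t * ?L \<theta> t) + of_real t * ?A t + of_real t * ?L (- \<theta>) t \<partial>\<mu>)"
    using ray_facts(3)[OF s(1,2)] ray_facts(3)[OF s(3,4)] arc_facts(2) by simp
  also have "\<dots> = (\<integral>t. 2 * pi * \<i> * (of_real t * h (of_real t)) \<partial>\<mu>)"
  proof (intro Bochner_Integration.integral_cong refl)
    fix t assume "t \<in> space \<mu>"
    then have t: "t > 0" by (simp add: space_OM[OF \<mu>])
    have "- (of_real t * ?L \<theta> t) + of_real t * ?A t + of_real t * ?L (- \<theta>) t
      = of_real t * Gamma_integral \<theta> \<delta> (\<lambda>z. \<Xi> z / (z - of_real t)\<^sup>2)"
      by (simp add: Gamma_integral_def algebra_simps)
    also have "Gamma_integral \<theta> \<delta> (\<lambda>z. \<Xi> z / (z - of_real t)\<^sup>2) = 2 * pi * \<i> * h (of_real t)"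
      by (rule Cauchy_Gamma[OF open_sector_nbhd convex_sector_nbhd der bnd' ray ball t])
    finally show "- (of_real t * ?L \<theta> t) + of_real t * ?A t + of_real t * ?L (- \<theta>) t
      = 2 * pi * \<i> * (of_real t * h (of_real t))" by (simp only: mult_ac)
  qed
  also have "\<dots> = 2 * pi * \<i> * (\<integral>t. of_real t * h (of_real t) \<partial>\<mu>)" by (rule integral_mult_right_zero)
  finally show "Gamma_integral \<theta> \<delta> (\<lambda>z. \<Xi> z * deriv \<phi> z) = 2 * pi * \<i> * (\<integral>t. of_real t * h (of_real t) \<partial>\<mu>)" .
qed

section \<open>Power series of resolvents under the integral\<close>

text \<open>The half-line is cut into intervals of length \<open>1 / (2 * K)\<close>, and \<open>cell K j\<close> is the indicator of
  the \<open>j\<close>-th one; on it a resolvent has its power series around the left end point.\<close>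

definition cell :: "real \<Rightarrow> nat \<Rightarrow> real \<Rightarrow> real" where
  "cell K j t = (if real j \<le> 2 * K * t \<and> 2 * K * t < real j + 1 then 1 else 0)"

definition node :: "real \<Rightarrow> nat \<Rightarrow> real" where
  "node K j = real j / (2 * K)"

lemma cell_measurable [measurable]: "cell K j \<in> borel_measurable borel"
  unfolding cell_def[abs_def] by measurable

lemma cell_floor: "0 \<le> K \<Longrightarrow> 0 \<le> t \<Longrightarrow> cell K j t = (if nat \<lfloor>2 * K * t\<rfloor> = j then 1 else 0)"
proof -
  assume "0 \<le> K" "0 \<le> t"
  then have "0 \<le> 2 * K * t" by simp
  then have "nat \<lfloor>2 * K * t\<rfloor> = j \<longleftrightarrow> \<lfloor>2 * K * t\<rfloor> = int j" by (simp add: eq_nat_nat_iff nat_eq_iff)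
  then show ?thesis by (auto simp: cell_def floor_eq_iff)
qed

text \<open>Cells have length \<open>1 / (2 * K) \<le> 1\<close>; moving from \<open>t\<close> to
  its node therefore changes \<open>1 + t\<close> by at most a factor 2.\<close>

lemma cell_node:
  assumes "K \<ge> 1" "cell K j t \<noteq> 0"
  shows "node K j \<le> t" "t - node K j \<le> 1 / (2 * K)" "1 / (1 + node K j) \<le> 2 / (1 + t)" "0 \<le> node K j"
proof -
  have *: "real j \<le> 2 * K * t" "2 * K * t < real j + 1" using assms(2) by (auto simp: cell_def split: if_splits)
  show 1: "node K j \<le> t" using * assms(1) by (simp add: node_def field_simps)
  have "t < (real j + 1) / (2 * K)" using * assms(1) by (simp add: pos_less_divide_eq mult_ac)
  then show 2: "t - node K j \<le> 1 / (2 * K)" by (simp add: node_def add_divide_distrib)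
  show 3: "0 \<le> node K j" using assms(1) by (simp add: node_def)
  have "1 / (2 * K) \<le> 1" using assms(1) by simp
  then have "1 + t \<le> 2 * (1 + node K j)" using 2 3 by simp
  then show "1 / (1 + node K j) \<le> 2 / (1 + t)" using 1 3 by (simp add: field_simps)
qed

text \<open>Moment of the measure \<open>\<rho> \<mu>\<close>, restricted to one cell, about the
  node. The sign of \<open>node K j - t\<close> matches the powers in the Neumann series about the
  node.\<close>

definition moment :: "real measure \<Rightarrow> real \<Rightarrow> (real \<Rightarrow> real) \<Rightarrow> nat \<Rightarrow> nat \<Rightarrow> real" where
  "moment \<mu> K \<rho> j p = (\<integral>t. cell K j t * \<rho> t * (node K j - t) ^ p \<partial>\<mu>)"

text \<open>The integral becomes a double series over cells and powers whose coefficients are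
  scalars independent of the \<open>u j p\<close>. Used once for vectors and once for traces, it
  yields the same coefficients in both cases. The second claim bounds these coefficients so that a
  series of nuclear operators built with them converges.\<close>

lemma expansion_integral:
  fixes f :: "real \<Rightarrow> 'b::banach"
  assumes \<mu>: "OM_measure \<mu>" and K: "K \<ge> 1"
    and \<rho>: "\<rho> \<in> borel_measurable borel" "\<And>t. t > 0 \<Longrightarrow> 0 \<le> \<rho> t"
    and f: "\<And>j t. t > 0 \<Longrightarrow> cell K j t \<noteq> 0 \<Longrightarrow> (\<lambda>p. (node K j - t) ^ p *\<^sub>R u j p) sums f t"
    and u: "\<And>j p. norm (u j p) \<le> Suc p * (K / (1 + node K j)) ^ p * \<beta> j"
    and \<beta>: "\<And>j. 0 < \<beta> j" "\<And>j t. t > 0 \<Longrightarrow> cell K j t \<noteq> 0 \<Longrightarrow> \<beta> j * \<rho> t \<le> C / (1 + t)"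
  shows "vint \<mu> (\<lambda>t. \<rho> t *\<^sub>R f t) (\<Sum>j. \<Sum>p. moment \<mu> K \<rho> j p *\<^sub>R u j p)"
    and "\<exists>M. summable M \<and> (\<forall>j. 0 \<le> M j) \<and>
      (\<forall>j p. \<bar>moment \<mu> K \<rho> j p\<bar> * (Suc p * (K / (1 + node K j)) ^ p * \<beta> j) \<le> Suc p * (1 / 2) ^ p * M j)"
proof -
  have C: "0 \<le> C"
  proof -
    \<comment> \<open>The point \<open>1 / (4 * K)\<close> is the midpoint of cell 0.\<close>
    have "0 \<le> \<beta> 0 * \<rho> (1 / (4 * K))" using \<beta>(1)[of 0] \<rho>(2) K by simp
    also have "\<dots> \<le> C / (1 + 1 / (4 * K))" using K by (intro \<beta>) (auto simp: cell_def)
    finally show ?thesis using K by (simp add: zero_le_divide_iff) (smt (verit) divide_nonneg_nonneg)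
  qed
  have [measurable]: "\<rho> \<in> borel_measurable borel" by (rule \<rho>)
  let ?e = "\<lambda>j t. cell K j t * (C / (1 + t))"
  have e_int: "integrable \<mu> (?e j)" for j
    by (rule integrable_OM[OF \<mu>, where C = C])
       (use C in \<open>auto simp: cell_def intro!: borel_measurable_OM[OF \<mu>]\<close>)
  \<comment> \<open>The part of the integral of \<open>C / (1 + t)\<close> that falls into cell
    \<open>j\<close>; since the cells are disjoint, these parts sum to at most the whole.\<close>
  define M where "M j = (\<integral>t. ?e j t \<partial>\<mu>)" for j
  have M0: "0 \<le> M j" for j
    unfolding M_def using C by (intro integral_nonneg_AE AE_I2) (auto simp: space_OM[OF \<mu>] cell_def)
  have M_sum: "summable M"
  proof (rule summableI_nonneg_bounded[OF M0])
    fix n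
    have int: "integrable \<mu> (\<lambda>t. C / (1 + t))"
      by (rule integrable_OM[OF \<mu>, where C = C]) (use C in \<open>auto intro!: borel_measurable_OM[OF \<mu>]\<close>)
    have "(\<Sum>j<n. M j) = (\<integral>t. (\<Sum>j<n. ?e j t) \<partial>\<mu>)" unfolding M_def using e_int by simp
    also have "\<dots> \<le> (\<integral>t. C / (1 + t) \<partial>\<mu>)"
    proof (rule integral_mono)
      show "integrable \<mu> (\<lambda>t. \<Sum>j<n. ?e j t)" using e_int by simp
      show "integrable \<mu> (\<lambda>t. C / (1 + t))" by (rule int)
      fix t assume "t \<in> space \<mu>"
      then have t: "t > 0" by (simp add: space_OM[OF \<mu>])
      have "(\<Sum>j<n. ?e j t) = (\<Sum>j<n. if nat \<lfloor>2 * K * t\<rfloor> = j then C / (1 + t) else 0)"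
        using t K by (intro sum.cong refl) (simp add: cell_floor)
      also have "\<dots> \<le> C / (1 + t)" using C t by (subst sum.delta') auto
      finally show "(\<Sum>j<n. ?e j t) \<le> C / (1 + t)" .
    qed
    finally show "(\<Sum>j<n. M j) \<le> (\<integral>t. C / (1 + t) \<partial>\<mu>)" .
  qed
  let ?k = "\<lambda>j p t. cell K j t * \<rho> t * (node K j - t) ^ p"
  \<comment> \<open>Inside a cell
    \<open>\<bar>node K j - t\<bar> * K / (1 + node K j) \<le> 1 / 2\<close>, so the geometric
    growth permitted to \<open>u j p\<close> is outweighed by the power of
    \<open>node K j - t\<close>. The cruder second bound gives integrability.\<close>
  have k_bound: "\<bar>?k j p t\<bar> * ((K / (1 + node K j)) ^ p * \<beta> j) \<le> (1 / 2) ^ p * ?e j t"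
    "\<bar>?k j p t\<bar> \<le> C / \<beta> j / (1 + t)" if t: "t > 0" for j p t
  proof -
    have "\<bar>?k j p t\<bar> * ((K / (1 + node K j)) ^ p * \<beta> j) \<le> (1 / 2) ^ p * ?e j t \<and> \<bar>?k j p t\<bar> \<le> C / \<beta> j / (1 + t)"
    proof (cases "cell K j t = 0")
      case True
      then show ?thesis using C \<beta>(1)[of j] t by simp
    next
      case False
      then have e1: "cell K j t = 1" by (auto simp: cell_def split: if_splits)
      note n = cell_node[OF K False]
      have d: "\<bar>node K j - t\<bar> \<le> 1 / (2 * K)" using n by simp
      have "\<bar>node K j - t\<bar> * (K / (1 + node K j)) \<le> 1 / (2 * K) * (K / 1)"
        using d n(4) K by (intro mult_mono divide_left_mono) auto
      then have d2: "\<bar>node K j - t\<bar> * (K / (1 + node K j)) \<le> 1 / 2" using K by simp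
      have "\<bar>?k j p t\<bar> * ((K / (1 + node K j)) ^ p * \<beta> j)
        = (\<bar>node K j - t\<bar> * (K / (1 + node K j))) ^ p * (\<beta> j * \<rho> t)"
        by (simp only: e1 abs_mult power_abs power_mult_distrib abs_one mult_1 abs_of_nonneg[OF \<rho>(2)[OF t]] mult_ac)
      also have "\<dots> \<le> (1 / 2) ^ p * (C / (1 + t))"
        using d2 \<beta>(2)[OF t False] \<beta>(1)[of j] \<rho>(2)[OF t] K n(4)
        by (intro mult_mono power_mono) auto
      finally have 1: "\<bar>?k j p t\<bar> * ((K / (1 + node K j)) ^ p * \<beta> j) \<le> (1 / 2) ^ p * ?e j t" using e1 by simp
      have "1 / (2 * K) \<le> 1" using K by simp
      then have "\<bar>node K j - t\<bar> ^ p \<le> 1" using d by (intro power_le_one) auto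
      then have "\<bar>?k j p t\<bar> \<le> \<rho> t * 1"
        using \<rho>(2)[OF t] e1 by (simp add: abs_mult power_abs mult_left_le)
      also have "\<dots> \<le> C / \<beta> j / (1 + t)"
      proof -
        have "\<rho> t \<le> C / (1 + t) / \<beta> j"
          unfolding pos_le_divide_eq[OF \<beta>(1)] using \<beta>(2)[OF t False] by (simp only: mult.commute)
        then show ?thesis by (simp only: divide_divide_eq_left mult.commute mult_1_right)
      qed
      finally show ?thesis using 1 by simp
    qed
    then show "\<bar>?k j p t\<bar> * ((K / (1 + node K j)) ^ p * \<beta> j) \<le> (1 / 2) ^ p * ?e j t"
      "\<bar>?k j p t\<bar> \<le> C / \<beta> j / (1 + t)" by auto
  qed
  have k_int: "integrable \<mu> (?k j p)" for j p
    by (rule integrable_OM[OF \<mu>, where C = "C / \<beta> j"])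
       (use k_bound in \<open>auto intro!: borel_measurable_OM[OF \<mu>]\<close>)
  have k_moment: "\<bar>moment \<mu> K \<rho> j p\<bar> * (Suc p * (K / (1 + node K j)) ^ p * \<beta> j) \<le> Suc p * (1 / 2) ^ p * M j" for j p
  proof -
    let ?c = "(K / (1 + node K j)) ^ p * \<beta> j"
    have c0: "0 \<le> ?c" using K \<beta>(1)[of j] by (simp add: node_def)
    have "\<bar>moment \<mu> K \<rho> j p\<bar> * ?c \<le> (\<integral>t. \<bar>?k j p t\<bar> \<partial>\<mu>) * ?c"
      unfolding moment_def by (intro mult_right_mono c0) (rule integral_abs_bound)
    also have "\<dots> = (\<integral>t. \<bar>?k j p t\<bar> * ?c \<partial>\<mu>)" by (simp only: integral_mult_left_zero)
    also have "\<dots> \<le> (\<integral>t. (1 / 2) ^ p * ?e j t \<partial>\<mu>)"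
      using k_int e_int k_bound(1)
      by (intro integral_mono integrable_mult_left integrable_mult_right integrable_abs) (auto simp only: space_OM[OF \<mu>] greaterThan_iff)
    also have "\<dots> = (1 / 2) ^ p * M j" unfolding M_def by (simp only: integral_mult_right_zero)
    finally have "real (Suc p) * (\<bar>moment \<mu> K \<rho> j p\<bar> * ?c) \<le> real (Suc p) * ((1 / 2) ^ p * M j)"
      by (rule mult_left_mono) simp
    then show ?thesis by (simp only: mult_ac)
  qed
  show "\<exists>M. summable M \<and> (\<forall>j. 0 \<le> M j) \<and>
      (\<forall>j p. \<bar>moment \<mu> K \<rho> j p\<bar> * (Suc p * (K / (1 + node K j)) ^ p * \<beta> j) \<le> Suc p * (1 / 2) ^ p * M j)"
    using M_sum M0 k_moment by blast
  have geo: "(\<lambda>p. real (Suc p) * (1 / 2) ^ p) sums 4"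
    using geometric_deriv_sums[of "1 / 2 :: real"] by (simp add: power2_eq_square)
  let ?G = "\<lambda>j t. cell K j t *\<^sub>R (\<rho> t *\<^sub>R f t)"
  have term_le: "norm (?k j p t *\<^sub>R u j p) \<le> real (Suc p) * (1 / 2) ^ p * ?e j t" if t: "t > 0" for j p t
  proof -
    have "norm (?k j p t *\<^sub>R u j p) \<le> \<bar>?k j p t\<bar> * (Suc p * (K / (1 + node K j)) ^ p * \<beta> j)"
      unfolding norm_scaleR by (intro mult_left_mono u) simp
    also have "\<dots> = Suc p * (\<bar>?k j p t\<bar> * ((K / (1 + node K j)) ^ p * \<beta> j))" by (simp only: mult_ac)
    also have "\<dots> \<le> Suc p * ((1 / 2) ^ p * ?e j t)"
      by (intro mult_left_mono k_bound(1)[OF t]) simp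
    finally show ?thesis by (simp only: mult.assoc)
  qed
  have G_sums: "(\<lambda>p. ?k j p t *\<^sub>R u j p) sums ?G j t" if t: "t > 0" for j t
  proof (cases "cell K j t = 0")
    case False
    have "(\<lambda>p. (cell K j t * \<rho> t) *\<^sub>R ((node K j - t) ^ p *\<^sub>R u j p)) sums ((cell K j t * \<rho> t) *\<^sub>R f t)"
      by (rule sums_scaleR_right[OF f[OF t False]])
    then show ?thesis by simp
  qed simp
  have inner: "vint \<mu> (?G j) (\<Sum>p. moment \<mu> K \<rho> j p *\<^sub>R u j p)" for j
  proof (rule vint_sums(3))
    show "vint \<mu> (\<lambda>t. ?k j p t *\<^sub>R u j p) (moment \<mu> K \<rho> j p *\<^sub>R u j p)" for p
      unfolding moment_def by (rule vint_scaleR[OF k_int])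
    show "(\<lambda>p. ?k j p t *\<^sub>R u j p) sums ?G j t" if "t \<in> space \<mu>" for t
      using that G_sums by (simp add: space_OM[OF \<mu>])
    show "(\<lambda>t. ennreal (real (Suc p) * (1 / 2) ^ p * ?e j t)) \<in> borel_measurable \<mu>" for p
      by (intro borel_measurable_OM[OF \<mu>]) measurable
    show "ennreal (norm (?k j p t *\<^sub>R u j p)) \<le> ennreal (real (Suc p) * (1 / 2) ^ p * ?e j t)" if "t \<in> space \<mu>" for p t
      using that by (intro ennreal_leI term_le) (simp add: space_OM[OF \<mu>])
    show "(\<integral>\<^sup>+t. ennreal (real (Suc p) * (1 / 2) ^ p * ?e j t) \<partial>\<mu>) \<le> ennreal (real (Suc p) * (1 / 2) ^ p * M j)" for p
    proof -
      have "(\<integral>\<^sup>+t. ennreal (real (Suc p) * (1 / 2) ^ p * ?e j t) \<partial>\<mu>)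
        = ennreal (\<integral>t. real (Suc p) * (1 / 2) ^ p * ?e j t \<partial>\<mu>)"
        using C by (intro nn_integral_eq_integral integrable_mult_right e_int AE_I2)
          (auto simp: space_OM[OF \<mu>] cell_def)
      then show ?thesis unfolding M_def by (simp only: integral_mult_right_zero order_refl)
    qed
    show "0 \<le> real (Suc p) * (1 / 2) ^ p * M j" for p using M0 by simp
    show "summable (\<lambda>p. real (Suc p) * (1 / 2) ^ p * M j)" by (intro summable_mult2 sums_summable[OF geo])
  qed
  show "vint \<mu> (\<lambda>t. \<rho> t *\<^sub>R f t) (\<Sum>j. \<Sum>p. moment \<mu> K \<rho> j p *\<^sub>R u j p)"
  proof (rule vint_sums(3)[OF inner])
    fix t assume "t \<in> space \<mu>"
    then have t: "t > 0" by (simp add: space_OM[OF \<mu>])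
    \<comment> \<open>Exactly one cell contains \<open>t\<close>, so the series over the cells has a
      single nonzero term.\<close>
    have "(\<lambda>j. if j = nat \<lfloor>2 * K * t\<rfloor> then \<rho> t *\<^sub>R f t else 0) sums (\<rho> t *\<^sub>R f t)"
      by (rule sums_single)
    moreover have "?G j t = (if j = nat \<lfloor>2 * K * t\<rfloor> then \<rho> t *\<^sub>R f t else 0)" for j
      using t K by (simp add: cell_floor)
    ultimately show "(\<lambda>j. ?G j t) sums (\<rho> t *\<^sub>R f t)" by simp
  next
    show "(\<lambda>t. ennreal (4 * ?e j t)) \<in> borel_measurable \<mu>" for j
      by (intro borel_measurable_OM[OF \<mu>]) measurable
    show "ennreal (norm (?G j t)) \<le> ennreal (4 * ?e j t)" if "t \<in> space \<mu>" for j t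
    proof (rule ennreal_leI)
      have t: "t > 0" using that by (simp add: space_OM[OF \<mu>])
      have s: "(\<lambda>p. real (Suc p) * (1 / 2) ^ p * ?e j t) sums (4 * ?e j t)" by (rule sums_mult2[OF geo])
      have "norm (\<Sum>p. ?k j p t *\<^sub>R u j p) \<le> (\<Sum>p. real (Suc p) * (1 / 2) ^ p * ?e j t)"
        by (rule norm_suminf_le[OF term_le[OF t] sums_summable[OF s]])
      then show "norm (?G j t) \<le> 4 * ?e j t"
        unfolding sums_unique[OF G_sums[OF t], symmetric] sums_unique[OF s, symmetric] .
    qed
    show "(\<integral>\<^sup>+t. ennreal (4 * ?e j t) \<partial>\<mu>) \<le> ennreal (4 * M j)" for j
    proof -
      have "(\<integral>\<^sup>+t. ennreal (4 * ?e j t) \<partial>\<mu>) = ennreal (\<integral>t. 4 * ?e j t \<partial>\<mu>)"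
        using C by (intro nn_integral_eq_integral integrable_mult_right e_int AE_I2)
          (auto simp: space_OM[OF \<mu>] cell_def)
      then show ?thesis unfolding M_def by (simp only: integral_mult_right_zero order_refl)
    qed
    show "0 \<le> 4 * M j" for j using M0 by simp
    show "summable (\<lambda>j. 4 * M j)" by (intro summable_mult M_sum)
  qed
qed

lemma of_real_power_scaleC: "(complex_of_real a - complex_of_real b) ^ p *\<^sub>C x = (a - b) ^ p *\<^sub>R x"
  by (simp add: scaleR_scaleC flip: of_real_power of_real_diff)

lemma borel_measurable_OM_continuous:
  fixes f :: "real \<Rightarrow> 'b::topological_space"
  assumes "OM_measure \<mu>" "continuous_on {0<..} f"
  shows "f \<in> borel_measurable \<mu>"
  by (rule measurable_OM[OF assms(1) borel_measurable_continuous_on_restrict[OF assms(2)]])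

lemma bounded_linear_eq_on_dense:
  assumes "bounded_linear S" "bounded_linear T" "closure D = UNIV" "\<And>x. x \<in> D \<Longrightarrow> S x = T x"
  shows "S = T"
proof -
  have "closed {x. S x = T x}"
    by (intro closed_Collect_eq linear_continuous_on assms(1,2))
  then have "closure D \<subseteq> {x. S x = T x}" using assms(4) by (intro closure_minimal) auto
  then show ?thesis using assms(3) by auto
qed

text \<open>Two bounded operators that agree on the dense set \<open>D\<close> coincide; this
  resolves the definite description.\<close>

lemma trace_difference_eq:
  assumes "difference_on D F G T" "closure D = UNIV"
  shows "trace_difference D F G = nuclear_trace T"
proof -
  have "(THE T. difference_on D F G T) = T"
  proof (rule the_equality)
    show "difference_on D F G T" by fact
    fix S assume "difference_on D F G S"
    then show "S = T"
      using assms by (intro bounded_linear_eq_on_dense[where D = D])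
        (auto simp: difference_on_def bounded_clinear_def)
  qed
  then show ?thesis by (simp add: trace_difference_def)
qed

section \<open>The functional calculus of a single operator\<close>

text \<open>Collects what the functional calculus of one operator depends on, to be instantiated for
  \<open>A\<close> and for \<open>B\<close> alike.\<close>

locale resolvent_bound =
  fixes A :: "'a::complex_banach oper" and K :: real
  assumes lin: "linear_oper A" and K: "K \<ge> 1"
    and res: "\<And>t. t \<ge> 0 \<Longrightarrow> is_resolvent A (of_real t) (resolvent (of_real t) A)"
    and bound: "\<And>t x. t \<ge> 0 \<Longrightarrow> norm (resolvent (of_real t) A x) \<le> K / (1 + t) * norm x"
    and cont: "\<And>x. continuous_on {0..} (\<lambda>t. resolvent (of_real t) A x)"
begin

abbreviation R :: "real \<Rightarrow> 'a \<Rightarrow> 'a" where "R t \<equiv> resolvent (of_real t) A"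

lemma R_clinear: "t \<ge> 0 \<Longrightarrow> bounded_clinear (R t)"
  using res by (simp add: is_resolvent_def)

text \<open>In a possibly non-separable space the existence of the integral is the issue; the
  expansion with constant weight 1 exhibits its value as a convergent double series.\<close>

lemma R_integral:
  assumes \<mu>: "OM_measure \<mu>"
  shows "\<exists>J. vint \<mu> (\<lambda>t. R t u) J"
proof -
  \<comment> \<open>The summand 1 in \<open>norm u + 1\<close> keeps \<open>\<beta>\<close> positive
    when \<open>u = 0\<close>.\<close>
  have "vint \<mu> (\<lambda>t. 1 *\<^sub>R R t u) (\<Sum>j. \<Sum>p. moment \<mu> K (\<lambda>t. 1) j p *\<^sub>R (R (node K j) ^^ Suc p) u)"
  proof (rule expansion_integral(1)[OF \<mu> K, where \<beta> = "\<lambda>j. K / (1 + node K j) * (norm u + 1)"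
        and C = "2 * K * (norm u + 1)"])
    fix j and t :: real assume t: "t > 0" and e: "cell K j t \<noteq> 0"
    note n = cell_node[OF K e]
    have "1 / (2 * K) \<le> (1 + node K j) / (2 * K)" using K n(4) by (intro divide_right_mono) auto
    then have d: "\<bar>node K j - t\<bar> \<le> (1 + node K j) / (2 * K)" using n by auto
    have "\<bar>node K j - t\<bar> * (K / (1 + node K j)) \<le> (1 + node K j) / (2 * K) * (K / (1 + node K j))"
      using d K n(4) by (intro mult_right_mono) auto
    also have "\<dots> = 1 / 2" using K n(4) by simp
    finally have z: "cmod (of_real (node K j) - of_real t) * (K / (1 + node K j)) \<le> 1 / 2"
      by (simp flip: of_real_diff)
    have "(\<lambda>p. (complex_of_real (node K j) - of_real t) ^ p *\<^sub>C (R (node K j) ^^ Suc p) u) sums R t u"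
      by (rule neumann_series(2)[OF lin res[OF n(4)] bound[OF n(4)] _ z]) (use K n(4) in simp)
    then show "(\<lambda>p. (node K j - t) ^ p *\<^sub>R (R (node K j) ^^ Suc p) u) sums R t u"
      by (simp only: of_real_power_scaleC)
    have "K / (1 + node K j) * (norm u + 1) * 1 = (K * (norm u + 1)) * (1 / (1 + node K j))" by simp
    also have "\<dots> \<le> (K * (norm u + 1)) * (2 / (1 + t))"
      using K by (intro mult_left_mono n(3)) auto
    finally show "K / (1 + node K j) * (norm u + 1) * 1 \<le> 2 * K * (norm u + 1) / (1 + t)" by (simp add: mult_ac)
  next
    fix j p
    have n: "node K j \<ge> 0" using K by (simp add: node_def)
    define r where "r = K / (1 + node K j)"
    have r: "0 \<le> r" using K n by (simp add: r_def)
    have "norm ((R (node K j) ^^ Suc p) u) \<le> r ^ Suc p * norm u"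
      unfolding r_def by (rule norm_funpow_le[OF bound[OF n]]) (use r r_def in simp)
    also have "\<dots> \<le> 1 * (r ^ Suc p * (norm u + 1))" using r by (simp add: mult_left_mono)
    also have "\<dots> \<le> real (Suc p) * (r ^ Suc p * (norm u + 1))"
      using r by (intro mult_right_mono) auto
    finally show "norm ((R (node K j) ^^ Suc p) u) \<le> real (Suc p) * r ^ p * (r * (norm u + 1))"
      by (simp add: mult_ac)
  next
    show "0 < K / (1 + node K j) * (norm u + 1)" for j
      using K by (simp add: node_def add_pos_nonneg add_nonneg_pos)
  qed auto
  then show ?thesis by auto
qed

text \<open>The bounded operator for which \<open>oper_fun \<phi> A\<close> acts on
  \<open>Domain A\<close> as \<open>J \<mu>\<close> after \<open>A\<close>, with
  \<open>\<mu>\<close> the representing measure.\<close>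

definition J :: "real measure \<Rightarrow> 'a \<Rightarrow> 'a" where
  "J \<mu> u = (SOME I. vint \<mu> (\<lambda>t. R t u) I)"

lemma J_vint: "OM_measure \<mu> \<Longrightarrow> vint \<mu> (\<lambda>t. R t u) (J \<mu> u)"
  unfolding J_def by (rule someI_ex) (rule R_integral)

lemma J_bounded_linear:
  assumes \<mu>: "OM_measure \<mu>"
  shows "bounded_linear (J \<mu>)"
proof -
  have lin: "bounded_linear (R t)" if "t \<in> space \<mu>" for t
    using R_clinear[of t] that by (simp add: space_OM[OF \<mu>] bounded_clinear_def)
  show ?thesis
  proof (rule bounded_linear_intro)
    fix x y
    have "vint \<mu> (\<lambda>t. R t (x + y)) (J \<mu> x + J \<mu> y)"
      using vint_add[OF J_vint[OF \<mu>] J_vint[OF \<mu>], of x y] lin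
      by (subst vint_cong) (auto simp: bounded_linear.linear linear_add)
    then show "J \<mu> (x + y) = J \<mu> x + J \<mu> y" using vint_unique J_vint[OF \<mu>] by blast
  next
    fix r x
    have "vint \<mu> (\<lambda>t. R t (r *\<^sub>R x)) (r *\<^sub>R J \<mu> x)"
      using vint_linear[OF bounded_linear_scaleR_right J_vint[OF \<mu>], of r x] lin
      by (subst vint_cong) (auto simp: bounded_linear.linear linear_scale)
    then show "J \<mu> (r *\<^sub>R x) = r *\<^sub>R J \<mu> x" using vint_unique J_vint[OF \<mu>] by blast
  next
    fix x :: 'a
    have int: "integrable \<mu> (\<lambda>t. K / (1 + t) * norm x)"
      by (rule integrable_OM[OF \<mu>, where C = "K * norm x"])
         (use K in \<open>auto intro!: borel_measurable_OM[OF \<mu>]\<close>)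
    have "ennreal (norm (J \<mu> x)) \<le> (\<integral>\<^sup>+t. ennreal (K / (1 + t) * norm x) \<partial>\<mu>)"
      by (rule vint_norm_bound[OF J_vint[OF \<mu>]])
         (use bound in \<open>auto simp: space_OM[OF \<mu>] intro!: borel_measurable_OM[OF \<mu>] ennreal_leI\<close>)
    also have "\<dots> = ennreal (\<integral>t. K / (1 + t) * norm x \<partial>\<mu>)"
      using K by (intro nn_integral_eq_integral int AE_I2) (auto simp: space_OM[OF \<mu>])
    also have "(\<integral>t. K / (1 + t) * norm x \<partial>\<mu>) = norm x * (\<integral>t. K / (1 + t) \<partial>\<mu>)"
      unfolding mult.commute[of _ "norm x"] by (rule integral_mult_right_zero)
    finally show "norm (J \<mu> x) \<le> norm x * (\<integral>t. K / (1 + t) \<partial>\<mu>)"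
      using K by (subst (asm) ennreal_le_iff)
        (auto intro!: mult_nonneg_nonneg integral_nonneg_AE AE_I2 simp: space_OM[OF \<mu>])
  qed
qed

lemma R_app:
  assumes "x \<in> Domain A" "t \<ge> 0"
  shows "app A (R t x) = R t (app A x)" "app A (R t x) = t *\<^sub>R R t x - x"
proof -
  have "(R t x, of_real t *\<^sub>C R t x - x) \<in> A" using res[OF assms(2)] by (simp add: is_resolvent_def)
  then show 1: "app A (R t x) = t *\<^sub>R R t x - x"
    using linear_oper_app_eq[OF lin] by (simp add: scaleR_scaleC)
  have "R t (of_real t *\<^sub>C x - app A x) = x"
    using res[OF assms(2)] app_in[OF lin assms(1)] by (simp add: is_resolvent_def)
  then have "t *\<^sub>R R t x - R t (app A x) = x"
    using R_clinear[OF assms(2)]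
    by (simp add: bounded_clinear_def bounded_linear.linear linear_diff scaleR_scaleC)
  then show "app A (R t x) = R t (app A x)" using 1 by (simp add: algebra_simps)
qed

text \<open>Applying the resolvent at \<open>0\<close> shows that the operator whose closure is \<open>oper_fun \<phi> A\<close> is
  closable.\<close>

lemma oper_fun_value:
  assumes \<phi>: "\<phi> \<in> OM_minus" and x: "x \<in> Domain A"
  shows "(x, y) \<in> oper_fun \<phi> A \<longleftrightarrow> y = J (repr_measure \<phi>) (app A x)"
proof -
  define \<mu> where "\<mu> = repr_measure \<phi>"
  have \<mu>: "OM_measure \<mu>" using represents_repr_measure[OF \<phi>] by (simp add: represents_def \<mu>_def)
  let ?G = "{(x, y). x \<in> Domain A \<and> has_vector_integral \<mu> (\<lambda>t. app A (R t x)) y}"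
  have G_iff: "has_vector_integral \<mu> (\<lambda>t. app A (R t x)) y \<longleftrightarrow> y = J \<mu> (app A x)"
    if x: "x \<in> Domain A" for x y
  proof -
    have eq: "app A (R t x) = R t (app A x)" if "t \<in> space \<mu>" for t
      using R_app[OF x, of t] that by (simp add: space_OM[OF \<mu>])
    have "(\<lambda>t. R t (app A x)) \<in> borel_measurable \<mu>"
      by (rule borel_measurable_OM_continuous[OF \<mu> continuous_on_subset[OF cont]]) auto
    then have "(\<lambda>t. app A (R t x)) \<in> borel_measurable \<mu>"
      by (subst measurable_cong[where g = "\<lambda>t. R t (app A x)"]) (use eq in auto)
    moreover have "vint \<mu> (\<lambda>t. app A (R t x)) y \<longleftrightarrow> vint \<mu> (\<lambda>t. R t (app A x)) y"
      by (rule vint_cong[OF eq])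
    ultimately show ?thesis
      unfolding has_vector_integral_iff_vint using J_vint[OF \<mu>] vint_unique by blast
  qed
  have R0: "bounded_linear (R 0)" using R_clinear[of 0] by (simp add: bounded_clinear_def)
  have J: "bounded_linear (J \<mu>)" by (rule J_bounded_linear[OF \<mu>])
  \<comment> \<open>The resolvent at 0 is the inverse of \<open>- A\<close>, so it maps
    \<open>A (R t x)\<close> to \<open>- R t x\<close>. The graph therefore lies in a set defined by
    an equation between continuous maps, which the closure cannot leave.\<close>
  have "?G \<subseteq> {p. R 0 (snd p) = - J \<mu> (fst p)}"
  proof (clarsimp simp del: of_real_0)
    fix x y z assume "(x, z) \<in> A" and hv: "has_vector_integral \<mu> (\<lambda>t. app A (R t x)) y"
    then have x: "x \<in> Domain A" by auto
    have "vint \<mu> (\<lambda>t. R 0 (app A (R t x))) (R 0 y)"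
      using hv by (intro vint_linear[OF R0]) (simp add: has_vector_integral_iff_vint)
    moreover have "R 0 (app A (R t x)) = - R t x" if "t \<in> space \<mu>" for t
    proof -
      have t: "t \<ge> 0" using that by (simp add: space_OM[OF \<mu>])
      have "R 0 x - R t x = (of_real t - of_real 0) *\<^sub>C R 0 (R t x)"
        by (rule resolvent_identity[OF res res]) (use t in auto)
      also have "\<dots> = R 0 (t *\<^sub>R R t x)" using R0 by (simp add: scaleR_scaleC bounded_linear.linear linear_scale flip: scaleR_scaleC)
      finally have "R 0 (t *\<^sub>R R t x) - R 0 x = - R t x" by (simp add: algebra_simps)
      moreover have "R 0 (t *\<^sub>R R t x - x) = R 0 (t *\<^sub>R R t x) - R 0 x"
        using R0 by (simp only: bounded_linear.linear linear_diff)
      ultimately show ?thesis using R_app(2)[OF x t] by simp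
    qed
    ultimately have "vint \<mu> (\<lambda>t. - R t x) (R 0 y)" using vint_cong by (metis (no_types, lifting))
    moreover have "vint \<mu> (\<lambda>t. - R t x) (- J \<mu> x)"
      by (rule vint_linear[OF bounded_linear_minus[OF bounded_linear_ident] J_vint[OF \<mu>]])
    ultimately show "R 0 y = - J \<mu> x" by (rule vint_unique)
  qed
  moreover have "closed {p. R 0 (snd p) = - J \<mu> (fst p)}"
    by (intro closed_Collect_eq continuous_on_minus bounded_linear.continuous_on[OF R0]
        bounded_linear.continuous_on[OF J] continuous_intros)
  ultimately have clos: "closure ?G \<subseteq> {p. R 0 (snd p) = - J \<mu> (fst p)}" by (rule closure_minimal)
  have mem: "(x, J \<mu> (app A x)) \<in> closure ?G"
    using x G_iff[OF x] by (intro subsetD[OF closure_subset]) auto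
  show ?thesis
  proof
    assume "(x, y) \<in> oper_fun \<phi> A"
    then have "(x, y) \<in> closure ?G" by (simp add: oper_fun_def \<mu>_def)
    then have "R 0 y = - J \<mu> x" using clos by auto
    moreover have "R 0 (J \<mu> (app A x)) = - J \<mu> x" using mem clos by auto
    ultimately have eq: "R 0 y = R 0 (J \<mu> (app A x))" by simp
    \<comment> \<open>This gives injectivity of \<open>R 0\<close>, so the closed relation
      determines \<open>y\<close>.\<close>
    have r0: "app A (R 0 w) = - w" for w
      using res[of 0] linear_oper_app_eq[OF lin] by (simp add: is_resolvent_def)
    have "- y = - J \<mu> (app A x)" unfolding r0[symmetric] eq ..
    then show "y = J (repr_measure \<phi>) (app A x)" by (simp add: \<mu>_def)
  next
    assume "y = J (repr_measure \<phi>) (app A x)"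
    then show "(x, y) \<in> oper_fun \<phi> A" using mem by (simp add: oper_fun_def \<mu>_def)
  qed
qed

text \<open>\<open>A (R t x)\<close> equals \<open>t *\<^sub>R R t x - x\<close>; in this form the
  isolated \<open>x\<close> cancels when the integrals for the two operators are subtracted.\<close>

lemma oper_fun_app:
  assumes "\<phi> \<in> OM_minus" "x \<in> Domain A"
  shows "x \<in> Domain (oper_fun \<phi> A)" "app (oper_fun \<phi> A) x = J (repr_measure \<phi>) (app A x)"
    "vint (repr_measure \<phi>) (\<lambda>t. t *\<^sub>R R t x - x) (app (oper_fun \<phi> A) x)"
    "x \<in> Domain (scalar_minus z (oper_fun \<phi> A))"
    "app (scalar_minus z (oper_fun \<phi> A)) x = z *\<^sub>C x - app (oper_fun \<phi> A) x"
proof -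
  note iff = oper_fun_value[OF assms]
  then show "x \<in> Domain (oper_fun \<phi> A)" by blast
  show 1: "app (oper_fun \<phi> A) x = J (repr_measure \<phi>) (app A x)"
    unfolding app_def iff by simp
  have \<mu>: "OM_measure (repr_measure \<phi>)" using represents_repr_measure[OF assms(1)] by (simp add: represents_def)
  show "vint (repr_measure \<phi>) (\<lambda>t. t *\<^sub>R R t x - x) (app (oper_fun \<phi> A) x)"
    unfolding 1 using J_vint[OF \<mu>, of "app A x"] R_app[OF assms(2)]
    by (subst vint_cong[where g = "\<lambda>t. R t (app A x)"]) (auto simp: space_OM[OF \<mu>])
  have iff2: "(x, w) \<in> scalar_minus z (oper_fun \<phi> A) \<longleftrightarrow> w = z *\<^sub>C x - app (oper_fun \<phi> A) x" for w
    unfolding scalar_minus_def using iff 1 by auto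
  then show "x \<in> Domain (scalar_minus z (oper_fun \<phi> A))" by blast
  show "app (scalar_minus z (oper_fun \<phi> A)) x = z *\<^sub>C x - app (oper_fun \<phi> A) x"
    unfolding app_def[of "scalar_minus z (oper_fun \<phi> A)"] iff2 by simp
qed

end

context neg_pair
begin

sublocale A: resolvent_bound A K
  by unfold_locales (use linA K resA boundA resolvent_continuous in auto)

sublocale B: resolvent_bound B K
  by unfold_locales (use linB K resB boundB resolvent_continuous in auto)

lemma node_distance:
  assumes "cell K j t \<noteq> 0"
  shows "0 \<le> node K j" "cmod (of_real (node K j) - of_real t) \<le> (1 + node K j) / (2 * K)"
proof -
  note n = cell_node[OF K assms]
  show "0 \<le> node K j" by (rule n)
  have "1 / (2 * K) \<le> (1 + node K j) / (2 * K)" using K n(4) by (intro divide_right_mono) auto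
  then have "\<bar>node K j - t\<bar> \<le> (1 + node K j) / (2 * K)" using n by auto
  then show "cmod (of_real (node K j) - of_real t) \<le> (1 + node K j) / (2 * K)" by (simp flip: of_real_diff)
qed

text \<open>The nuclear bound decays like the inverse square of \<open>1 + t\<close>. The factor
  \<open>t\<close> uses up one of these powers, and the other is what the measure can integrate; the
  4 is the square of the factor 2 lost between \<open>t\<close> and its node.\<close>

lemma weight_bound:
  assumes "t > 0" "cell K j t \<noteq> 0" "0 \<le> d"
  shows "(K / (1 + node K j))\<^sup>2 * d * t \<le> 4 * K\<^sup>2 * d / (1 + t)"
proof -
  note n = cell_node[OF K assms(2)]
  have "(K / (1 + node K j))\<^sup>2 * d * t = K\<^sup>2 * d * t * (1 / (1 + node K j))\<^sup>2"
    by (simp add: power_divide)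
  also have "\<dots> \<le> K\<^sup>2 * d * t * (2 / (1 + t))\<^sup>2"
    using n assms by (intro mult_left_mono power_mono) auto
  also have "\<dots> = 4 * K\<^sup>2 * d * (t / (1 + t)\<^sup>2)" by (simp add: power_divide)
  also have "\<dots> \<le> 4 * K\<^sup>2 * d * (1 / (1 + t))"
  proof (intro mult_left_mono)
    show "t / (1 + t)\<^sup>2 \<le> 1 / (1 + t)" using assms(1) by (simp add: power2_eq_square divide_simps)
  qed (use assms in auto)
  finally show ?thesis by simp
qed

text \<open>\<open>T\<close> and \<open>c\<close> are one and the same double series, formed with
  the operators \<open>W\<close> and with their traces respectively; two applications of
  \<open>nuc_suminf\<close> show that \<open>c\<close> is the trace of \<open>T\<close>. Reading
  both series back as integrals interchanges trace and integral.\<close>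

lemma trace_integral:
  assumes \<mu>: "OM_measure \<mu>"
  shows "\<exists>T w. nuc T w (\<integral>t. of_real t * h (of_real t) \<partial>\<mu>) \<and> (\<forall>x. vint \<mu> (\<lambda>t. t *\<^sub>R D (of_real t) x) (T x))"
proof -
  let ?m = "moment \<mu> K (\<lambda>t. t)"
  let ?r = "\<lambda>j. K / (1 + node K j)"
  have node0: "0 \<le> node K j" for j using K by (simp add: node_def)
  have r0: "0 < ?r j" for j using K node0[of j] by simp
  have nucW: "nuc (W (node K j) p) (Suc p * ?r j ^ p * ((?r j)\<^sup>2 * v)) (nuclear_trace (W (node K j) p))" for j p
    using nuc_W[OF node0, of j p] by (simp only: power_add mult_ac)
  define T where "T x = (\<Sum>j. \<Sum>p. ?m j p *\<^sub>R W (node K j) p x)" for x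
  define c where "c = (\<Sum>j. \<Sum>p. ?m j p *\<^sub>R nuclear_trace (W (node K j) p))"
  \<comment> \<open>Here \<open>v * norm x + 1\<close> bounds the vectors
    \<open>W (node K j) p x\<close> up to the common factors; the summand 1 provides strict
    positivity.\<close>
  have vT: "vint \<mu> (\<lambda>t. t *\<^sub>R D (of_real t) x) (T x)" for x
    unfolding T_def
  proof (rule expansion_integral(1)[OF \<mu> K, where \<beta> = "\<lambda>j. (?r j)\<^sup>2 * (v * norm x + 1)"
        and C = "4 * K\<^sup>2 * (v * norm x + 1)"])
    fix j and t :: real assume t: "t > 0" and e: "cell K j t \<noteq> 0"
    show "(\<lambda>p. (node K j - t) ^ p *\<^sub>R W (node K j) p x) sums D (of_real t) x"
      using expansion_D(1)[OF node_distance[OF e], of x] by (simp only: of_real_power_scaleC)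
    show "(?r j)\<^sup>2 * (v * norm x + 1) * t \<le> 4 * K\<^sup>2 * (v * norm x + 1) / (1 + t)"
      using v_nonneg by (intro weight_bound[OF t e]) auto
  next
    fix j p
    have "norm (W (node K j) p x) \<le> Suc p * ?r j ^ p * ((?r j)\<^sup>2 * v) * norm x"
      by (rule nuc_norm(1)[OF nucW])
    also have "\<dots> = (Suc p * ?r j ^ p * (?r j)\<^sup>2) * (v * norm x)" by (simp only: mult_ac)
    also have "\<dots> \<le> (Suc p * ?r j ^ p * (?r j)\<^sup>2) * (v * norm x + 1)"
      using r0[of j] by (intro mult_left_mono) auto
    finally show "norm (W (node K j) p x) \<le> real (Suc p) * ?r j ^ p * ((?r j)\<^sup>2 * (v * norm x + 1))"
      by (simp only: mult_ac)
  next
    show "0 < (?r j)\<^sup>2 * (v * norm x + 1)" for j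
      using r0[of j] v_nonneg by (intro mult_pos_pos zero_less_power add_nonneg_pos) auto
  qed auto
  \<comment> \<open>Second use of the expansion, now for the complex numbers
    \<open>nuclear_trace (W (node K j) p)\<close>; the moments are those of the first use.\<close>
  note E = expansion_integral[OF \<mu> K, where \<beta> = "\<lambda>j. (?r j)\<^sup>2 * (v + 1)" and C = "4 * K\<^sup>2 * (v + 1)"
      and \<rho> = "\<lambda>t. t" and f = "\<lambda>t. h (of_real t)" and u = "\<lambda>j p. nuclear_trace (W (node K j) p)"]
  have hyp: "(\<lambda>p. (node K j - t) ^ p *\<^sub>R nuclear_trace (W (node K j) p)) sums h (of_real t)"
    "(?r j)\<^sup>2 * (v + 1) * t \<le> 4 * K\<^sup>2 * (v + 1) / (1 + t)"
    if t: "t > 0" and e: "cell K j t \<noteq> 0" for j t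
  proof -
    show "(\<lambda>p. (node K j - t) ^ p *\<^sub>R nuclear_trace (W (node K j) p)) sums h (of_real t)"
      using expansion_D(2)[OF node_distance[OF e]]
      by (simp only: scaleC_complex_def[symmetric] of_real_power_scaleC)
    show "(?r j)\<^sup>2 * (v + 1) * t \<le> 4 * K\<^sup>2 * (v + 1) / (1 + t)"
      using v_nonneg by (intro weight_bound[OF t e]) auto
  qed
  have hyp2: "norm (nuclear_trace (W (node K j) p)) \<le> real (Suc p) * ?r j ^ p * ((?r j)\<^sup>2 * (v + 1))"
    and hyp3: "0 < (?r j)\<^sup>2 * (v + 1)" for j p
  proof -
    have "norm (nuclear_trace (W (node K j) p)) \<le> Suc p * ?r j ^ p * ((?r j)\<^sup>2 * v)"
      by (rule nuc_norm(2)[OF nucW])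
    also have "\<dots> \<le> Suc p * ?r j ^ p * ((?r j)\<^sup>2 * (v + 1))"
      using r0[of j] by (intro mult_left_mono) auto
    finally show "norm (nuclear_trace (W (node K j) p)) \<le> real (Suc p) * ?r j ^ p * ((?r j)\<^sup>2 * (v + 1))" .
    show "0 < (?r j)\<^sup>2 * (v + 1)" using r0[of j] v_nonneg by (intro mult_pos_pos) auto
  qed
  have vc: "vint \<mu> (\<lambda>t. t *\<^sub>R h (of_real t)) c"
    unfolding c_def by (rule E(1)) (use hyp hyp2 hyp3 in auto)
  have "\<exists>M. summable M \<and> (\<forall>j. 0 \<le> M j) \<and>
      (\<forall>j p. \<bar>?m j p\<bar> * (Suc p * ?r j ^ p * ((?r j)\<^sup>2 * (v + 1))) \<le> Suc p * (1 / 2) ^ p * M j)"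
    by (rule E(2)) (use hyp hyp2 hyp3 in auto)
  then obtain M where M: "summable M"
    "\<And>j p. \<bar>?m j p\<bar> * (Suc p * ?r j ^ p * ((?r j)\<^sup>2 * (v + 1))) \<le> Suc p * (1 / 2) ^ p * M j" by blast
  have geo: "(\<lambda>p. real (Suc p) * (1 / 2) ^ p * M j) sums (4 * M j)" for j
    using sums_mult2[OF geometric_deriv_sums[of "1 / 2 :: real"], of "M j"] by (simp add: power2_eq_square)
  have nuc1: "nuc (\<lambda>x. ?m j p *\<^sub>R W (node K j) p x) (real (Suc p) * (1 / 2) ^ p * M j)
      (?m j p *\<^sub>R nuclear_trace (W (node K j) p))" for j p
  proof (rule nuc_mono)
    show "nuc (\<lambda>x. ?m j p *\<^sub>R W (node K j) p x) (\<bar>?m j p\<bar> * (Suc p * ?r j ^ p * ((?r j)\<^sup>2 * v)))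
      (?m j p *\<^sub>R nuclear_trace (W (node K j) p))"
      using nuc_scaleC[OF nucW, of "of_real (?m j p)" j p]
      by (simp only: scaleR_scaleC[symmetric] norm_of_real scaleR_conv_of_real)
    have "\<bar>?m j p\<bar> * (Suc p * ?r j ^ p * ((?r j)\<^sup>2 * v)) \<le> \<bar>?m j p\<bar> * (Suc p * ?r j ^ p * ((?r j)\<^sup>2 * (v + 1)))"
      using r0[of j] by (intro mult_left_mono) auto
    also note M(2)
    finally show "\<bar>?m j p\<bar> * (Suc p * ?r j ^ p * ((?r j)\<^sup>2 * v)) \<le> Suc p * (1 / 2) ^ p * M j" .
  qed
  have nuc2: "nuc (\<lambda>x. \<Sum>p. ?m j p *\<^sub>R W (node K j) p x) (4 * M j)
      (\<Sum>p. ?m j p *\<^sub>R nuclear_trace (W (node K j) p))" for j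
  proof -
    have "nuc (\<lambda>x. \<Sum>p. ?m j p *\<^sub>R W (node K j) p x) (\<Sum>p. real (Suc p) * (1 / 2) ^ p * M j)
      (\<Sum>p. ?m j p *\<^sub>R nuclear_trace (W (node K j) p))"
      by (rule nuc_suminf(3)[OF nuc1 sums_summable[OF geo]])
    then show ?thesis unfolding sums_unique[OF geo, symmetric] .
  qed
  have "nuc T (\<Sum>j. 4 * M j) c"
    unfolding T_def[abs_def] c_def by (rule nuc_suminf(3)[OF nuc2 summable_mult[OF M(1)]])
  moreover have "c = (\<integral>t. of_real t * h (of_real t) \<partial>\<mu>)"
  proof -
    have "integrable \<mu> (\<lambda>t. t *\<^sub>R h (of_real t))"
    proof (rule integrable_OM[OF \<mu>, where C = "4 * K\<^sup>2 * v"])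
      have "complex_of_real t \<in> (\<Union>t\<in>{0..}. ball (complex_of_real t) ((1 + t) / (2 * K)))" if "t > 0" for t
        using that K by (intro UN_I[of t]) auto
      then have "continuous_on {0<..} (\<lambda>t. h (of_real t))"
        by (intro continuous_on_compose2[OF holomorphic_on_imp_continuous_on[OF h_holomorphic]
              continuous_on_of_real[OF continuous_on_id]]) auto
      then have "continuous_on {0<..} (\<lambda>t. t *\<^sub>R h (of_real t))"
        by (intro continuous_on_scaleR continuous_on_id)
      then show "(\<lambda>t. t *\<^sub>R h (of_real t)) \<in> borel_measurable \<mu>"
        by (rule borel_measurable_OM_continuous[OF \<mu>])
      fix t :: real assume t: "t > 0"
      have "cmod (h (of_real t)) \<le> 4 * K\<^sup>2 * v / (1 + t)\<^sup>2"
        by (rule expansion_D(3)) (use t K in auto)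
      then have "norm (t *\<^sub>R h (of_real t)) \<le> t * (4 * K\<^sup>2 * v / (1 + t)\<^sup>2)"
        unfolding norm_scaleR using t by (intro mult_mono) auto
      also have "\<dots> = 4 * K\<^sup>2 * v * (t / (1 + t)\<^sup>2)" by simp
      also have "\<dots> \<le> 4 * K\<^sup>2 * v * (1 / (1 + t))"
      proof (intro mult_left_mono)
        show "t / (1 + t)\<^sup>2 \<le> 1 / (1 + t)" using t by (simp add: power2_eq_square divide_simps)
      qed (use v_nonneg in auto)
      finally show "norm (t *\<^sub>R h (of_real t)) \<le> 4 * K\<^sup>2 * v / (1 + t)" by simp
    qed
    from vint_unique[OF vc vint_integrable[OF this]] show ?thesis
      by (simp add: scaleR_conv_of_real)
  qed
  ultimately show ?thesis using vT by blast
qed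

lemma trace_oper_fun:
  assumes \<phi>: "\<phi> \<in> OM_minus"
  shows "\<exists>T w. nuc T w (\<integral>t. of_real t * h (of_real t) \<partial>repr_measure \<phi>) \<and>
    difference_on (Domain A) (oper_fun \<phi> A) (oper_fun \<phi> B) T"
proof -
  have \<mu>: "OM_measure (repr_measure \<phi>)" using represents_repr_measure[OF \<phi>] by (simp add: represents_def)
  obtain T w where T: "nuc T w (\<integral>t. of_real t * h (of_real t) \<partial>repr_measure \<phi>)"
    "\<And>x. vint (repr_measure \<phi>) (\<lambda>t. t *\<^sub>R D (of_real t) x) (T x)"
    using trace_integral[OF \<mu>] by blast
  have sub: "Domain A \<subseteq> Domain B" using diff by (auto simp: difference_on_def)
  have "T x = app (oper_fun \<phi> A) x - app (oper_fun \<phi> B) x" if x: "x \<in> Domain A" for x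
  proof (rule vint_unique[OF T(2)])
    have "vint (repr_measure \<phi>) (\<lambda>t. (t *\<^sub>R A.R t x - x) - (t *\<^sub>R B.R t x - x))
      (app (oper_fun \<phi> A) x - app (oper_fun \<phi> B) x)"
      using x sub by (intro vint_diff A.oper_fun_app(3) B.oper_fun_app(3) \<phi>) auto
    then show "vint (repr_measure \<phi>) (\<lambda>t. t *\<^sub>R D (of_real t) x) (app (oper_fun \<phi> A) x - app (oper_fun \<phi> B) x)"
      by (simp add: D_def scaleR_diff_right)
  qed
  then have "difference_on (Domain A) (oper_fun \<phi> A) (oper_fun \<phi> B) T"
    unfolding difference_on_def
    using nuc_bounded_clinear[OF T(1)] A.oper_fun_app(1)[OF \<phi>] B.oper_fun_app(1)[OF \<phi>] sub by blast
  then show ?thesis using T(1) by blast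
qed

text \<open>In the difference of the logarithms the scalar \<open>ln l\<close> cancels, and
  \<open>psi l\<close> enters with the opposite sign.\<close>

lemma spectral_shift_eq:
  assumes l: "l > 0"
  shows "spectral_shift A B l = - (\<integral>t. of_real t * h (of_real t) \<partial>repr_measure (psi l))"
proof -
  obtain T w where T: "nuc T w (\<integral>t. of_real t * h (of_real t) \<partial>repr_measure (psi l))"
    "difference_on (Domain A) (oper_fun (psi l) A) (oper_fun (psi l) B) T"
    using trace_oper_fun[OF psi_OM[OF l]] by blast
  have sub: "Domain A \<subseteq> Domain B" using diff by (auto simp: difference_on_def)
  let ?S = "\<lambda>x. (-1) *\<^sub>C T x"
  have S: "nuc ?S (cmod (-1) * w) (-1 * (\<integral>t. of_real t * h (of_real t) \<partial>repr_measure (psi l)))"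
    by (rule nuc_scaleC[OF T(1)])
  have "difference_on (Domain A) (log_oper l A) (log_oper l B) ?S"
    unfolding difference_on_def log_oper_def
  proof (intro conjI subsetI ballI nuc_bounded_clinear[OF S])
    fix x assume x: "x \<in> Domain A"
    then have x': "x \<in> Domain B" using sub by blast
    note a = A.oper_fun_app[OF psi_OM[OF l] x] and b = B.oper_fun_app[OF psi_OM[OF l] x']
    show "x \<in> Domain (scalar_minus (of_real (ln l)) (oper_fun (psi l) A))" by (rule a)
    show "x \<in> Domain (scalar_minus (of_real (ln l)) (oper_fun (psi l) B))" by (rule b)
    have "T x = app (oper_fun (psi l) A) x - app (oper_fun (psi l) B) x"
      using T(2) x by (simp add: difference_on_def)
    then show "?S x = app (scalar_minus (of_real (ln l)) (oper_fun (psi l) A)) x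
      - app (scalar_minus (of_real (ln l)) (oper_fun (psi l) B)) x"
      unfolding a(5) b(5) by simp
  qed
  then have "spectral_shift A B l = nuclear_trace ?S"
    unfolding spectral_shift_def by (rule trace_difference_eq[OF _ dense])
  then show ?thesis using nuc_trace[OF AP S] by simp
qed

end

section \<open>The trace formula\<close>

lemma Re_eq_cmod_cos_Arg: "z \<noteq> 0 \<Longrightarrow> Re z = cmod z * cos (Arg z)"
  using rcis_cmod_Arg[of z] by (metis Re_rcis)

text \<open>\<open>Arg\<close> is discontinuous, whereas \<open>Re z\<close> and
  \<open>cmod z\<close> are continuous. The inequality form makes the sectors visibly open or
  closed.\<close>

lemma sector_iff:
  assumes "z \<noteq> 0" "0 \<le> \<theta>" "\<theta> \<le> pi"
  shows "\<bar>Arg z\<bar> < \<theta> \<longleftrightarrow> cmod z * cos \<theta> < Re z" "\<bar>Arg z\<bar> \<le> \<theta> \<longleftrightarrow> cmod z * cos \<theta> \<le> Re z"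
proof -
  have A: "0 \<le> \<bar>Arg z\<bar>" "\<bar>Arg z\<bar> \<le> pi" using mpi_less_Arg[of z] Arg_le_pi[of z] by auto
  have c: "cos \<bar>Arg z\<bar> = cos (Arg z)" by (simp add: abs_if)
  have lt: "\<bar>Arg z\<bar> < \<theta> \<longleftrightarrow> cos \<theta> < cos (Arg z)"
    using cos_mono_less_eq[of \<theta> "\<bar>Arg z\<bar>"] A assms(2,3) c by simp
  have le: "\<bar>Arg z\<bar> \<le> \<theta> \<longleftrightarrow> cos \<theta> \<le> cos (Arg z)"
    using cos_mono_le_eq[of \<theta> "\<bar>Arg z\<bar>"] A assms(2,3) c by simp
  show "\<bar>Arg z\<bar> < \<theta> \<longleftrightarrow> cmod z * cos \<theta> < Re z" "\<bar>Arg z\<bar> \<le> \<theta> \<longleftrightarrow> cmod z * cos \<theta> \<le> Re z"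
    using assms(1) unfolding lt le Re_eq_cmod_cos_Arg[OF assms(1)] by simp_all
qed

text \<open>The sector with its bounding rays together with the closed disc is a closed set; the
  rays have angle at most \<open>c\<close>, and the disc fits into the one centred at 0.\<close>

lemma closure_Omega_subset:
  assumes "0 < \<theta>" "\<theta> \<le> pi" "0 < \<delta>" "\<theta> \<le> c" "\<delta> < c"
  shows "closure (Omega \<theta> \<delta>) \<subseteq> sector_nbhd c"
proof -
  let ?S = "{z. cmod z * cos \<theta> \<le> Re z} \<union> cball 0 \<delta>"
  have "closed ?S" by (intro closed_Un closed_Collect_le closed_cball continuous_intros)
  moreover have "Omega \<theta> \<delta> \<subseteq> ?S"
    using sector_iff(1)[of _ \<theta>] assms by (auto simp: Omega_def less_imp_le)
  ultimately have "closure (Omega \<theta> \<delta>) \<subseteq> ?S" by (rule closure_minimal[rotated])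
  moreover have "z \<in> sector_nbhd c" if z: "cmod z * cos \<theta> \<le> Re z" "z \<noteq> 0" for z
  proof -
    have "\<bar>Arg z\<bar> \<le> \<theta>" using sector_iff(2)[OF z(2)] z(1) assms by simp
    then have "of_real (cmod z) * cis (Arg z) \<in> sector_nbhd c"
      using assms by (intro ray_in_sector_nbhd) auto
    then show ?thesis using rcis_cmod_Arg[of z] by (simp add: rcis_def)
  qed
  moreover have "cball 0 \<delta> \<subseteq> sector_nbhd c" using assms by (intro cball_subset_sector_nbhd)
  moreover from this have "0 \<in> sector_nbhd c" using assms by auto
  ultimately show ?thesis by blast
qed

text \<open>The last conclusion, which expresses the shift by \<open>h\<close>, is exported because
  the converse evaluates it for scalars.\<close>

lemma (in neg_pair) LK_formula_exists:
  obtains \<theta> \<delta> \<Xi> where "0 < \<theta>" "\<theta> < pi / 2" "0 < \<delta>" "shift_continuation A B \<theta> \<delta> \<Xi>"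
    "\<And>\<phi>. \<phi> \<in> OM_minus \<Longrightarrow> growth_condition \<phi> \<Longrightarrow> LK_formula A B \<theta> \<delta> \<Xi> \<phi>"
    "\<And>l. l > 0 \<Longrightarrow> spectral_shift A B l = - (LINT t:{l..}|lborel. h (of_real t))"
proof -
  define c where "c = 1 / (2 * K)"
  have c: "0 < c" "c \<le> 1 / 2" using K by (auto simp: c_def)
  have nb: "sector_nbhd c = (\<Union>t\<in>{0..}. ball (of_real t) ((1 + t) / (2 * K)))"
    by (simp add: sector_nbhd_def c_def)
  have bnd: "cmod (h z) \<le> 4 * K\<^sup>2 * v / (1 + t)\<^sup>2" if "t \<ge> 0" "cmod (of_real t - z) < c * (1 + t)" for z t
    using that by (intro expansion_D(3)) (auto simp: c_def)
  obtain \<Xi> C where \<Xi>: "\<And>z. z \<in> sector_nbhd c \<Longrightarrow> (\<Xi> has_field_derivative h z) (at z)"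
    "\<And>z. z \<in> sector_nbhd c \<Longrightarrow> cmod (\<Xi> z) \<le> C / (1 + cmod z)"
    "\<And>l. l \<ge> 0 \<Longrightarrow> set_integrable lborel {l..} (\<lambda>t. h (of_real t))"
    "\<And>l. l \<ge> 0 \<Longrightarrow> \<Xi> (of_real l) = - (LINT t:{l..}|lborel. h (of_real t))"
    using primitive_vanishing_at_infinity[OF c(1) h_holomorphic[folded nb] bnd] by metis
  \<comment> \<open>One number serves as angle and as radius; taking half of \<open>c\<close> leaves
    room for a neighbourhood of the closure.\<close>
  define \<theta> where "\<theta> = c / 2"
  have th: "0 < \<theta>" "\<theta> < pi / 2" "\<theta> \<le> c" "\<theta> < c" using c pi_gt3 by (auto simp: \<theta>_def)
  interpret keyhole \<theta> \<theta> by unfold_locales (use th in auto)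
  have Gamma: "Gamma_integrable \<theta> \<theta> (\<lambda>z. \<Xi> z * deriv \<phi> z)"
    "Gamma_integral \<theta> \<theta> (\<lambda>z. \<Xi> z * deriv \<phi> z) = 2 * pi * \<i> * (\<integral>t. of_real t * h (of_real t) \<partial>\<mu>)"
    if "represents \<mu> \<phi>" "growth_condition \<phi>" for \<mu> \<phi>
    by (rule trace_integral_Gamma[OF c(1) th(3,4) \<Xi>(1) \<Xi>(2) that]; assumption)+
  have hcont: "continuous_on {0<..} (\<lambda>t. of_real t * h (of_real t))"
    using c(1) unfolding nb[symmetric]
    by (intro continuous_intros continuous_on_compose2[OF holomorphic_on_imp_continuous_on[OF h_holomorphic[folded nb]]])
       (auto intro!: of_real_in_sector_nbhd)
  have shift: "spectral_shift A B l = - (LINT t:{l..}|lborel. h (of_real t))" if l: "l > 0" for l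
  proof -
    (* The contour integral depends on psi l only, which makes it irrelevant which representing
       measure repr_measure has chosen. *)
    have "2 * pi * \<i> * (\<integral>t. of_real t * h (of_real t) \<partial>repr_measure (psi l))
      = 2 * pi * \<i> * (\<integral>t. of_real t * h (of_real t) \<partial>psi_measure l)"
      using Gamma(2)[OF represents_repr_measure[OF psi_OM[OF l]] growth_psi[OF l]]
        Gamma(2)[OF represents_psi[OF l] growth_psi[OF l]] by simp
    then have "(\<integral>t. of_real t * h (of_real t) \<partial>repr_measure (psi l)) = (\<integral>t. of_real t * h (of_real t) \<partial>psi_measure l)"
      by simp
    also have "\<dots> = (LINT t:{l..}|lborel. of_real t * h (of_real t) / of_real t)"
    proof (rule integral_psi_measure[OF l])
      show "(\<lambda>t. of_real t * h (of_real t)) \<in> borel_measurable (restrict_space lborel {0<..})"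
        using borel_measurable_continuous_on_restrict[OF hcont]
          measurable_cong_sets[OF sets_restrict_space_cong[OF sets_lborel] refl] by blast
    qed
    also have "\<dots> = (LINT t:{l..}|lborel. h (of_real t))"
      by (rule set_lebesgue_integral_cong) (use l in auto)
    finally show ?thesis using spectral_shift_eq[OF l] by simp
  qed
  have "shift_continuation A B \<theta> \<theta> \<Xi>"
    unfolding shift_continuation_def
  proof (intro conjI allI impI)
    have "closure (Omega \<theta> \<theta>) \<subseteq> sector_nbhd c" using th by (intro closure_Omega_subset) auto
    moreover have "\<Xi> holomorphic_on sector_nbhd c"
      using \<Xi>(1) by (meson holomorphic_onI field_differentiable_at_within field_differentiable_def)
    ultimately show "\<Xi> analytic_on closure (Omega \<theta> \<theta>)"
      using open_sector_nbhd analytic_on_holomorphic by blast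
  qed (simp add: shift \<Xi>(4))
  moreover have "LK_formula A B \<theta> \<theta> \<Xi> \<phi>" if \<phi>: "\<phi> \<in> OM_minus" "growth_condition \<phi>" for \<phi>
  proof -
    obtain T w where T: "nuc T w (\<integral>t. of_real t * h (of_real t) \<partial>repr_measure \<phi>)"
      "difference_on (Domain A) (oper_fun \<phi> A) (oper_fun \<phi> B) T"
      using trace_oper_fun[OF \<phi>(1)] by blast
    note G = Gamma[OF represents_repr_measure[OF \<phi>(1)] \<phi>(2)]
    have "trace_difference (Domain A) (oper_fun \<phi> A) (oper_fun \<phi> B)
      = (\<integral>t. of_real t * h (of_real t) \<partial>repr_measure \<phi>)"
      using trace_difference_eq[OF T(2) dense] nuc_trace[OF AP T(1)] by simp
    moreover have "nuclear_difference (Domain A) (oper_fun \<phi> A) (oper_fun \<phi> B)"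
      using T nuc_imp_nuclear by (auto simp: nuclear_difference_def)
    ultimately show ?thesis unfolding LK_formula_def using G by simp
  qed
  ultimately show ?thesis using that th(1,2) shift by blast
qed

lemma neg_pairI:
  fixes A B :: "'a::complex_banach oper"
  assumes AP: "approximation_property TYPE('a)" and A: "negative_oper A" and B: "negative_oper B"
    and diff: "nuclear_difference (Domain A) A B"
  obtains V K v \<tau> where "neg_pair A B V K v \<tau>"
proof -
  obtain V where V: "difference_on (Domain A) A B V" "nuclear V"
    using diff by (auto simp: nuclear_difference_def)
  then obtain v \<tau> where \<tau>: "nuc V v \<tau>"
    using nuclear_series_imp_nuc by (metis nuclear_def)
  obtain L where L: "L \<ge> 1" "\<And>t. t \<ge> 0 \<Longrightarrow> is_resolvent A (of_real t) (resolvent (of_real t) A)"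
    "\<And>t x. t \<ge> 0 \<Longrightarrow> norm (resolvent (of_real t) A x) \<le> L / (1 + t) * norm x"
    using negative_oper_bound[OF A] by blast
  obtain M where M: "M \<ge> 1" "\<And>t. t \<ge> 0 \<Longrightarrow> is_resolvent B (of_real t) (resolvent (of_real t) B)"
    "\<And>t x. t \<ge> 0 \<Longrightarrow> norm (resolvent (of_real t) B x) \<le> M / (1 + t) * norm x"
    using negative_oper_bound[OF B] by blast
  have le: "k / (1 + t) * norm x \<le> max L M / (1 + t) * norm x"
    if "k \<le> max L M" "t \<ge> 0" for k t :: real and x :: 'a
    using that by (intro mult_right_mono divide_right_mono) auto
  have "neg_pair A B V (max L M) v \<tau>"
  proof
    show "norm (resolvent (of_real t) A x) \<le> max L M / (1 + t) * norm x" if "t \<ge> 0" for t x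
      using L(3)[OF that, of x] le[of L t x] that by simp
    show "norm (resolvent (of_real t) B x) \<le> max L M / (1 + t) * norm x" if "t \<ge> 0" for t x
      using M(3)[OF that, of x] le[of M t x] that by simp
  qed (use AP A B L M V \<tau> in \<open>auto simp: negative_oper_def\<close>)
  then show ?thesis by (rule that)
qed

lemma trace_formula:
  fixes A B :: "'a::complex_banach oper"
  assumes "approximation_property TYPE('a)" "negative_oper A" "negative_oper B"
    "nuclear_difference (Domain A) A B"
  shows "\<exists>\<theta> \<delta> \<xi>. 0 < \<theta> \<and> \<theta> < pi / 2 \<and> 0 < \<delta> \<and> shift_continuation A B \<theta> \<delta> \<xi> \<and>
     (\<forall>\<phi>\<in>OM_minus. growth_condition \<phi> \<longrightarrow> LK_formula A B \<theta> \<delta> \<xi> \<phi>)"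
proof -
  obtain V K v \<tau> where "neg_pair A B V K v \<tau>" using neg_pairI[OF assms] by blast
  then interpret neg_pair A B V K v \<tau> .
  show ?thesis using LK_formula_exists by metis
qed

text \<open>A fixed rotation gives the integrand a positive real part of the size of the integrand
  at \<open>- r\<close>; the real part of the rotated integral can then suffer no
  cancellation.\<close>

lemma OM_ray_lower:
  assumes rep: "represents \<mu> \<phi>" and \<theta>: "0 < \<theta>" "\<theta> < pi" and r: "0 < r"
  shows "sin (\<theta> / 2) * cmod (\<phi> (of_real (- r))) \<le> cmod (\<phi> (of_real r * cis \<theta>))"
proof -
  have \<mu>: "OM_measure \<mu>" using rep by (simp add: represents_def)
  define s where "s = sin (\<theta> / 2)"
  have s: "s > 0" unfolding s_def using \<theta> by (intro sin_gt_zero) auto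
  let ?z = "of_real r * cis \<theta>"
  have "sin \<theta> > 0" using \<theta> by (rule sin_gt_zero)
  then have "?z \<notin> complex_of_real ` {0<..}" using r by (auto simp: complex_eq_iff)
  then have \<phi>z: "\<phi> ?z = (\<integral>t. ?z / (of_real t - ?z) \<partial>\<mu>)" using rep by (simp add: represents_def)
  have low: "s * (t + r) \<le> cmod (of_real t - ?z)" if "t > 0" for t
    unfolding s_def by (rule norm_diff_off_sector) (use that r \<theta> in auto)
  have int: "integrable \<mu> (\<lambda>t. ?z / (of_real t - ?z))"
  proof (rule integrable_OM[OF \<mu>, where C = "(1 + r) / s"])
    fix t :: real assume t: "t > 0"
    have "norm (?z / (of_real t - ?z)) \<le> r / (s * (t + r))"
      unfolding norm_divide using low[OF t] s t r by (intro frac_le) (auto simp: norm_mult)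
    also have "\<dots> = r / (t + r) / s" by simp
    also have "\<dots> \<le> (1 + r) / (1 + t) / s"
    proof (rule divide_right_mono)
      have "r * (1 + t) \<le> (1 + r) * (t + r)" using r t by (simp add: algebra_simps)
      then show "r / (t + r) \<le> (1 + r) / (1 + t)" using r t by (simp add: field_simps)
    qed (use s in simp)
    finally show "norm (?z / (of_real t - ?z)) \<le> (1 + r) / s / (1 + t)" by (simp add: mult.commute)
  qed (intro borel_measurable_OM[OF \<mu>], measurable)
  \<comment> \<open>As \<open>t\<close> runs from 0 to infinity, the argument of
    \<open>z / (t - z)\<close> moves from \<open>pi\<close> down to \<open>\<theta>\<close>.
    Multiplication by \<open>?u = cis (- (pi + \<theta>) / 2)\<close> turns the bisector of this
    range to the positive axis, and \<open>s\<close> is the cosine of the half opening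
    angle.\<close>
  let ?u = "- cis (pi / 2 - \<theta> / 2)"
  have Re: "s * (r / (t + r)) \<le> Re (?u * (?z / (of_real t - ?z)))" if t: "t > 0" for t
  proof -
    have q: "of_real t - ?z \<noteq> 0" using low[OF t] mult_pos_pos[OF s, of "t + r"] t r by auto
    have n: "(cmod (of_real t - ?z))\<^sup>2 = t\<^sup>2 + r\<^sup>2 - 2 * t * r * cos \<theta>"
    proof -
      have "(r * sin \<theta>)\<^sup>2 = r\<^sup>2 - r\<^sup>2 * (cos \<theta>)\<^sup>2" by (simp add: power_mult_distrib sin_squared_eq algebra_simps)
      moreover have "(cmod (of_real t - ?z))\<^sup>2 = (t - r * cos \<theta>)\<^sup>2 + (r * sin \<theta>)\<^sup>2"
        by (simp add: cmod_power2)
      ultimately show ?thesis by (simp add: power2_eq_square algebra_simps)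
    qed
    have "?u * (?z / (of_real t - ?z)) = ?u * (?z * cnj (of_real t - ?z)) / of_real ((cmod (of_real t - ?z))\<^sup>2)"
      by (simp only: complex_div_cnj[of ?z "of_real t - ?z"] times_divide_eq_right of_real_power)
    also have "?u * (?z * cnj (of_real t - ?z)) = of_real r * (of_real r * cis (pi / 2 - \<theta> / 2) - of_real t * cis (pi / 2 + \<theta> / 2))"
    proof -
      have 1: "cis (pi / 2 - \<theta> / 2) * cis \<theta> = cis (pi / 2 + \<theta> / 2)" by (simp add: cis_mult field_simps)
      have 2: "cis \<theta> * cis (- \<theta>) = 1" by (simp add: cis_mult)
      have "?u * (?z * cnj (of_real t - ?z)) = of_real r * (of_real r * (cis (pi / 2 - \<theta> / 2) * (cis \<theta> * cis (- \<theta>)))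
          - of_real t * (cis (pi / 2 - \<theta> / 2) * cis \<theta>))"
        by (simp only: complex_cnj_diff complex_cnj_mult complex_cnj_complex_of_real cis_cnj
            ring_distribs mult_minus_left mult_minus_right mult_ac) simp
      then show ?thesis unfolding 1 2 by simp
    qed
    finally have "Re (?u * (?z / (of_real t - ?z))) = r * (r * s + t * s) / (cmod (of_real t - ?z))\<^sup>2"
      by (simp add: s_def cos_diff cos_add Re_divide_of_real del: of_real_power)
    \<comment> \<open>The distance of \<open>t\<close> from a point of modulus \<open>r\<close> is
      at most \<open>t + r\<close>.\<close>
    moreover have "r * (r * s + t * s) / (t + r)\<^sup>2 \<le> r * (r * s + t * s) / (cmod (of_real t - ?z))\<^sup>2"
    proof (rule divide_left_mono)
      have "- cos \<theta> \<le> 1" using cos_ge_minus_one[of \<theta>] by simp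
      then have "2 * t * r * (- cos \<theta>) \<le> 2 * t * r * 1" using t r by (intro mult_left_mono) auto
      then show "(cmod (of_real t - ?z))\<^sup>2 \<le> (t + r)\<^sup>2" unfolding n by (simp add: power2_eq_square algebra_simps)
    qed (use r s t q in auto)
    moreover have "r * (r * s + t * s) / (t + r)\<^sup>2 = s * (r / (t + r))"
    proof -
      have "r * (r * s + t * s) = s * r * (t + r)" by (simp add: algebra_simps)
      then show ?thesis using r t by (simp add: power2_eq_square)
    qed
    ultimately show ?thesis by simp
  qed
  have "s * cmod (\<phi> (of_real (- r))) = (\<integral>t. s * (r / (t + r)) \<partial>\<mu>)"
    unfolding cmod_OM_negative(2)[OF rep r] by (simp only: integral_mult_right_zero)
  also have "\<dots> \<le> (\<integral>t. Re (?u * (?z / (of_real t - ?z))) \<partial>\<mu>)"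
  proof (rule integral_mono)
    show "integrable \<mu> (\<lambda>t. Re (?u * (?z / (of_real t - ?z))))"
      by (intro integrable_Re integrable_mult_right int)
    show "integrable \<mu> (\<lambda>t. s * (r / (t + r)))"
    proof (rule integrable_OM[OF \<mu>, where C = "s * (1 + r)"])
      fix t :: real assume t: "t > 0"
      have "r * (1 + t) \<le> (1 + r) * (t + r)" using r t by (simp add: algebra_simps)
      then have "r / (t + r) \<le> (1 + r) / (1 + t)" using r t by (simp add: field_simps)
      then have "s * (r / (t + r)) \<le> s * ((1 + r) / (1 + t))" using s by (intro mult_left_mono) auto
      then show "norm (s * (r / (t + r))) \<le> s * (1 + r) / (1 + t)" using s r t by simp
    qed (intro borel_measurable_OM[OF \<mu>], measurable)
  qed (use Re in \<open>auto simp: space_OM[OF \<mu>]\<close>)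
  also have "\<dots> = Re (\<integral>t. ?u * (?z / (of_real t - ?z)) \<partial>\<mu>)"
    by (rule integral_Re[OF integrable_mult_right[OF int]])
  also have "\<dots> = Re (?u * \<phi> ?z)" unfolding \<phi>z by (simp only: integral_mult_right_zero)
  also have "\<dots> \<le> cmod (?u * \<phi> ?z)" by (rule complex_Re_le_cmod)
  also have "\<dots> = cmod (\<phi> ?z)" by (simp add: norm_mult)
  finally show ?thesis by (simp add: s_def)
qed

section \<open>The converse\<close>

definition mult_oper :: "complex \<Rightarrow> complex oper" where
  "mult_oper a = {(x, a * x) | x. True}"

lemma Domain_mult_oper [simp]: "Domain (mult_oper a) = UNIV"
  by (auto simp: mult_oper_def)

lemma linear_mult_oper: "linear_oper (mult_oper a)"
  by (auto simp: linear_oper_def mult_oper_def single_valued_def scaleC_complex_def algebra_simps)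

lemma app_mult_oper: "app (mult_oper a) x = a * x"
  by (rule linear_oper_app_eq[OF linear_mult_oper]) (auto simp: mult_oper_def)

lemma resolvent_mult_oper:
  assumes "z \<noteq> a"
  shows "is_resolvent (mult_oper a) z (\<lambda>y. y / (z - a))"
  unfolding is_resolvent_def
proof (intro conjI allI impI)
  show "bounded_clinear (\<lambda>y. y / (z - a))"
    by (rule bounded_clinearI[where K = "1 / cmod (z - a)"])
       (auto simp: scaleC_complex_def add_divide_distrib norm_divide)
  fix y
  have "z * (y / (z - a)) - y = a * (y / (z - a))" using assms by (simp add: divide_simps) (simp add: algebra_simps)
  then show "(y / (z - a), z *\<^sub>C (y / (z - a)) - y) \<in> mult_oper a"
    by (auto simp: mult_oper_def scaleC_complex_def)
next
  fix x u assume "(x, u) \<in> mult_oper a"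
  then show "(z *\<^sub>C x - u) / (z - a) = x"
    using assms by (auto simp: mult_oper_def scaleC_complex_def simp flip: left_diff_distrib)
qed

lemma resolvent_mult_oper_eq: "z \<noteq> a \<Longrightarrow> resolvent z (mult_oper a) = (\<lambda>y. y / (z - a))"
  by (rule resolvent_eq[OF resolvent_mult_oper])

lemma negative_mult_oper:
  assumes a: "0 < a"
  shows "negative_oper (mult_oper (- of_real a))"
  unfolding negative_oper_def
proof (intro conjI linear_mult_oper)
  let ?A = "mult_oper (- of_real a)"
  have ne: "of_real t \<noteq> - complex_of_real a" if "t \<ge> 0" for t
    using that a by (auto simp: complex_eq_iff)
  have "?A = {p. snd p = - of_real a * fst p}" by (auto simp: mult_oper_def)
  then show "closed ?A" by (auto intro!: closed_Collect_eq continuous_intros)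
  show "closure (Domain ?A) = UNIV" by simp
  show "complex_of_real ` {0..} \<subseteq> resolvent_set ?A"
  proof clarsimp
    fix t :: real assume t: "0 \<le> t"
    note res = resolvent_mult_oper[OF ne[OF t]]
    have eq: "app (scalar_minus (of_real t) ?A) = (\<lambda>x. (of_real t + of_real a) * x)"
      by (intro ext) (simp add: app_scalar_minus[OF linear_mult_oper] app_mult_oper scaleC_complex_def algebra_simps)
    have ne': "complex_of_real t + of_real a \<noteq> 0" using ne[OF t] by (simp add: add_eq_0_iff2)
    have "bij (\<lambda>x. (complex_of_real t + of_real a) * x)"
      by (rule o_bij[of "\<lambda>x. x / (of_real t + of_real a)"]) (use ne' in \<open>auto simp: o_def\<close>)
    moreover have "bounded_clinear (resolvent (of_real t) ?A)"
      using res unfolding resolvent_eq[OF res] is_resolvent_def by blast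
    ultimately show "complex_of_real t \<in> resolvent_set ?A"
      by (simp add: resolvent_set_def eq)
  qed
  show "bdd_above ((\<lambda>t. onorm (\<lambda>x. (1 + t) *\<^sub>R resolvent (of_real t) ?A x)) ` {0<..})"
  proof (rule bdd_aboveI2)
    fix t :: real assume "t \<in> {0<..}"
    then have t: "t > 0" by simp
    show "onorm (\<lambda>x. (1 + t) *\<^sub>R resolvent (of_real t) ?A x) \<le> 1 + 1 / a"
    proof (rule onorm_bound)
      show "norm ((1 + t) *\<^sub>R resolvent (of_real t) ?A x) \<le> (1 + 1 / a) * norm x" for x
      proof -
        have "norm ((1 + t) *\<^sub>R resolvent (of_real t) ?A x) = (1 + t) / (t + a) * norm x"
          using t a ne[of t] by (simp add: resolvent_mult_oper_eq norm_divide flip: of_real_add)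
        also have "(1 + t) / (t + a) \<le> 1 + 1 / a" using t a by (simp add: field_simps)
        finally show ?thesis by (simp add: mult_right_mono)
      qed
    qed (use a in simp)
  qed
qed

lemma approximation_property_complex: "approximation_property TYPE(complex)"
proof -
  have "x \<in> cvec.span {1}" for x :: complex
    using cvec.span_scale[OF cvec.span_base[of "1::complex" "{1}"], of x] by (simp add: scaleC_complex_def)
  then have "range (\<lambda>x::complex. x) \<subseteq> cvec.span {1}" by blast
  then have "finite_rank (\<lambda>x::complex. x)"
    unfolding finite_rank_def by (intro conjI bounded_clinear_id exI[of _ "{1}"]) auto
  then show ?thesis
    unfolding approximation_property_def by (intro allI impI exI[of _ "\<lambda>x. x"]) auto
qed

text \<open>A single rank one term, padded by zeros to an infinite series; in dimension one the
  trace is the factor itself.\<close>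

lemma nuc_multiplication: "nuc (\<lambda>x::complex. m * x) (cmod m) m"
proof -
  have "nuc (\<lambda>x::complex. m *\<^sub>C x) (cmod m * 1) (m * 1)"
  proof (rule nuc_scaleC)
    show "nuc (\<lambda>x::complex. x) 1 1"
      unfolding nuc_def
    proof (intro exI conjI allI)
      show "bounded_clinear (\<lambda>x::complex. if n = (0::nat) then x else 0)" for n
        using bounded_clinear_id bounded_clinear_0 by (cases "n = 0") auto
      have "(\<lambda>n. if n = 0 then 1 else 0 :: real) sums 1" using sums_single[of 0 "\<lambda>n. 1"] by simp
      then show "summable (\<lambda>n. if n = (0::nat) then 1 else 0 :: real)"
        "(\<Sum>n. if n = (0::nat) then 1 else 0 :: real) \<le> 1" by (auto simp: sums_iff)
      show "cmod (if n = 0 then x else 0) * norm (1::complex) \<le> (if n = 0 then 1 else 0) * norm x"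
        for n :: nat and x by simp
      show "(\<lambda>n. (if n = (0::nat) then x else 0) *\<^sub>C 1) sums x" for x :: complex
        using sums_single[of 0 "\<lambda>n. x"] by (simp only: scaleC_complex_def mult_1_right)
      show "(\<lambda>n. if n = (0::nat) then 1 else 0 :: complex) sums 1"
        using sums_single[of 0 "\<lambda>n. 1::complex"] by simp
    qed auto
  qed
  then show ?thesis by (simp add: scaleC_complex_def)
qed

text \<open>The trace of the difference of the resolvents is
  \<open>1 / (t + 1) - 1 / (t + 2)\<close>, with primitive \<open>Ln (t + 1) - Ln (t + 2)\<close>
  vanishing at infinity. The value comes from the general integral of \<open>h\<close>, so the
  operator logarithm never has to be evaluated.\<close>

lemma spectral_shift_mult_oper:
  assumes l: "l > 0"
  shows "spectral_shift (mult_oper (-1)) (mult_oper (-2)) l = Ln (of_real l + 1) - Ln (of_real l + 2)"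
proof -
  let ?A = "mult_oper (-1)" and ?B = "mult_oper (-2)"
  have A: "negative_oper ?A" and B: "negative_oper ?B"
    using negative_mult_oper[of 1] negative_mult_oper[of 2] by simp_all
  have "difference_on (Domain ?A) ?A ?B (\<lambda>x. 1 * x)"
    by (auto simp: difference_on_def bounded_clinear_id app_mult_oper)
  then have "nuclear_difference (Domain ?A) ?A ?B"
    using nuc_imp_nuclear[OF nuc_multiplication] unfolding nuclear_difference_def by blast
  then obtain V K v \<tau> where np: "neg_pair ?A ?B V K v \<tau>"
    using neg_pairI[OF approximation_property_complex A B] by blast
  then interpret neg_pair ?A ?B V K v \<tau> .
  have shift: "spectral_shift ?A ?B l = - (LINT t:{l..}|lborel. h (of_real t))"
    by (rule LK_formula_exists) (use l in blast)
  have h: "h (of_real t) = 1 / (of_real t + 1) - 1 / (of_real t + 2)" if t: "t > 0" for t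
  proof -
    have ne: "complex_of_real t \<noteq> -1" "complex_of_real t \<noteq> -2" using t by (auto simp: complex_eq_iff)
    have "D (of_real t) = (\<lambda>x. (1 / (of_real t + 1) - 1 / (of_real t + 2)) * x)"
      unfolding D_def[abs_def] using ne by (intro ext) (simp add: resolvent_mult_oper_eq left_diff_distrib)
    then show ?thesis
      unfolding h_def using nuc_trace[OF approximation_property_complex nuc_multiplication] by simp
  qed
  let ?f = "\<lambda>t. 1 / (complex_of_real t + 1) - 1 / (complex_of_real t + 2)"
  let ?P = "\<lambda>t. Ln (complex_of_real t + 1) - Ln (complex_of_real t + 2)"
  have ne: "complex_of_real t + 1 \<noteq> 0" "complex_of_real t + 2 \<noteq> 0" if "t \<ge> l" for t
    using that l by (auto simp: complex_eq_iff)
  have int: "set_integrable lborel {l..} ?f"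
  proof (rule set_integrable_continuous_bound[where c = 1 and C = 1])
    show "continuous_on {l..} ?f" using ne by (intro continuous_intros) auto
    fix t assume t: "l \<le> t"
    have "?f t = of_real (1 / ((t + 1) * (t + 2)))" using ne[OF t] by (simp add: divide_simps)
    then have "cmod (?f t) = 1 / ((t + 1) * (t + 2))" using t l by (simp only: norm_of_real) simp
    also have "\<dots> \<le> 1 / (t + 1)\<^sup>2" using t l by (intro frac_le) (auto simp: power2_eq_square)
    finally show "norm (?f t) \<le> 1 / (t + 1)\<^sup>2" .
  qed (use l in simp)
  have der: "(?P has_vector_derivative ?f t) (at t within S)" if t: "t \<ge> l" for t S
  proof -
    have "complex_of_real t + 1 \<notin> \<real>\<^sub>\<le>\<^sub>0" "complex_of_real t + 2 \<notin> \<real>\<^sub>\<le>\<^sub>0"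
      using t l by (auto simp: complex_nonpos_Reals_iff)
    then have "((\<lambda>w. Ln (w + 1) - Ln (w + 2)) has_field_derivative ?f t) (at (of_real t))"
      using ne[OF t] by (auto intro!: derivative_eq_intros simp: divide_simps)
    from has_vector_derivative_real_field[OF this] show ?thesis .
  qed
  have "((\<lambda>b::real. ln (b + 1) - ln (b + 2)) \<longlongrightarrow> 0) at_top" by real_asymp
  then have "((\<lambda>b. complex_of_real (ln (b + 1) - ln (b + 2))) \<longlongrightarrow> of_real 0) at_top" by (rule tendsto_of_real)
  moreover have "\<forall>\<^sub>F b in at_top. complex_of_real (ln (b + 1) - ln (b + 2)) = ?P b"
    by (rule eventually_mono[OF eventually_gt_at_top[of 0]]) (simp flip: Ln_of_real)
  ultimately have "(?P \<longlongrightarrow> of_real 0) at_top" by (rule Lim_transform_eventually)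
  then have "(LINT t:{l..}|lborel. ?f t) = of_real 0 - ?P l"
    by (rule set_integral_FTC_atLeast[where P = ?P, OF int, rotated]) (rule der)
  moreover have "(LINT t:{l..}|lborel. h (of_real t)) = (LINT t:{l..}|lborel. ?f t)"
    by (rule set_lebesgue_integral_cong) (use l h in auto)
  ultimately show ?thesis using shift by simp
qed

text \<open>For \<open>w\<close> the difference of the logarithms,
  \<open>exp w - 1 = - 1 / (z + 2)\<close>. On the unit disc \<open>exp\<close> is Lipschitz with
  constant 3, since \<open>exp 1 \<le> 3\<close>, which bounds \<open>w\<close> from below; outside
  the unit disc the claim is trivial.\<close>

lemma Ln_difference_lower:
  assumes "Re z > 0"
  shows "1 / (3 * (cmod z + 2)) \<le> cmod (Ln (z + 1) - Ln (z + 2))"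
proof -
  define w where "w = Ln (z + 1) - Ln (z + 2)"
  have ne: "z + 1 \<noteq> 0" "z + 2 \<noteq> 0" using assms by (auto simp: complex_eq_iff)
  have z2: "0 < cmod (z + 2)" "cmod (z + 2) \<le> cmod z + 2"
    using ne norm_triangle_ineq[of z 2] by auto
  show ?thesis
  proof (cases "cmod w \<le> 1")
    case True
    have "exp w = (z + 1) / (z + 2)" using ne by (simp add: w_def exp_diff)
    then have "exp w - 1 = (z + 1) / (z + 2) - (z + 2) / (z + 2)" using ne by simp
    then have "exp w - 1 = ((z + 1) - (z + 2)) / (z + 2)" by (simp only: diff_divide_distrib)
    then have "exp w - 1 = - 1 / (z + 2)" by simp
    then have "cmod (exp w - 1) = 1 / cmod (z + 2)" by (simp add: norm_divide)
    moreover have "cmod (exp w - 1) \<le> 3 * cmod w"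
    proof -
      have "cmod (exp w - exp 0) \<le> 3 * cmod (w - 0)"
      proof (rule field_differentiable_bound[where S = "cball 0 1"])
        fix x :: complex assume "x \<in> cball 0 1"
        then have "exp (cmod x) \<le> exp 1" by simp
        then show "cmod (exp x) \<le> 3" using norm_exp[of x] exp_le by linarith
      qed (use True in \<open>auto intro!: derivative_eq_intros\<close>)
      then show ?thesis by simp
    qed
    moreover have "1 / (cmod z + 2) \<le> 1 / cmod (z + 2)" using z2
      by (intro divide_left_mono mult_pos_pos) (auto intro: add_nonneg_pos)
    ultimately have le: "1 / (cmod z + 2) \<le> 3 * cmod w" by linarith
    define y where "y = 1 / (cmod z + 2)"
    have "1 / (3 * (cmod z + 2)) = y / 3" by (simp add: y_def)
    also have "\<dots> \<le> cmod w" using le[folded y_def] by simp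
    finally show ?thesis unfolding w_def .
  next
    case False
    have "1 / (3 * (cmod z + 2)) \<le> 1" by (simp add: divide_le_eq add_nonneg_pos)
    then show ?thesis using False by (simp add: w_def)
  qed
qed

lemma open_sector: "open {z. cmod z * c < Re z}"
  by (intro open_Collect_less continuous_intros)

lemma convex_sector:
  assumes "0 \<le> c"
  shows "convex {z. cmod z * c < Re z}"
proof (rule convexI)
  fix x y :: complex and u v :: real
  assume x: "x \<in> {z. cmod z * c < Re z}" and y: "y \<in> {z. cmod z * c < Re z}" and uv: "0 \<le> u" "0 \<le> v" "u + v = 1"
  have "cmod (u *\<^sub>R x + v *\<^sub>R y) * c \<le> (u * cmod x + v * cmod y) * c"
    using norm_triangle_ineq[of "u *\<^sub>R x" "v *\<^sub>R y"] uv assms by (intro mult_right_mono) auto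
  also have "\<dots> = u * (cmod x * c) + v * (cmod y * c)" by (simp add: algebra_simps)
  also have "\<dots> < u * Re x + v * Re y"
  proof (cases "u = 0")
    case True
    then show ?thesis using uv y by simp
  next
    case False
    then have "u * (cmod x * c) < u * Re x" using uv x by simp
    moreover have "v * (cmod y * c) \<le> v * Re y" using uv y by (intro mult_left_mono) auto
    ultimately show ?thesis by linarith
  qed
  finally show "u *\<^sub>R x + v *\<^sub>R y \<in> {z. cmod z * c < Re z}" by simp
qed

text \<open>The identity theorem applies in the open sector only, whereas the contour runs along its
  boundary. The ray is reached by letting the argument increase to \<open>\<theta>\<close>, where
  \<open>\<xi>\<close> is still continuous because it is analytic on the closure.\<close>

lemma continuation_on_ray:
  assumes \<theta>: "0 < \<theta>" "\<theta> < pi / 2" and \<xi>: "\<xi> analytic_on closure (Omega \<theta> \<delta>)"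
    and F: "F holomorphic_on {z. 0 < Re z}" and eq: "\<And>l. l > 0 \<Longrightarrow> \<xi> (of_real l) = F (of_real l)"
    and r: "0 < r"
  shows "\<xi> (of_real r * cis \<theta>) = F (of_real r * cis \<theta>)"
    and "of_real r * cis \<theta> \<in> closure (Omega \<theta> \<delta>)"
proof -
  let ?S = "{z. cmod z * cos \<theta> < Re z}"
  have c: "0 < cos \<theta>" "cos \<theta> < 1" using \<theta> cos_gt_zero[of \<theta>] cos_monotone_0_pi[of 0 \<theta>] by auto
  have S0: "z \<noteq> 0" if "z \<in> ?S" for z using that by auto
  have S_Re: "0 < Re z" if "z \<in> ?S" for z
  proof -
    have "0 \<le> cmod z * cos \<theta>" using c by simp
    then show ?thesis using that by simp
  qed
  have S_sub: "?S \<subseteq> Omega \<theta> \<delta>"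
    using sector_iff(1)[OF S0, of _ \<theta>] S0 \<theta> by (auto simp: Omega_def)
  have \<xi>S: "\<xi> holomorphic_on ?S"
    by (rule holomorphic_on_subset[OF analytic_imp_holomorphic[OF \<xi>] order_trans[OF S_sub closure_subset]])
  have eqS: "\<xi> z - F z = 0" if z: "z \<in> ?S" for z
  proof (rule analytic_continuation[where f = "\<lambda>z. \<xi> z - F z" and w = z and S = ?S and U = "complex_of_real ` {0<..}" and \<xi> = 1])
    show "(\<lambda>z. \<xi> z - F z) holomorphic_on ?S"
      using S_Re by (intro holomorphic_intros \<xi>S holomorphic_on_subset[OF F]) auto
    show "connected ?S" using c by (intro convex_connected convex_sector) simp
    show "complex_of_real ` {0<..} \<subseteq> ?S" using c by auto
    show "1 islimpt complex_of_real ` {0<..}"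
    proof (rule islimptI)
      fix T :: "complex set" assume T: "1 \<in> T" "open T"
      then obtain e where e: "e > 0" "ball 1 e \<subseteq> T" using openE by blast
      have "complex_of_real (1 + e / 2) \<in> ball 1 e" using e by (simp add: dist_norm)
      then show "\<exists>y\<in>complex_of_real ` {0<..}. y \<in> T \<and> y \<noteq> 1"
        using e by (intro bexI[of _ "complex_of_real (1 + e / 2)"] imageI) auto
    qed
  qed (use c eq z open_sector in auto)
  let ?z = "\<lambda>s. of_real r * cis s"
  have inS: "?z s \<in> ?S" if "0 < s" "s < \<theta>" for s
  proof -
    have "cos \<theta> < cos s" using that \<theta> by (intro cos_monotone_0_pi) auto
    then show ?thesis using r by (simp add: norm_mult)
  qed
  have ev: "\<forall>\<^sub>F s in at_left \<theta>. 0 < s \<and> s < \<theta>"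
    using eventually_at_left_real[OF \<theta>(1)] by eventually_elim auto
  have zlim: "(?z \<longlongrightarrow> ?z \<theta>) (at_left \<theta>)"
    by (intro tendsto_intros)
  show cl: "?z \<theta> \<in> closure (Omega \<theta> \<delta>)"
  proof (rule Lim_in_closed_set[OF closed_closure _ _ zlim])
    show "\<forall>\<^sub>F s in at_left \<theta>. ?z s \<in> closure (Omega \<theta> \<delta>)"
      using ev
    proof eventually_elim
      case (elim s)
      then show ?case using inS[of s] S_sub closure_subset by blast
    qed
  qed simp
  have "isCont \<xi> (?z \<theta>)" using \<xi> cl by (meson analytic_at_imp_isCont analytic_on_analytic_at)
  then have 1: "((\<lambda>s. \<xi> (?z s)) \<longlongrightarrow> \<xi> (?z \<theta>)) (at_left \<theta>)" using zlim by (rule isCont_tendsto_compose)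
  have "0 < Re (?z \<theta>)" using r c by simp
  moreover have "open {z. 0 < Re z}" by (intro open_Collect_less continuous_intros)
  ultimately have "isCont F (?z \<theta>)"
    using holomorphic_on_imp_continuous_on[OF F] continuous_on_eq_continuous_at by blast
  then have 2: "((\<lambda>s. F (?z s)) \<longlongrightarrow> F (?z \<theta>)) (at_left \<theta>)" using zlim by (rule isCont_tendsto_compose)
  have "\<forall>\<^sub>F s in at_left \<theta>. F (?z s) = \<xi> (?z s)"
    using ev
  proof eventually_elim
    case (elim s)
    then show ?case using eqS[OF inS[of s]] by simp
  qed
  with 2 have "((\<lambda>s. \<xi> (?z s)) \<longlongrightarrow> F (?z \<theta>)) (at_left \<theta>)"
    by (rule Lim_transform_eventually)
  from tendsto_unique[OF trivial_limit_at_left_real 1 this] show "\<xi> (?z \<theta>) = F (?z \<theta>)" .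
qed

section \<open>From the derivative on a ray to the growth condition\<close>

text \<open>The fundamental theorem along the ray, whose direction \<open>cis \<theta>\<close> has
  modulus 1. The extended nonnegative form is the one to which Tonelli's theorem is applied
  afterwards.\<close>

lemma radial_increment_bound:
  assumes rep: "represents \<mu> \<phi>" and \<theta>: "0 < \<theta>" "\<theta> < pi" and \<delta>: "0 < \<delta>" "\<delta> \<le> r"
  shows "ennreal (cmod (\<phi> (of_real r * cis \<theta>))) \<le> ennreal (cmod (\<phi> (of_real \<delta> * cis \<theta>)))
    + (\<integral>\<^sup>+s\<in>{\<delta>..r}. ennreal (cmod (deriv \<phi> (of_real s * cis \<theta>))) \<partial>lborel)"
proof -
  let ?z = "\<lambda>s. of_real s * cis \<theta>"
  have off: "?z s \<in> - complex_of_real ` {0..}" if "s > 0" for s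
    using that sin_gt_zero[OF \<theta>] by (auto simp: complex_eq_iff)
  have hol: "\<phi> holomorphic_on - complex_of_real ` {0..}" by (rule OM_holomorphic[OF rep])
  have cont: "continuous_on {\<delta>..r} (\<lambda>s. deriv \<phi> (?z s))"
  proof (rule continuous_on_compose2[OF holomorphic_on_imp_continuous_on[OF holomorphic_deriv[OF hol open_off_positive_axis]]])
    show "continuous_on {\<delta>..r} ?z" by (intro continuous_intros)
    show "?z ` {\<delta>..r} \<subseteq> - complex_of_real ` {0..}" by (intro image_subsetI off) (use \<delta> in auto)
  qed
  have "((\<lambda>s. deriv \<phi> (?z s) * cis \<theta>) has_integral (\<phi> (?z r) - \<phi> (?z \<delta>))) {\<delta>..r}"
  proof (rule fundamental_theorem_of_calculus[OF \<delta>(2)])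
    fix s assume "s \<in> {\<delta>..r}"
    then have s: "s > 0" using \<delta> by simp
    have "(\<phi> has_field_derivative deriv \<phi> (?z s)) (at (?z s))"
      by (rule holomorphic_derivI[OF hol open_off_positive_axis off[OF s]])
    moreover have "((\<lambda>w. w * cis \<theta>) has_field_derivative cis \<theta>) (at (of_real s))"
      by (auto intro!: derivative_eq_intros)
    ultimately have "((\<lambda>w. \<phi> (w * cis \<theta>)) has_field_derivative deriv \<phi> (?z s) * cis \<theta>) (at (of_real s))"
      by (rule DERIV_chain2)
    from has_vector_derivative_real_field[OF this]
    show "((\<lambda>s. \<phi> (?z s)) has_vector_derivative deriv \<phi> (?z s) * cis \<theta>) (at s within {\<delta>..r})" .
  qed
  moreover have contn: "continuous_on {\<delta>..r} (\<lambda>s. cmod (deriv \<phi> (?z s)))" using cont by (intro continuous_intros)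
  ultimately have "cmod (\<phi> (?z r) - \<phi> (?z \<delta>)) \<le> integral {\<delta>..r} (\<lambda>s. cmod (deriv \<phi> (?z s)))"
    using integral_norm_bound_integral[OF has_integral_integrable integrable_continuous_real[OF contn]]
    by (metis (no_types, lifting) integral_unique norm_cis norm_mult mult.right_neutral order_refl)
  moreover have int: "set_integrable lborel {\<delta>..r} (\<lambda>s. cmod (deriv \<phi> (?z s)))"
    unfolding set_integrable_def by (rule borel_integrable_compact[OF _ contn]) simp
  then have "ennreal (integral {\<delta>..r} (\<lambda>s. cmod (deriv \<phi> (?z s)))) = (\<integral>\<^sup>+s\<in>{\<delta>..r}. ennreal (cmod (deriv \<phi> (?z s))) \<partial>lborel)"
  proof -
    have "(\<integral>\<^sup>+s\<in>{\<delta>..r}. ennreal (cmod (deriv \<phi> (?z s))) \<partial>lborel)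
      = (\<integral>\<^sup>+s. ennreal (indicator {\<delta>..r} s *\<^sub>R cmod (deriv \<phi> (?z s))) \<partial>lborel)"
      by (intro nn_integral_cong) (auto simp: indicator_def)
    also have "\<dots> = ennreal (LINT s:{\<delta>..r}|lborel. cmod (deriv \<phi> (?z s)))"
      unfolding set_lebesgue_integral_def
      using int by (intro nn_integral_eq_integral) (auto simp: set_integrable_def)
    finally show ?thesis using set_borel_integral_eq_integral(2)[OF int] by simp
  qed
  moreover have "cmod (\<phi> (?z r)) \<le> cmod (\<phi> (?z \<delta>)) + cmod (\<phi> (?z r) - \<phi> (?z \<delta>))"
    using norm_triangle_ineq[of "\<phi> (?z \<delta>)" "\<phi> (?z r) - \<phi> (?z \<delta>)"] by simp
  ultimately have "ennreal (cmod (\<phi> (?z r))) \<le> ennreal (cmod (\<phi> (?z \<delta>)) + integral {\<delta>..r} (\<lambda>s. cmod (deriv \<phi> (?z s))))"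
    by (intro ennreal_leI) linarith
  also have "\<dots> = ennreal (cmod (\<phi> (?z \<delta>))) + ennreal (integral {\<delta>..r} (\<lambda>s. cmod (deriv \<phi> (?z s))))"
    by (intro ennreal_plus integral_nonneg integrable_continuous_real contn) auto
  finally show ?thesis
    using \<open>ennreal (integral {\<delta>..r} (\<lambda>s. cmod (deriv \<phi> (?z s)))) = _\<close> by simp
qed

lemma nn_integral_inverse_square:
  assumes "a > 0"
  shows "(\<integral>\<^sup>+r\<in>{a..}. ennreal (1 / r\<^sup>2) \<partial>lborel) = ennreal (1 / a)"
proof -
  have "(\<integral>\<^sup>+r. ennreal (1 / r\<^sup>2) * indicator {a..} r \<partial>lborel) = ennreal (0 - (- 1 / a))"
  proof (rule nn_integral_FTC_atLeast)
    fix x assume "a \<le> x"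
    then show "((\<lambda>x. - 1 / x) has_real_derivative 1 / x\<^sup>2) (at x)"
      using assms by (auto intro!: derivative_eq_intros simp: power2_eq_square)
  next
    show "((\<lambda>x::real. - 1 / x) \<longlongrightarrow> 0) at_top" by real_asymp
  qed auto
  then show ?thesis by simp
qed

text \<open>Tonelli over the region \<open>\<delta> \<le> s \<le> r\<close>, where the integral of
  \<open>1 / r^2\<close> from \<open>s\<close> to infinity is \<open>1 / s\<close>. For integrable
  functions Hardy's inequality is thus an identity.\<close>

lemma Hardy_tail:
  fixes E :: "real \<Rightarrow> ennreal"
  assumes [measurable]: "E \<in> borel_measurable borel" and \<delta>: "0 < \<delta>"
  shows "(\<integral>\<^sup>+r\<in>{\<delta>..}. ennreal (1 / r\<^sup>2) * (\<integral>\<^sup>+s\<in>{\<delta>..r}. E s \<partial>lborel) \<partial>lborel)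
    = (\<integral>\<^sup>+s\<in>{\<delta>..}. E s * ennreal (1 / s) \<partial>lborel)"
proof -
  let ?K = "\<lambda>r s. if \<delta> \<le> s \<and> s \<le> r then ennreal (1 / r\<^sup>2) * E s else 0"
  have "(\<integral>\<^sup>+r\<in>{\<delta>..}. ennreal (1 / r\<^sup>2) * (\<integral>\<^sup>+s\<in>{\<delta>..r}. E s \<partial>lborel) \<partial>lborel)
    = (\<integral>\<^sup>+r. \<integral>\<^sup>+s. ?K r s \<partial>lborel \<partial>lborel)"
  proof (rule nn_integral_cong)
    fix r :: real
    have "ennreal (1 / r\<^sup>2) * (\<integral>\<^sup>+s\<in>{\<delta>..r}. E s \<partial>lborel) = (\<integral>\<^sup>+s. ennreal (1 / r\<^sup>2) * (E s * indicator {\<delta>..r} s) \<partial>lborel)"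
      by (rule nn_integral_cmult[symmetric]) measurable
    also have "\<dots> = (\<integral>\<^sup>+s. ?K r s \<partial>lborel)"
      by (intro nn_integral_cong) (auto simp: indicator_def)
    finally have eq: "ennreal (1 / r\<^sup>2) * (\<integral>\<^sup>+s\<in>{\<delta>..r}. E s \<partial>lborel) = (\<integral>\<^sup>+s. ?K r s \<partial>lborel)" .
    show "ennreal (1 / r\<^sup>2) * (\<integral>\<^sup>+s\<in>{\<delta>..r}. E s \<partial>lborel) * indicator {\<delta>..} r = (\<integral>\<^sup>+s. ?K r s \<partial>lborel)"
    proof (cases "\<delta> \<le> r")
      case True
      then show ?thesis using eq by simp
    next
      case False
      then have "(\<lambda>s. ?K r s) = (\<lambda>s. 0)" by auto
      then show ?thesis using False by simp
    qed
  qed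
  also have "\<dots> = (\<integral>\<^sup>+s. \<integral>\<^sup>+r. ?K r s \<partial>lborel \<partial>lborel)"
    by (rule lborel_pair.Fubini') measurable
  also have "\<dots> = (\<integral>\<^sup>+s\<in>{\<delta>..}. E s * ennreal (1 / s) \<partial>lborel)"
  proof (rule nn_integral_cong)
    fix s :: real
    show "(\<integral>\<^sup>+r. ?K r s \<partial>lborel) = E s * ennreal (1 / s) * indicator {\<delta>..} s"
    proof (cases "\<delta> \<le> s")
      case True
      have "(\<integral>\<^sup>+r. ?K r s \<partial>lborel) = (\<integral>\<^sup>+r. E s * (ennreal (1 / r\<^sup>2) * indicator {s..} r) \<partial>lborel)"
        using True by (intro nn_integral_cong) (auto simp: indicator_def mult.commute)
      also have "\<dots> = E s * (\<integral>\<^sup>+r. ennreal (1 / r\<^sup>2) * indicator {s..} r \<partial>lborel)"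
        by (rule nn_integral_cmult) measurable
      also have "\<dots> = E s * ennreal (1 / s)"
        using nn_integral_inverse_square[of s] True \<delta> by simp
      finally show ?thesis using True by simp
    qed simp
  qed
  finally show ?thesis .
qed

text \<open>Beyond \<open>\<delta>\<close> the value at \<open>- x\<close> is dominated by the value
  on the ray, which in turn is a constant plus an integral of the derivative; the constant is
  integrable against \<open>1 / x^2\<close>, and Hardy's identity takes care of the rest. Up to
  \<open>\<delta>\<close> the function is bounded.\<close>

lemma growth_of_ray_integral:
  assumes rep: "represents \<mu> \<phi>" and \<theta>: "0 < \<theta>" "\<theta> < pi" and \<delta>: "0 < \<delta>"
    and fin: "(\<integral>\<^sup>+r\<in>{\<delta>..}. ennreal (cmod (deriv \<phi> (of_real r * cis \<theta>))) * ennreal (1 / r) \<partial>lborel) < \<infinity>"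
  shows "growth_condition \<phi>"
proof -
  have \<mu>: "OM_measure \<mu>" using rep by (simp add: represents_def)
  let ?z = "\<lambda>s. of_real s * cis \<theta>"
  define s where "s = sin (\<theta> / 2)"
  have s: "s > 0" unfolding s_def using \<theta> by (intro sin_gt_zero) auto
  define E where "E r = ennreal (indicator {\<delta>..} r *\<^sub>R cmod (deriv \<phi> (?z r)))" for r
  have off: "?z r \<in> - complex_of_real ` {0..}" if "r > 0" for r
    using that sin_gt_zero[OF \<theta>] by (auto simp: complex_eq_iff)
  have cont: "continuous_on {\<delta>..} (\<lambda>r. cmod (deriv \<phi> (?z r)))"
  proof (rule continuous_on_norm, rule continuous_on_compose2[OF holomorphic_on_imp_continuous_on[OF
            holomorphic_deriv[OF OM_holomorphic[OF rep] open_off_positive_axis]]])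
    show "continuous_on {\<delta>..} ?z" by (intro continuous_intros)
    show "?z ` {\<delta>..} \<subseteq> - complex_of_real ` {0..}" by (intro image_subsetI off) (use \<delta> in auto)
  qed
  have E_meas [measurable]: "E \<in> borel_measurable borel"
    unfolding E_def[abs_def]
    using set_measurable_continuous_on[OF _ cont] by (simp add: set_borel_measurable_def)
  \<comment> \<open>The bound rests on \<open>x / (t + x) \<le> (1 + \<delta>) / (1 + t)\<close>,
    valid for \<open>0 < x \<le> \<delta>\<close>.\<close>
  define B where "B = (\<integral>t. (1 + \<delta>) / (1 + t) \<partial>\<mu>)"
  have B0: "0 \<le> B" unfolding B_def using \<delta> by (intro integral_nonneg_AE AE_I2) (auto simp: space_OM[OF \<mu>])
  have small: "cmod (\<phi> (of_real (- x))) \<le> B" if x: "0 \<le> x" "x \<le> \<delta>" for x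
  proof (cases "x = 0")
    case True
    have "0 \<in> - complex_of_real ` {0<..}" by auto
    then have "\<phi> 0 = (\<integral>t. 0 / (of_real t - 0) \<partial>\<mu>)" using rep unfolding represents_def by blast
    then show ?thesis using True B0 by simp
  next
    case False
    then have x0: "x > 0" using x by simp
    have int: "integrable \<mu> (\<lambda>t. (1 + \<delta>) / (1 + t))"
      by (rule integrable_OM[OF \<mu>, where C = "1 + \<delta>"]) (use \<delta> in \<open>auto intro!: borel_measurable_OM[OF \<mu>]\<close>)
    have le: "x / (t + x) \<le> (1 + \<delta>) / (1 + t)" if t: "t > 0" for t
    proof -
      have "x * (1 + t) \<le> (1 + \<delta>) * (t + x)"
      proof -
        have "x * t \<le> \<delta> * t" using x t by (intro mult_right_mono) auto
        moreover have "0 \<le> \<delta> * x" using x0 \<delta> by simp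
        ultimately show ?thesis using t by (simp only: distrib_left distrib_right mult_1 mult_1_right)
      qed
      then show ?thesis using t x0 by (simp add: field_simps)
    qed
    show ?thesis unfolding cmod_OM_negative(2)[OF rep x0] B_def
    proof (rule integral_mono[OF _ int])
      show "integrable \<mu> (\<lambda>t. x / (t + x))"
        by (rule integrable_OM[OF \<mu>, where C = "1 + \<delta>"])
           (use le x0 in \<open>auto intro!: borel_measurable_OM[OF \<mu>]\<close>)
    qed (use le in \<open>auto simp: space_OM[OF \<mu>]\<close>)
  qed
  define G where "G = ennreal (cmod (\<phi> (?z \<delta>)))"
  have large: "ennreal (cmod (\<phi> (of_real (- x))) / (1 + x\<^sup>2)) \<le>
      ennreal (1 / s) * (ennreal (1 / x\<^sup>2) * (G + (\<integral>\<^sup>+r\<in>{\<delta>..x}. E r \<partial>lborel)))" if x: "x \<ge> \<delta>" for x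
  proof -
    have x0: "x > 0" using x \<delta> by simp
    have "cmod (\<phi> (of_real (- x))) / (1 + x\<^sup>2) \<le> (1 / s * cmod (\<phi> (?z x))) / x\<^sup>2"
    proof (rule frac_le)
      show "cmod (\<phi> (of_real (- x))) \<le> 1 / s * cmod (\<phi> (?z x))"
        using OM_ray_lower[OF rep \<theta> x0] s by (simp add: s_def[symmetric] field_simps)
    qed (use x0 s in auto)
    then have "ennreal (cmod (\<phi> (of_real (- x))) / (1 + x\<^sup>2)) \<le> ennreal (1 / s * (1 / x\<^sup>2 * cmod (\<phi> (?z x))))"
      by (intro ennreal_leI) simp
    also have "\<dots> = ennreal (1 / s) * (ennreal (1 / x\<^sup>2) * ennreal (cmod (\<phi> (?z x))))"
      using s by (simp add: ennreal_mult' flip: ennreal_mult)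
    also have "\<dots> \<le> ennreal (1 / s) * (ennreal (1 / x\<^sup>2) * (G + (\<integral>\<^sup>+r\<in>{\<delta>..x}. E r \<partial>lborel)))"
    proof (intro mult_left_mono)
      have "(\<integral>\<^sup>+r\<in>{\<delta>..x}. ennreal (cmod (deriv \<phi> (?z r))) \<partial>lborel) = (\<integral>\<^sup>+r\<in>{\<delta>..x}. E r \<partial>lborel)"
        by (intro nn_integral_cong) (auto simp: E_def indicator_def)
      then show "ennreal (cmod (\<phi> (?z x))) \<le> G + (\<integral>\<^sup>+r\<in>{\<delta>..x}. E r \<partial>lborel)"
        using radial_increment_bound[OF rep \<theta> \<delta> x] by (simp add: G_def)
    qed auto
    finally show ?thesis .
  qed
  let ?H = "\<lambda>x. ennreal (1 / x\<^sup>2) * G * indicator {\<delta>..} x + ennreal (1 / x\<^sup>2) * (\<integral>\<^sup>+r\<in>{\<delta>..x}. E r \<partial>lborel) * indicator {\<delta>..} x"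
  have Hm1 [measurable]: "(\<lambda>x::real. ennreal (1 / x\<^sup>2) * G * indicator {\<delta>..} x) \<in> borel_measurable lborel" by measurable
  have Em: "(\<lambda>x. \<integral>\<^sup>+r\<in>{\<delta>..x}. E r \<partial>lborel) \<in> borel_measurable lborel"
  proof -
    \<comment> \<open>With the moving upper limit written as a condition, the integrand is jointly
      measurable, and measurability in \<open>x\<close> follows from that.\<close>
    have "(\<lambda>x. \<integral>\<^sup>+r. (if \<delta> \<le> r \<and> r \<le> x then E r else 0) \<partial>lborel) \<in> borel_measurable lborel"
      by (rule lborel.borel_measurable_nn_integral) measurable
    moreover have "(\<integral>\<^sup>+r\<in>{\<delta>..x}. E r \<partial>lborel) = (\<integral>\<^sup>+r. (if \<delta> \<le> r \<and> r \<le> x then E r else 0) \<partial>lborel)" for x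
      by (intro nn_integral_cong) (auto simp: indicator_def)
    ultimately show ?thesis by simp
  qed
  have Hm2 [measurable]: "(\<lambda>x::real. ennreal (1 / x\<^sup>2) * (\<integral>\<^sup>+r\<in>{\<delta>..x}. E r \<partial>lborel) * indicator {\<delta>..} x) \<in> borel_measurable lborel"
    using Em by measurable
  have Hfin: "(\<integral>\<^sup>+x. ?H x \<partial>lborel) < \<infinity>"
  proof -
    have "(\<integral>\<^sup>+x. ennreal (1 / x\<^sup>2) * G * indicator {\<delta>..} x \<partial>lborel) = (\<integral>\<^sup>+x. G * (ennreal (1 / x\<^sup>2) * indicator {\<delta>..} x) \<partial>lborel)"
      by (intro nn_integral_cong) (simp add: mult_ac)
    also have "\<dots> = G * (\<integral>\<^sup>+x\<in>{\<delta>..}. ennreal (1 / x\<^sup>2) \<partial>lborel)" by (rule nn_integral_cmult) measurable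
    also have "\<dots> < \<infinity>" using nn_integral_inverse_square[OF \<delta>] by (simp add: G_def ennreal_mult_less_top)
    finally have 1: "(\<integral>\<^sup>+x. ennreal (1 / x\<^sup>2) * G * indicator {\<delta>..} x \<partial>lborel) < \<infinity>" .
    have "(\<integral>\<^sup>+r\<in>{\<delta>..}. E r * ennreal (1 / r) \<partial>lborel)
      = (\<integral>\<^sup>+r\<in>{\<delta>..}. ennreal (cmod (deriv \<phi> (?z r))) * ennreal (1 / r) \<partial>lborel)"
      by (intro nn_integral_cong) (auto simp: E_def indicator_def)
    then have 2: "(\<integral>\<^sup>+x. ennreal (1 / x\<^sup>2) * (\<integral>\<^sup>+r\<in>{\<delta>..x}. E r \<partial>lborel) * indicator {\<delta>..} x \<partial>lborel) < \<infinity>"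
      using Hardy_tail[OF E_meas \<delta>] fin by simp
    show ?thesis using 1 2 by (subst nn_integral_add) auto
  qed
  have "(\<integral>\<^sup>+x\<in>{0..}. ennreal (cmod (\<phi> (of_real (- x))) / (1 + x\<^sup>2)) \<partial>lborel)
     \<le> (\<integral>\<^sup>+x. ennreal B * indicator {0..\<delta>} x + ennreal (1 / s) * ?H x \<partial>lborel)"
  proof (rule nn_integral_mono)
    fix x :: real
    show "ennreal (cmod (\<phi> (of_real (- x))) / (1 + x\<^sup>2)) * indicator {0..} x
      \<le> ennreal B * indicator {0..\<delta>} x + ennreal (1 / s) * ?H x"
    proof (cases "0 \<le> x \<and> x \<le> \<delta>")
      case True
      have "cmod (\<phi> (of_real (- x))) / (1 + x\<^sup>2) \<le> B / 1" using small True by (intro frac_le) (auto intro: B0)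
      then have "ennreal (cmod (\<phi> (of_real (- x))) / (1 + x\<^sup>2)) * indicator {0..} x \<le> ennreal B * indicator {0..\<delta>} x"
        using True by (simp add: ennreal_leI)
      also have "\<dots> \<le> ennreal B * indicator {0..\<delta>} x + ennreal (1 / s) * ?H x" by simp
      finally show ?thesis .
    next
      case False
      show ?thesis
      proof (cases "x < 0")
        case True
        then show ?thesis by simp
      next
        case False
        then have x: "\<delta> \<le> x" "0 \<le> x" using \<open>\<not> (0 \<le> x \<and> x \<le> \<delta>)\<close> by auto
        have "ennreal (cmod (\<phi> (of_real (- x))) / (1 + x\<^sup>2)) * indicator {0..} x \<le> ennreal (1 / s) * ?H x"
          using large[OF x(1)] x by (simp add: distrib_left)
        also have "\<dots> \<le> ennreal B * indicator {0..\<delta>} x + ennreal (1 / s) * ?H x" by simp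
        finally show ?thesis .
      qed
    qed
  qed
  also have "\<dots> = (\<integral>\<^sup>+x. ennreal B * indicator {0..\<delta>} x \<partial>lborel) + (\<integral>\<^sup>+x. ennreal (1 / s) * ?H x \<partial>lborel)"
    by (intro nn_integral_add) measurable
  also have "(\<integral>\<^sup>+x. ennreal (1 / s) * ?H x \<partial>lborel) = ennreal (1 / s) * (\<integral>\<^sup>+x. ?H x \<partial>lborel)"
    by (intro nn_integral_cmult) measurable
  also have "(\<integral>\<^sup>+x. ennreal B * indicator {0..\<delta>} x \<partial>lborel) = ennreal B * ennreal \<delta>"
    using \<delta> by (subst nn_integral_cmult_indicator) auto
  also have "ennreal B * ennreal \<delta> + ennreal (1 / s) * (\<integral>\<^sup>+x. ?H x \<partial>lborel) < \<infinity>"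
    using Hfin by (simp add: ennreal_mult_less_top)
  finally show ?thesis by (simp add: growth_condition_def)
qed

text \<open>The formula contains absolute integrability on the ray of argument
  \<open>\<theta>\<close>. There \<open>\<xi>\<close> is the explicit difference of logarithms, of
  size at least \<open>1 / (3 * (r + 2))\<close>, so the modulus of the derivative divided by
  \<open>r\<close> is integrable too.\<close>

lemma growth_of_LK_formula:
  assumes \<phi>: "\<phi> \<in> OM_minus" and \<theta>: "0 < \<theta>" "\<theta> < pi / 2" and \<delta>: "0 < \<delta>"
    and \<xi>: "shift_continuation (mult_oper (-1)) (mult_oper (-2)) \<theta> \<delta> \<xi>"
    and LK: "LK_formula (mult_oper (-1)) (mult_oper (-2)) \<theta> \<delta> \<xi> \<phi>"
  shows "growth_condition \<phi>"
proof -
  have rep: "represents (repr_measure \<phi>) \<phi>" by (rule represents_repr_measure[OF \<phi>])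
  let ?z = "\<lambda>s. of_real s * cis \<theta>"
  let ?F = "\<lambda>z. Ln (z + 1) - Ln (z + 2)"
  have F: "?F holomorphic_on {z. 0 < Re z}"
    by (intro holomorphic_intros) (auto simp: complex_nonpos_Reals_iff)
  have ray: "\<xi> (?z r) = ?F (?z r)" if "r > 0" for r
    using \<xi> spectral_shift_mult_oper
    by (intro continuation_on_ray(1)[OF \<theta> _ F _ that]) (auto simp: shift_continuation_def)
  have low: "1 / (3 * (r + 2)) \<le> cmod (\<xi> (?z r))" if r: "r > 0" for r
  proof -
    have "0 < Re (?z r)" using r \<theta> by (simp add: cos_gt_zero)
    from Ln_difference_lower[OF this] show ?thesis using r by (simp add: ray norm_mult)
  qed
  let ?E = "\<lambda>r. cmod (deriv \<phi> (?z r))"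
  have "set_integrable lborel {\<delta>..} (\<lambda>r. \<xi> (?z r) * deriv \<phi> (?z r) * cis \<theta>)"
    using LK by (simp add: LK_formula_def Gamma_integrable_def)
  then have I: "(\<integral>\<^sup>+r. ennreal (norm (indicator {\<delta>..} r *\<^sub>R (\<xi> (?z r) * deriv \<phi> (?z r) * cis \<theta>))) \<partial>lborel) < \<infinity>"
    and meas: "(\<lambda>r. indicator {\<delta>..} r *\<^sub>R (\<xi> (?z r) * deriv \<phi> (?z r) * cis \<theta>)) \<in> borel_measurable lborel"
    by (auto simp: set_integrable_def integrable_iff_bounded)
  \<comment> \<open>Chosen so that \<open>r + 2 \<le> k * r\<close> for all
    \<open>r \<ge> \<delta>\<close>; the 3 in \<open>C\<close> is the constant of
    \<open>Ln_difference_lower\<close>.\<close>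
  define k where "k = 1 + 2 / \<delta>"
  define C where "C = 3 * k"
  have C: "C \<ge> 0" using \<delta> by (simp add: C_def k_def)
  have "(\<integral>\<^sup>+r\<in>{\<delta>..}. ennreal (?E r) * ennreal (1 / r) \<partial>lborel) \<le>
    (\<integral>\<^sup>+r. ennreal C * ennreal (norm (indicator {\<delta>..} r *\<^sub>R (\<xi> (?z r) * deriv \<phi> (?z r) * cis \<theta>))) \<partial>lborel)"
  proof (rule nn_integral_mono)
    fix r :: real
    show "ennreal (?E r) * ennreal (1 / r) * indicator {\<delta>..} r \<le>
      ennreal C * ennreal (norm (indicator {\<delta>..} r *\<^sub>R (\<xi> (?z r) * deriv \<phi> (?z r) * cis \<theta>)))"
    proof (cases "\<delta> \<le> r")
      case True
      then have r: "r > 0" using \<delta> by simp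
      have "2 / \<delta> * r \<ge> 2" using True \<delta> by (simp add: field_simps)
      then have "r + 2 \<le> k * r" by (simp add: k_def distrib_right)
      then have "1 / r \<le> C * (1 / (3 * (r + 2)))" using r by (simp add: C_def field_simps)
      also have "\<dots> \<le> C * cmod (\<xi> (?z r))" using C by (intro mult_left_mono low[OF r])
      finally have "?E r * (1 / r) \<le> ?E r * (C * cmod (\<xi> (?z r)))" by (rule mult_left_mono) simp
      then have "ennreal (?E r * (1 / r)) \<le> ennreal (C * norm (indicator {\<delta>..} r *\<^sub>R (\<xi> (?z r) * deriv \<phi> (?z r) * cis \<theta>)))"
        using True by (intro ennreal_leI) (simp add: norm_mult mult_ac)
      moreover have "ennreal (?E r) * ennreal (1 / r) = ennreal (?E r * (1 / r))"
        using r by (intro ennreal_mult[symmetric]) auto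
      ultimately show ?thesis using True C by (simp only: ennreal_mult'[symmetric] atLeast_iff indicator_simps mult_1_right)
    qed simp
  qed
  also have "\<dots> = ennreal C * (\<integral>\<^sup>+r. ennreal (norm (indicator {\<delta>..} r *\<^sub>R (\<xi> (?z r) * deriv \<phi> (?z r) * cis \<theta>))) \<partial>lborel)"
    by (rule nn_integral_cmult[OF measurable_compose[OF measurable_compose[OF meas borel_measurable_norm] measurable_ennreal]])
  also have "\<dots> < \<infinity>" using I by (simp add: ennreal_mult_less_top)
  finally show ?thesis using \<theta> by (intro growth_of_ray_integral[OF rep _ _ \<delta>, where \<theta> = \<theta>]) auto
qed

theorem theorem4p2:
  shows
    "(approximation_property TYPE('a::complex_banach) \<longrightarrow>
       (\<forall>A B :: 'a oper.
          negative_oper A \<longrightarrow> negative_oper B \<longrightarrow> Domain A \<subseteq> Domain B \<longrightarrow>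
          nuclear_difference (Domain A) A B \<longrightarrow>
          (\<exists>\<theta> \<delta> \<xi>. 0 < \<theta> \<and> \<theta> < pi / 2 \<and> 0 < \<delta> \<and> shift_continuation A B \<theta> \<delta> \<xi> \<and>
             (\<forall>\<phi>\<in>OM_minus. deriv_at_minus_zero \<phi> \<noteq> \<infinity> \<longrightarrow> growth_condition \<phi> \<longrightarrow>
                LK_formula A B \<theta> \<delta> \<xi> \<phi>))))
     \<and>
     (\<forall>\<phi>\<in>OM_minus. deriv_at_minus_zero \<phi> \<noteq> \<infinity> \<longrightarrow>
        (\<forall>A B :: complex oper. negative_oper A \<longrightarrow> negative_oper B \<longrightarrow>
           (\<exists>\<theta> \<delta> \<xi>. 0 < \<theta> \<and> \<theta> < pi / 2 \<and> 0 < \<delta> \<and> shift_continuation A B \<theta> \<delta> \<xi> \<and>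
              LK_formula A B \<theta> \<delta> \<xi> \<phi>)) \<longrightarrow>
        growth_condition \<phi>)"
proof (intro conjI impI allI ballI)
  fix A B :: "'a oper"
  assume AP: "approximation_property TYPE('a)" and A: "negative_oper A" and B: "negative_oper B"
    and diff: "nuclear_difference (Domain A) A B"
  then show "\<exists>\<theta> \<delta> \<xi>. 0 < \<theta> \<and> \<theta> < pi / 2 \<and> 0 < \<delta> \<and> shift_continuation A B \<theta> \<delta> \<xi> \<and>
    (\<forall>\<phi>\<in>OM_minus. deriv_at_minus_zero \<phi> \<noteq> \<infinity> \<longrightarrow> growth_condition \<phi> \<longrightarrow> LK_formula A B \<theta> \<delta> \<xi> \<phi>)"
    using trace_formula[OF AP A B diff] by blast
next
  fix \<phi>
  assume \<phi>: "\<phi> \<in> OM_minus"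
    and LK: "\<forall>A B :: complex oper. negative_oper A \<longrightarrow> negative_oper B \<longrightarrow>
      (\<exists>\<theta> \<delta> \<xi>. 0 < \<theta> \<and> \<theta> < pi / 2 \<and> 0 < \<delta> \<and> shift_continuation A B \<theta> \<delta> \<xi> \<and> LK_formula A B \<theta> \<delta> \<xi> \<phi>)"
  have "negative_oper (mult_oper (-1))" "negative_oper (mult_oper (-2))"
    using negative_mult_oper[of 1] negative_mult_oper[of 2] by simp_all
  then show "growth_condition \<phi>"
    using LK growth_of_LK_formula[OF \<phi>] by blast
qed

end
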